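(* Let $(M,\omega)$ be a compact complex Hermitian manifold of dimension $k$. Let $\alpha_1,\ldots,\alpha_{k-1}$ be continuous $(1,0)$-forms on $M$. Then there exists a positive current $T$ on $M$, of mass $1$ and of bidimension $(1,1)$, such that $T\wedge\alpha_j=0$ for $j=1,\ldots,k-1$, and $i\partial\overline\partial T=0$.
   Context: The mass of a positive current $T$ of bidimension $(1,1)$ on $M$ is $\int_M T\wedge\omega$, where $\omega$ is the (not necessarily closed) Hermitian $(1,1)$-form. Positive currents have measure coefficients, so $T\wedge\alpha_j$ is well defined for continuous $\alpha_j$. No integrability (Frobenius) condition on the $\alpha_j$ is assumed. *)

theory Defs
  imports "HOL-Analysis.Analysis" "HOL-Library.Nonpos_Ints"
begin

text \<open>
  A complex manifold of dimension \<open>k = CARD('k)\<close> is a Hausdorff type \<open>'m\<close> together with a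
  holomorphic atlas on it.  A chart is a pair \<open>(U, z)\<close>; outside \<open>U\<close> the values of \<open>z\<close> are
  irrelevant.
\<close>

type_synonym ('m, 'k) chart = "'m set \<times> ('m \<Rightarrow> complex ^ 'k)"

definition is_chart :: "('m::topological_space, 'k::finite) chart \<Rightarrow> bool" where
  "is_chart c \<longleftrightarrow> open (fst c) \<and> open (snd c ` fst c) \<and>
     (\<exists>g. homeomorphism (fst c) (snd c ` fst c) (snd c) g)"

definition chart_image :: "('m, 'k::finite) chart \<Rightarrow> (complex ^ 'k) set" where
  "chart_image c = snd c ` fst c"

definition chart_inv :: "('m, 'k::finite) chart \<Rightarrow> complex ^ 'k \<Rightarrow> 'm" where
  "chart_inv c = inv_into (fst c) (snd c)"

definition transition ::
    "('m, 'k::finite) chart \<Rightarrow> ('m, 'k) chart \<Rightarrow> complex ^ 'k \<Rightarrow> complex ^ 'k" where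
  "transition c c' = snd c' \<circ> chart_inv c"

text \<open>Holomorphy in several variables, for open \<open>S\<close>: the Frechet derivative is complex linear.\<close>

definition holomorphic_map_on ::
    "(complex ^ 'k::finite \<Rightarrow> complex ^ 'l::finite) \<Rightarrow> (complex ^ 'k) set \<Rightarrow> bool" where
  "holomorphic_map_on F S \<longleftrightarrow>
     (\<forall>x\<in>S. \<exists>D. (F has_derivative D) (at x) \<and> (\<forall>a v. D (a *s v) = a *s D v))"

definition complex_atlas :: "('m::topological_space, 'k::finite) chart set \<Rightarrow> bool" where
  "complex_atlas A \<longleftrightarrow>
     (\<forall>c\<in>A. is_chart c) \<and> (\<Union>c\<in>A. fst c) = UNIV \<and>
     (\<forall>c\<in>A. \<forall>c'\<in>A. holomorphic_map_on (transition c c') (snd c ` (fst c \<inter> fst c')))"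

definition compact_complex_manifold :: "('m::t2_space, 'k::finite) chart set \<Rightarrow> bool" where
  "compact_complex_manifold A \<longleftrightarrow> complex_atlas A \<and> compact (UNIV :: 'm set)"

definition transition_deriv ::
    "('m, 'k::finite) chart \<Rightarrow> ('m, 'k) chart \<Rightarrow> 'm \<Rightarrow> complex ^ 'k \<Rightarrow> complex ^ 'k" where
  "transition_deriv c c' p = frechet_derivative (transition c c') (at (snd c p))"


text \<open>
  \<open>iter_deriv [v\<^sub>1, \<dots>, v\<^sub>r] f\<close> is the iterated directional derivative of \<open>f\<close>, in the constant
  real directions \<open>v\<^sub>1\<close>, then \<open>v\<^sub>2\<close>, and so on.  On an open set \<open>S\<close>, \<open>smooth_on\<close> is \<open>C\<^sup>\<infinity>\<close>:
  differentiability at one order gives continuity of the derivatives of the order below.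
\<close>

fun iter_deriv ::
    "'a::real_normed_vector list \<Rightarrow> ('a \<Rightarrow> 'b::real_normed_vector) \<Rightarrow> 'a \<Rightarrow> 'b" where
  "iter_deriv [] f = f"
| "iter_deriv (v # vs) f = iter_deriv vs (\<lambda>x. frechet_derivative f (at x) v)"

definition smooth_on ::
    "'a::real_normed_vector set \<Rightarrow> ('a \<Rightarrow> 'b::real_normed_vector) \<Rightarrow> bool" where
  "smooth_on S f \<longleftrightarrow> (\<forall>vs. \<forall>x\<in>S. iter_deriv vs f differentiable (at x))"

definition smooth_function ::
    "('m, 'k::finite) chart set \<Rightarrow> ('m \<Rightarrow> complex) \<Rightarrow> bool" where
  "smooth_function A f \<longleftrightarrow> (\<forall>c\<in>A. smooth_on (chart_image c) (f \<circ> chart_inv c))"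


text \<open>
  A form is given by its coefficients in every chart \<open>(U, z)\<close> of the atlas at every point of \<open>U\<close>:
  those of \<open>dz\<^sub>a\<close>, of \<open>d\<close>conj\<open>(z\<^sub>b)\<close>, and of \<open>dz\<^sub>a \<and> d\<close>conj\<open>(z\<^sub>b)\<close> respectively (no factor
  \<open>i\<close> or \<open>i/2\<close> is included).  The coefficients in overlapping charts are related by the derivative
  of the change of coordinates, and they are set to \<open>0\<close> where they have no meaning, so that two
  forms are equal iff they are equal as functions.
\<close>

type_synonym ('m, 'k) one_form = "('m, 'k) chart \<Rightarrow> 'm \<Rightarrow> complex ^ 'k"
type_synonym ('m, 'k) two_form = "('m, 'k) chart \<Rightarrow> 'm \<Rightarrow> complex ^ 'k ^ 'k"

definition eval10 :: "complex ^ 'k::finite \<Rightarrow> complex ^ 'k \<Rightarrow> complex" where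
  "eval10 a v = (\<Sum>i\<in>UNIV. a $ i * v $ i)"

definition eval01 :: "complex ^ 'k::finite \<Rightarrow> complex ^ 'k \<Rightarrow> complex" where
  "eval01 b v = (\<Sum>i\<in>UNIV. b $ i * cnj (v $ i))"

definition eval11 :: "complex ^ 'k ^ 'k::finite \<Rightarrow> complex ^ 'k \<Rightarrow> complex ^ 'k \<Rightarrow> complex" where
  "eval11 h v w = (\<Sum>i\<in>UNIV. \<Sum>j\<in>UNIV. h $ i $ j * v $ i * cnj (w $ j))"

definition supported_on_atlas ::
    "('m, 'k::finite) chart set \<Rightarrow> (('m, 'k) chart \<Rightarrow> 'm \<Rightarrow> 'e::zero) \<Rightarrow> bool" where
  "supported_on_atlas A s \<longleftrightarrow> (\<forall>c p. \<not> (c \<in> A \<and> p \<in> fst c) \<longrightarrow> s c p = 0)"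

definition form10 :: "('m, 'k::finite) chart set \<Rightarrow> ('m, 'k) one_form \<Rightarrow> bool" where
  "form10 A \<alpha> \<longleftrightarrow> supported_on_atlas A \<alpha> \<and>
     (\<forall>c\<in>A. \<forall>c'\<in>A. \<forall>p\<in>fst c \<inter> fst c'. \<forall>v.
        eval10 (\<alpha> c p) v = eval10 (\<alpha> c' p) (transition_deriv c c' p v))"

definition form01 :: "('m, 'k::finite) chart set \<Rightarrow> ('m, 'k) one_form \<Rightarrow> bool" where
  "form01 A \<beta> \<longleftrightarrow> supported_on_atlas A \<beta> \<and>
     (\<forall>c\<in>A. \<forall>c'\<in>A. \<forall>p\<in>fst c \<inter> fst c'. \<forall>v.
        eval01 (\<beta> c p) v = eval01 (\<beta> c' p) (transition_deriv c c' p v))"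

definition form11 :: "('m, 'k::finite) chart set \<Rightarrow> ('m, 'k) two_form \<Rightarrow> bool" where
  "form11 A \<psi> \<longleftrightarrow> supported_on_atlas A \<psi> \<and>
     (\<forall>c\<in>A. \<forall>c'\<in>A. \<forall>p\<in>fst c \<inter> fst c'. \<forall>v w.
        eval11 (\<psi> c p) v w =
        eval11 (\<psi> c' p) (transition_deriv c c' p v) (transition_deriv c c' p w))"

definition continuous_coeffs ::
    "('m::topological_space, 'k::finite) chart set \<Rightarrow>
     (('m, 'k) chart \<Rightarrow> 'm \<Rightarrow> 'e::topological_space) \<Rightarrow> bool" where
  "continuous_coeffs A s \<longleftrightarrow> (\<forall>c\<in>A. continuous_on (fst c) (s c))"

definition smooth_coeffs ::
    "('m, 'k::finite) chart set \<Rightarrow>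
     (('m, 'k) chart \<Rightarrow> 'm \<Rightarrow> 'e::real_normed_vector) \<Rightarrow> bool" where
  "smooth_coeffs A s \<longleftrightarrow> (\<forall>c\<in>A. smooth_on (chart_image c) (s c \<circ> chart_inv c))"

definition continuous_form10 ::
    "('m::topological_space, 'k::finite) chart set \<Rightarrow> ('m, 'k) one_form \<Rightarrow> bool" where
  "continuous_form10 A \<alpha> \<longleftrightarrow> form10 A \<alpha> \<and> continuous_coeffs A \<alpha>"

definition smooth_form01 :: "('m, 'k::finite) chart set \<Rightarrow> ('m, 'k) one_form \<Rightarrow> bool" where
  "smooth_form01 A \<beta> \<longleftrightarrow> form01 A \<beta> \<and> smooth_coeffs A \<beta>"

definition smooth_form11 :: "('m, 'k::finite) chart set \<Rightarrow> ('m, 'k) two_form \<Rightarrow> bool" where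
  "smooth_form11 A \<psi> \<longleftrightarrow> form11 A \<psi> \<and> smooth_coeffs A \<psi>"

definition add11 :: "('m, 'k::finite) two_form \<Rightarrow> ('m, 'k) two_form \<Rightarrow> ('m, 'k) two_form" where
  "add11 \<psi> \<phi> = (\<lambda>c p. \<psi> c p + \<phi> c p)"

definition scale11 :: "complex \<Rightarrow> ('m, 'k::finite) two_form \<Rightarrow> ('m, 'k) two_form" where
  "scale11 a \<psi> = (\<lambda>c p. \<chi> i j. a * \<psi> c p $ i $ j)"

text \<open>The wedge product of a \<open>(1,0)\<close>-form and a \<open>(0,1)\<close>-form.\<close>

definition wedge :: "('m, 'k::finite) one_form \<Rightarrow> ('m, 'k) one_form \<Rightarrow> ('m, 'k) two_form" where
  "wedge \<alpha> \<beta> = (\<lambda>c p. \<chi> i j. \<alpha> c p $ i * \<beta> c p $ j)"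

text \<open>
  The form \<open>i \<Sum> h\<^sub>a\<^sub>b dz\<^sub>a \<and> d\<close>conj\<open>(z\<^sub>b)\<close> is positive iff the matrix \<open>h\<close> is Hermitian and positive
  semidefinite; over the complex numbers, the Hermitian property is implied by the realness of the
  values on the diagonal.  In particular \<open>i \<alpha> \<and>\<close> conj\<open>(\<alpha>)\<close> is positive.
\<close>

definition positive_form11 :: "('m, 'k::finite) chart set \<Rightarrow> ('m, 'k) two_form \<Rightarrow> bool" where
  "positive_form11 A \<psi> \<longleftrightarrow>
     (\<forall>c\<in>A. \<forall>p\<in>fst c. \<forall>v. - \<i> * eval11 (\<psi> c p) v v \<in> \<real>\<^sub>\<ge>\<^sub>0)"

definition hermitian_form :: "('m, 'k::finite) chart set \<Rightarrow> ('m, 'k) two_form \<Rightarrow> bool" where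
  "hermitian_form A \<omega> \<longleftrightarrow> smooth_form11 A \<omega> \<and>
     (\<forall>c\<in>A. \<forall>p\<in>fst c. \<forall>v. v \<noteq> 0 \<longrightarrow> - \<i> * eval11 (\<omega> c p) v v \<in> \<real>\<^sub>\<ge>\<^sub>0 - {0})"


definition wirtinger :: "'k::finite \<Rightarrow> (complex ^ 'k \<Rightarrow> complex) \<Rightarrow> complex ^ 'k \<Rightarrow> complex" where
  "wirtinger a g x =
     (frechet_derivative g (at x) (axis a 1) - \<i> * frechet_derivative g (at x) (axis a \<i>)) / 2"

definition wirtinger_bar :: "'k::finite \<Rightarrow> (complex ^ 'k \<Rightarrow> complex) \<Rightarrow> complex ^ 'k \<Rightarrow> complex" where
  "wirtinger_bar b g x =
     (frechet_derivative g (at x) (axis b 1) + \<i> * frechet_derivative g (at x) (axis b \<i>)) / 2"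

definition delbar :: "('m, 'k::finite) chart set \<Rightarrow> ('m \<Rightarrow> complex) \<Rightarrow> ('m, 'k) one_form" where
  "delbar A f = (\<lambda>c p. if c \<in> A \<and> p \<in> fst c
     then \<chi> b. wirtinger_bar b (f \<circ> chart_inv c) (snd c p) else 0)"

text \<open>The operator \<open>\<partial>\<close> from \<open>(0,1)\<close>-forms to \<open>(1,1)\<close>-forms.\<close>

definition del01 :: "('m, 'k::finite) chart set \<Rightarrow> ('m, 'k) one_form \<Rightarrow> ('m, 'k) two_form" where
  "del01 A \<beta> = (\<lambda>c p. if c \<in> A \<and> p \<in> fst c
     then \<chi> a b. wirtinger a (\<lambda>x. \<beta> c (chart_inv c x) $ b) (snd c p) else 0)"

definition i_del_delbar :: "('m, 'k::finite) chart set \<Rightarrow> ('m \<Rightarrow> complex) \<Rightarrow> ('m, 'k) two_form" where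
  "i_del_delbar A f = scale11 \<i> (del01 A (delbar A f))"


text \<open>
  Since \<open>M\<close> is compact, a current of bidimension \<open>(1,1)\<close> is a linear form on the smooth
  \<open>(1,1)\<close>-forms that is continuous for uniform convergence of all derivatives of the coefficients.
  This topology is metrizable, so continuity can be tested on null sequences.  Only the values of
  \<open>T\<close> on smooth \<open>(1,1)\<close>-forms are relevant.
\<close>

definition smooth_null_sequence ::
    "('m::topological_space, 'k::finite) chart set \<Rightarrow> (nat \<Rightarrow> ('m, 'k) two_form) \<Rightarrow> bool" where
  "smooth_null_sequence A \<Psi> \<longleftrightarrow>
     (\<forall>c\<in>A. \<forall>K vs. compact K \<and> K \<subseteq> chart_image c \<longrightarrow>
        uniform_limit K (\<lambda>n. iter_deriv vs (\<Psi> n c \<circ> chart_inv c)) (\<lambda>_. 0) sequentially)"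

definition current11 ::
    "('m::topological_space, 'k::finite) chart set \<Rightarrow> (('m, 'k) two_form \<Rightarrow> complex) \<Rightarrow> bool" where
  "current11 A T \<longleftrightarrow>
     (\<forall>\<psi> \<phi>. smooth_form11 A \<psi> \<and> smooth_form11 A \<phi> \<longrightarrow> T (add11 \<psi> \<phi>) = T \<psi> + T \<phi>) \<and>
     (\<forall>a \<psi>. smooth_form11 A \<psi> \<longrightarrow> T (scale11 a \<psi>) = a * T \<psi>) \<and>
     (\<forall>\<Psi>. (\<forall>n. smooth_form11 A (\<Psi> n)) \<and> smooth_null_sequence A \<Psi> \<longrightarrow>
        (\<lambda>n. T (\<Psi> n)) \<longlonglongrightarrow> 0)"

definition positive_current11 ::
    "('m::topological_space, 'k::finite) chart set \<Rightarrow> (('m, 'k) two_form \<Rightarrow> complex) \<Rightarrow> bool" where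
  "positive_current11 A T \<longleftrightarrow> current11 A T \<and>
     (\<forall>\<psi>. smooth_form11 A \<psi> \<and> positive_form11 A \<psi> \<longrightarrow> T \<psi> \<in> \<real>\<^sub>\<ge>\<^sub>0)"

text \<open>The mass, that is, the integral of \<open>T \<and> \<omega>\<close> over \<open>M\<close>.\<close>

definition current_mass :: "(('m, 'k::finite) two_form \<Rightarrow> complex) \<Rightarrow> ('m, 'k) two_form \<Rightarrow> complex"
  where "current_mass T \<omega> = T \<omega>"

text \<open>
  A positive current has measure coefficients, that is, it is continuous for uniform convergence of
  the coefficients.  As the smooth forms are dense in the continuous ones for this convergence, it
  extends uniquely by continuity to the continuous \<open>(1,1)\<close>-forms (this is the integration of
  the continuous coefficients against the measures).  The value of the extension at \<open>\<psi>\<close> is the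
  common limit of \<open>T\<close> along all sequences of smooth forms converging uniformly to \<open>\<psi>\<close>.
\<close>

definition uniform_form_limit ::
    "('m::topological_space, 'k::finite) chart set \<Rightarrow> (nat \<Rightarrow> ('m, 'k) two_form) \<Rightarrow>
     ('m, 'k) two_form \<Rightarrow> bool" where
  "uniform_form_limit A \<Psi> \<psi> \<longleftrightarrow>
     (\<forall>c\<in>A. \<forall>K. compact K \<and> K \<subseteq> fst c \<longrightarrow>
        uniform_limit K (\<lambda>n. \<Psi> n c) (\<psi> c) sequentially)"

definition continuous_extension ::
    "('m::topological_space, 'k::finite) chart set \<Rightarrow> (('m, 'k) two_form \<Rightarrow> complex) \<Rightarrow>
     ('m, 'k) two_form \<Rightarrow> complex" where
  "continuous_extension A T \<psi> =
     (THE z. \<forall>\<Psi>. (\<forall>n. smooth_form11 A (\<Psi> n)) \<and> uniform_form_limit A \<Psi> \<psi> \<longrightarrow>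
        (\<lambda>n. T (\<Psi> n)) \<longlonglongrightarrow> z)"

text \<open>
  \<open>T \<and> \<alpha>\<close>, for a continuous \<open>(1,0)\<close>-form \<open>\<alpha>\<close>, acts on smooth \<open>(0,1)\<close>-forms; the current
  \<open>i\<partial>\<close>conj\<open>(\<partial>)T\<close> acts on smooth functions.
\<close>

definition current_wedge ::
    "('m::topological_space, 'k::finite) chart set \<Rightarrow> (('m, 'k) two_form \<Rightarrow> complex) \<Rightarrow>
     ('m, 'k) one_form \<Rightarrow> ('m, 'k) one_form \<Rightarrow> complex" where
  "current_wedge A T \<alpha> \<beta> = continuous_extension A T (wedge \<alpha> \<beta>)"

definition i_del_delbar_current ::
    "('m, 'k::finite) chart set \<Rightarrow> (('m, 'k) two_form \<Rightarrow> complex) \<Rightarrow> ('m \<Rightarrow> complex) \<Rightarrow> complex" where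
  "i_del_delbar_current A T f = T (i_del_delbar A f)"

end

theory Submission
  imports Defs "HOL-Complex_Analysis.Cauchy_Integral_Formula"
begin

text \<open>
  Let \<open>X\<close> be the set of pairs \<open>(p, v)\<close> with \<open>v\<close> of unit length in the common kernel of the \<open>\<alpha>\<^sub>j\<close> at \<open>p\<close>,
  which is nonzero since there are fewer forms than dimensions.  A form \<open>\<psi>\<close> of bidegree \<open>(1,1)\<close>
  gives the function \<open>L \<psi>(p, v) = -i \<psi>(v, v)\<close> on \<open>X\<close>; for \<open>\<psi> = \<alpha>\<^sub>j \<and> \<beta>\<close> it vanishes, and for
  \<open>\<psi> = \<omega>\<close> it is \<open>1\<close>.  For a real smooth function \<open>f\<close> the maximum principle, applied at a minimum of
  \<open>f\<close>, shows that \<open>L(i\<partial>\<close>conj\<open>(\<partial>)f)\<close> is nonnegative somewhere.  Hence the sublinear functional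
  \<open>sup\<^sub>X\<close> is nonnegative on these functions, and by Hahn--Banach there is a linear functional \<open>m \<le> sup\<^sub>X\<close> that
  vanishes on them.  The current is \<open>T \<psi> = m (Re L \<psi>) + i m (Im L \<psi>)\<close>.
  That \<open>T \<and> \<alpha>\<^sub>j\<close> is given by the continuous extension of \<open>T\<close> requires smooth forms to be uniformly dense in
  the continuous ones, which reduces to the Stone--Weierstrass theorem for the algebra of smooth functions.
\<close>

subsection \<open>A Hahn--Banach argument for bounded functions\<close>

text \<open>The functional \<open>m\<close> is built on all bounded functions on \<open>X\<close>,
  hence is a finitely additive mean, and the arbitrary choice of one chart per point does no harm.
  The analysis then rests on uniform bounds: vectors of unit length for \<omega> have bounded
  coordinates, because the chosen charts come from finitely many compact balls, and a bound of
  \<open>m f\<close> by the supremum of the absolute value of \<open>f\<close> makes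
  \<open>T\<close> continuous already for uniform convergence of coefficients. Three features of the
  definitions shape the rest. Transition maps are given with one complex derivative, so bump
  functions become smooth in every chart only after Cauchy's formula has produced the higher
  derivatives. The extension of \<open>T\<close> to continuous forms is a definite description over
  approximating sequences, so convergence to 0 along all of them must be complemented by the
  existence of one. Test functions are complex: the maximum principle concerns \<open>Re f\<close>,
  and \<open>m\<close> is made to vanish on the real parts coming from all complex \<open>f\<close>;
  replacing \<open>f\<close> by \<open>-\<i> f\<close> then covers the imaginary parts.\<close>

definition bounded_real_on :: "'x set \<Rightarrow> ('x \<Rightarrow> real) \<Rightarrow> bool" where
  "bounded_real_on X f \<longleftrightarrow> (\<exists>b. \<forall>x\<in>X. \<bar>f x\<bar> \<le> b)"

lemma bounded_real_on_add:
  assumes "bounded_real_on X f" "bounded_real_on X g"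
  shows "bounded_real_on X (\<lambda>x. f x + g x)"
proof -
  obtain b c where "\<forall>x\<in>X. \<bar>f x\<bar> \<le> b" "\<forall>x\<in>X. \<bar>g x\<bar> \<le> c"
    using assms unfolding bounded_real_on_def by blast
  then have "\<forall>x\<in>X. \<bar>f x + g x\<bar> \<le> b + c" by (metis abs_triangle_ineq add_mono order_trans)
  then show ?thesis unfolding bounded_real_on_def by blast
qed

lemma bounded_real_on_mult:
  assumes "bounded_real_on X f"
  shows "bounded_real_on X (\<lambda>x. c * f x)"
proof -
  obtain b where "\<forall>x\<in>X. \<bar>f x\<bar> \<le> b" using assms unfolding bounded_real_on_def by blast
  then have "\<forall>x\<in>X. \<bar>c * f x\<bar> \<le> \<bar>c\<bar> * b" by (auto simp: abs_mult intro: mult_left_mono)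
  then show ?thesis unfolding bounded_real_on_def by blast
qed

text \<open>The value outside the bounded functions is fixed so that the pointwise order on sublinear
  functionals is antisymmetric.\<close>

definition sublinear_on :: "'x set \<Rightarrow> (('x \<Rightarrow> real) \<Rightarrow> real) \<Rightarrow> bool" where
  "sublinear_on X q \<longleftrightarrow>
     (\<forall>f g. bounded_real_on X f \<longrightarrow> bounded_real_on X g \<longrightarrow> q (\<lambda>x. f x + g x) \<le> q f + q g) \<and>
     (\<forall>f c. bounded_real_on X f \<longrightarrow> 0 < c \<longrightarrow> q (\<lambda>x. c * f x) = c * q f) \<and>
     (\<forall>f. \<not> bounded_real_on X f \<longrightarrow> q f = 0)"

lemma sublinear_zero:
  assumes "sublinear_on X q" shows "q (\<lambda>x. 0) = 0"
proof -
  have "bounded_real_on X (\<lambda>x. 0)" unfolding bounded_real_on_def by auto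
  moreover have "\<And>f c. bounded_real_on X f \<Longrightarrow> 0 < c \<Longrightarrow> q (\<lambda>x. c * f x) = c * q f"
    using assms unfolding sublinear_on_def by blast
  ultimately have "q (\<lambda>x. 2 * 0) = 2 * q (\<lambda>x. 0)" using zero_less_numeral by blast
  then show ?thesis by simp
qed

text \<open>This lower bound keeps the infimum over a chain of functionals finite, and it is one
  half of the oddness of a minimal functional.\<close>

lemma sublinear_minus:
  assumes "sublinear_on X q" "bounded_real_on X f" shows "- q (\<lambda>x. - f x) \<le> q f"
proof -
  have "bounded_real_on X (\<lambda>x. - f x)" using bounded_real_on_mult[OF assms(2), of "-1"] by simp
  then have "q (\<lambda>x. f x + - f x) \<le> q f + q (\<lambda>x. - f x)"
    using assms unfolding sublinear_on_def by blast
  then show ?thesis using sublinear_zero[OF assms(1)] by simp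
qed

text \<open>A minimal sublinear functional equals the \<open>q'\<close> constructed here for every \<open>v\<close>, so it is odd and hence linear.\<close>

lemma sublinear_shrink:
  assumes q: "sublinear_on X q" and v: "bounded_real_on X v"
  obtains q' where "sublinear_on X q'" "\<forall>f. q' f \<le> q f" "q' (\<lambda>x. - v x) \<le> - q v"
proof -
  \<comment> \<open>The infimum over \<open>t\<close> lowers \<open>q\<close> as far as possible in
    the direction \<open>-v\<close>: the value at \<open>t = 0\<close> is \<open>q f\<close>, and
    for \<open>f = -v\<close> the value at \<open>t = 1\<close> is \<open>- q v\<close>.\<close>
  define S where "S f = (\<lambda>t. q (\<lambda>x. f x + t * v x) - t * q v) ` {0..}" for f
  define q' where "q' f = (if bounded_real_on X f then Inf (S f) else 0)" for f
  have add: "q (\<lambda>x. f x + g x) \<le> q f + q g" if "bounded_real_on X f" "bounded_real_on X g" for f g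
    using q that unfolding sublinear_on_def by blast
  have hom: "q (\<lambda>x. c * f x) = c * q f" if "bounded_real_on X f" "0 \<le> c" for f c
    using q that sublinear_zero[OF q] unfolding sublinear_on_def by (cases "c = 0") auto
  note bdi = bounded_real_on_add bounded_real_on_mult v
  \<comment> \<open>Since \<open>t * q v = q (t v)\<close> and
    \<open>t v = (f + t v) + (- f)\<close>, subadditivity gives a bound that is independent of
    \<open>t\<close>.\<close>
  have low: "- q (\<lambda>x. - f x) \<le> q (\<lambda>x. f x + t * v x) - t * q v"
    if f: "bounded_real_on X f" and t: "0 \<le> t" for f t
  proof -
    have m: "bounded_real_on X (\<lambda>x. - f x)" using bounded_real_on_mult[OF f, of "-1"] by simp
    have "q (\<lambda>x. (f x + t * v x) + - f x) \<le> q (\<lambda>x. f x + t * v x) + q (\<lambda>x. - f x)"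
      by (intro add m bdi f)
    then show ?thesis using hom[OF v t] by simp
  qed
  have bb: "bdd_below (S f)" if "bounded_real_on X f" for f
    unfolding S_def using low[OF that] by (auto intro!: bdd_belowI2)
  have ne: "S f \<noteq> {}" for f unfolding S_def by auto
  have le: "q' f \<le> q (\<lambda>x. f x + t * v x) - t * q v" if "bounded_real_on X f" "0 \<le> t" for f t
    using that bb[OF that(1)] unfolding q'_def by (auto simp: S_def intro!: cInf_lower)
  have ge: "b \<le> q' f" if "bounded_real_on X f" "\<And>t. 0 \<le> t \<Longrightarrow> b \<le> q (\<lambda>x. f x + t * v x) - t * q v" for f b
    using that ne[of f] unfolding q'_def by (auto simp: S_def intro!: cInf_greatest)
  have "sublinear_on X q'"
    unfolding sublinear_on_def
  proof (intro conjI allI impI)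
    fix f g assume f: "bounded_real_on X f" and g: "bounded_real_on X g"
    \<comment> \<open>The shifts \<open>t\<close> for \<open>f\<close> and \<open>s\<close> for
      \<open>g\<close> combine to the admissible shift \<open>t + s\<close> for the sum.\<close>
    have *: "q' (\<lambda>x. f x + g x) \<le> (q (\<lambda>x. f x + t * v x) - t * q v) + (q (\<lambda>x. g x + s * v x) - s * q v)"
      if t: "0 \<le> t" and s: "0 \<le> s" for s t
    proof -
      have "q (\<lambda>x. (f x + t * v x) + (g x + s * v x)) \<le> q (\<lambda>x. f x + t * v x) + q (\<lambda>x. g x + s * v x)"
        by (intro add bdi f g)
      moreover have "q' (\<lambda>x. f x + g x) \<le> q (\<lambda>x. (f x + g x) + (t + s) * v x) - (t + s) * q v"
        using t s by (intro le bdi f g) auto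
      moreover have "(\<lambda>x. (f x + g x) + (t + s) * v x) = (\<lambda>x. (f x + t * v x) + (g x + s * v x))"
        by (auto simp: algebra_simps)
      ultimately show ?thesis by (simp add: algebra_simps)
    qed
    have "q' (\<lambda>x. f x + g x) - (q (\<lambda>x. f x + t * v x) - t * q v) \<le> q' g" if "0 \<le> t" for t
      using *[OF that] by (intro ge g) (auto simp: algebra_simps)
    then have "q' (\<lambda>x. f x + g x) - q' g \<le> q' f"
      by (intro ge f) (auto simp: algebra_simps)
    then show "q' (\<lambda>x. f x + g x) \<le> q' f + q' g" by simp
  next
    fix f and c :: real assume f: "bounded_real_on X f" and c: "0 < c"
    have *: "q' (\<lambda>x. c * f x) \<le> c * q' f" if f: "bounded_real_on X f" and c: "0 < c" for f c
    proof -
      have "q' (\<lambda>x. c * f x) / c \<le> q (\<lambda>x. f x + t * v x) - t * q v" if t: "0 \<le> t" for t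
      proof -
        have "q' (\<lambda>x. c * f x) \<le> q (\<lambda>x. c * f x + (c * t) * v x) - (c * t) * q v"
          using t c by (intro le bdi f) auto
        also have "(\<lambda>x. c * f x + (c * t) * v x) = (\<lambda>x. c * (f x + t * v x))"
          by (auto simp: algebra_simps)
        also have "q \<dots> = c * q (\<lambda>x. f x + t * v x)" using c by (intro hom bdi f) auto
        finally show ?thesis using c by (simp add: field_simps)
      qed
      then have "q' (\<lambda>x. c * f x) / c \<le> q' f" by (rule ge[OF f])
      then show ?thesis using c by (simp add: field_simps)
    qed
    \<comment> \<open>The reverse inequality is the one just proved, for the function
      \<open>c f\<close> and the factor \<open>1/c\<close>.\<close>
    have "q' (\<lambda>x. (1/c) * (c * f x)) \<le> (1/c) * q' (\<lambda>x. c * f x)"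
      using c by (intro * bdi f) auto
    then have "c * q' f \<le> q' (\<lambda>x. c * f x)" using c by (simp add: field_simps)
    with *[OF f c] show "q' (\<lambda>x. c * f x) = c * q' f" by simp
  next
    fix f assume "\<not> bounded_real_on X f" then show "q' f = 0" by (simp add: q'_def)
  qed
  moreover have "q' f \<le> q f" for f
  proof (cases "bounded_real_on X f")
    case True then show ?thesis using le[of f 0] by simp
  next
    case False then show ?thesis using q by (simp add: q'_def sublinear_on_def)
  qed
  moreover have "q' (\<lambda>x. - v x) \<le> - q v"
  proof -
    have "bounded_real_on X (\<lambda>x. - v x)" using bounded_real_on_mult[OF v, of "-1"] by simp
    from le[OF this, of 1] show ?thesis using sublinear_zero[OF q] by simp
  qed
  ultimately show thesis using that by blast
qed

text \<open>Hahn--Banach without extension from subspaces: a minimal sublinear functional below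
  \<open>p\<close> cannot be lowered by \<open>sublinear_shrink\<close>, so it is odd, and an odd
  subadditive functional is additive.\<close>

lemma linear_below_sublinear:
  assumes p: "sublinear_on X p"
  obtains m where "sublinear_on X m" "\<forall>f. m f \<le> p f"
    "\<And>f. bounded_real_on X f \<Longrightarrow> m (\<lambda>x. - f x) = - m f"
proof -
  define Q where "Q = {q. sublinear_on X q \<and> (\<forall>f. q f \<le> p f)}"
  \<comment> \<open>The order is reversed, so that the maximal element provided by Zorn's lemma is a
    pointwise minimal functional.\<close>
  define R where "R q q' \<longleftrightarrow> (\<forall>f. q' f \<le> q f)" for q q' :: "('a \<Rightarrow> real) \<Rightarrow> real"
  have "\<exists>m\<in>Q. \<forall>q\<in>Q. R m q \<longrightarrow> q = m"
  proof (rule predicate_Zorn)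
    show "partial_order_on Q (relation_of R Q)"
      unfolding R_def by (intro partial_order_on_relation_ofI) (auto intro: order_trans, blast intro: ext order_antisym)
    fix C assume C: "C \<in> Chains (relation_of R Q)"
    then have CQ: "C \<subseteq> Q" and tot: "\<And>q q'. q \<in> C \<Longrightarrow> q' \<in> C \<Longrightarrow> R q q' \<or> R q' q"
      unfolding Chains_def relation_of_def by auto
    show "\<exists>u\<in>Q. \<forall>a\<in>C. R a u"
    proof (cases "C = {}")
      case True then show ?thesis using p by (auto simp: Q_def)
    next
      case False
      define u where "u f = (INF q\<in>C. q f)" for f
      have bb: "bdd_below ((\<lambda>q. q f) ` C)" for f
      proof (cases "bounded_real_on X f")
        case True
        have "- p (\<lambda>x. - f x) \<le> q f" if "q \<in> C" for q
        proof -
          have "sublinear_on X q" "q (\<lambda>x. - f x) \<le> p (\<lambda>x. - f x)" using that CQ by (auto simp: Q_def)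
          with sublinear_minus[OF this(1) True] show ?thesis by linarith
        qed
        then show ?thesis by (rule bdd_belowI2)
      next
        case False
        then have "0 \<le> q f" if "q \<in> C" for q using that CQ by (auto simp: Q_def sublinear_on_def)
        then show ?thesis by (rule bdd_belowI2)
      qed
      have le: "u f \<le> q f" if "q \<in> C" for q f
        unfolding u_def using bb that by (auto intro: cINF_lower)
      have ge: "b \<le> u f" if "\<And>q. q \<in> C \<Longrightarrow> b \<le> q f" for b f
        unfolding u_def using False that by (auto intro: cINF_greatest)
      have "sublinear_on X u"
        unfolding sublinear_on_def
      proof (intro conjI allI impI)
        fix f g assume fg: "bounded_real_on X f" "bounded_real_on X g"
        have *: "u (\<lambda>x. f x + g x) \<le> q f + q' g" if q: "q \<in> C" "q' \<in> C" for q q'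
        proof -
          \<comment> \<open>The smaller of the two comparable functionals serves for both values at
            once.\<close>
          obtain r where r: "r \<in> C" "r f \<le> q f" "r g \<le> q' g"
            using tot[OF q] q unfolding R_def by blast
          have "u (\<lambda>x. f x + g x) \<le> r (\<lambda>x. f x + g x)" by (rule le[OF r(1)])
          also have "\<dots> \<le> r f + r g" using r(1) CQ fg by (auto simp: Q_def sublinear_on_def)
          finally show ?thesis using r by linarith
        qed
        have "u (\<lambda>x. f x + g x) - q f \<le> u g" if "q \<in> C" for q
          by (rule ge) (use *[OF that] in force)
        then have "u (\<lambda>x. f x + g x) - u g \<le> u f"
          by (intro ge) force
        then show "u (\<lambda>x. f x + g x) \<le> u f + u g" by simp
      next
        fix f and c :: real assume f: "bounded_real_on X f" and c: "0 < c"
        have e: "q (\<lambda>x. c * f x) = c * q f" if "q \<in> C" for q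
          using that CQ f c by (auto simp: Q_def sublinear_on_def)
        have "u (\<lambda>x. c * f x) / c \<le> q f" if "q \<in> C" for q
          using le[OF that, of "\<lambda>x. c * f x"] e[OF that] c by (simp add: field_simps)
        then have "u (\<lambda>x. c * f x) / c \<le> u f" by (rule ge)
        moreover have "c * u f \<le> u (\<lambda>x. c * f x)"
          by (rule ge) (simp add: e mult_left_mono[OF le] less_imp_le[OF c])
        ultimately show "u (\<lambda>x. c * f x) = c * u f" using c by (simp add: field_simps)
      next
        fix f assume f: "\<not> bounded_real_on X f"
        then have "q f = 0" if "q \<in> C" for q using that CQ by (auto simp: Q_def sublinear_on_def)
        then have "(\<lambda>q. q f) ` C = {0}" using False by force
        then show "u f = 0" unfolding u_def by simp
      qed
      moreover have "u f \<le> p f" for f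
      proof -
        obtain q where "q \<in> C" using False by blast
        then have "u f \<le> q f" "q f \<le> p f" using le CQ by (auto simp: Q_def)
        then show ?thesis by linarith
      qed
      ultimately have "u \<in> Q" by (simp add: Q_def)
      then show ?thesis using le by (auto simp: R_def)
    qed
  qed
  then obtain m where m: "m \<in> Q" and min: "\<And>q. q \<in> Q \<Longrightarrow> R m q \<Longrightarrow> q = m" by blast
  have "m (\<lambda>x. - f x) = - m f" if f: "bounded_real_on X f" for f
  proof -
    have sm: "sublinear_on X m" using m by (simp add: Q_def)
    obtain q' where q': "sublinear_on X q'" "\<forall>f. q' f \<le> m f" "q' (\<lambda>x. - f x) \<le> - m f"
      using sublinear_shrink[OF sm f] by blast
    \<comment> \<open>Minimality turns the last property of \<open>q'\<close> into one inequality of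
      oddness for \<open>m\<close>; subadditivity gives the other.\<close>
    have "q' = m"
    proof (rule min)
      show "q' \<in> Q" using q' m by (auto simp: Q_def intro: order_trans)
      show "R m q'" using q' by (simp add: R_def)
    qed
    then show ?thesis using q'(3) sublinear_minus[OF sm f] by (auto intro!: order_antisym)
  qed
  then show thesis using that m by (auto simp: Q_def)
qed

text \<open>Being below the supremum makes \<open>m\<close> positive with value 1 at the constant 1,
  a finitely additive probability. As \<open>W\<close> is closed under negation, \<open>Wpos\<close>
  says that no element of \<open>W\<close> has a strict sign throughout \<open>X\<close>, which is
  the separation condition of Hahn--Banach.\<close>

lemma mean_vanishing_on_exists:
  fixes W :: "('x \<Rightarrow> real) set"
  assumes X: "X \<noteq> {}" and W: "W \<noteq> {}"
    and Wb: "\<And>w. w \<in> W \<Longrightarrow> bounded_real_on X w"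
    and Wadd: "\<And>w w'. w \<in> W \<Longrightarrow> w' \<in> W \<Longrightarrow> (\<lambda>x. w x + w' x) \<in> W"
    and Wmult: "\<And>w c. w \<in> W \<Longrightarrow> (\<lambda>x. c * w x) \<in> W"
    and Wpos: "\<And>w. w \<in> W \<Longrightarrow> \<exists>x\<in>X. 0 \<le> w x"
  shows "\<exists>m. (\<forall>f g. bounded_real_on X f \<longrightarrow> bounded_real_on X g \<longrightarrow> m (\<lambda>x. f x + g x) = m f + m g) \<and>
    (\<forall>f c. bounded_real_on X f \<longrightarrow> m (\<lambda>x. c * f x) = c * m f) \<and>
    (\<forall>f b. bounded_real_on X f \<longrightarrow> (\<forall>x\<in>X. f x \<le> b) \<longrightarrow> m f \<le> b) \<and> (\<forall>w\<in>W. m w = 0)"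
proof -
  \<comment> \<open>The infimum over \<open>w \<in> W\<close> of the suprema of \<open>f + w\<close> is sublinear and at most \<open>0\<close> on \<open>W\<close>; it is
    finite because no element of \<open>W\<close> is negative throughout \<open>X\<close>.\<close>
  define S where "S f = {b. \<exists>w\<in>W. \<forall>x\<in>X. f x + w x \<le> b}" for f
  define p where "p f = (if bounded_real_on X f then Inf (S f) else 0)" for f
  have W0: "(\<lambda>x. 0) \<in> W" using W Wmult[of _ 0] by auto
  have bb: "bdd_below (S f)" if f: "bounded_real_on X f" for f
  proof -
    obtain b where b: "\<forall>x\<in>X. \<bar>f x\<bar> \<le> b" using f unfolding bounded_real_on_def by blast
    have "- b \<le> s" if s: "s \<in> S f" for s
    proof -
      obtain w where w: "w \<in> W" "\<forall>x\<in>X. f x + w x \<le> s" using s unfolding S_def by blast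
      obtain x where "x \<in> X" "0 \<le> w x" using Wpos[OF w(1)] by blast
      then have "\<bar>f x\<bar> \<le> b" "f x + w x \<le> s" "0 \<le> w x" using b w by auto
      then show ?thesis by linarith
    qed
    then show ?thesis by (rule bdd_belowI)
  qed
  have ne: "S f \<noteq> {}" if f: "bounded_real_on X f" for f
  proof -
    obtain b where b: "\<forall>x\<in>X. \<bar>f x\<bar> \<le> b" using f unfolding bounded_real_on_def by blast
    have "b \<in> S f" unfolding S_def using W0 b by (auto intro!: bexI[of _ "\<lambda>x. 0"] simp: abs_le_iff)
    then show ?thesis by blast
  qed
  have le: "p f \<le> s" if "bounded_real_on X f" "s \<in> S f" for f s
    using that bb[OF that(1)] by (auto simp: p_def intro: cInf_lower)
  have ge: "b \<le> p f" if "bounded_real_on X f" "\<And>s. s \<in> S f \<Longrightarrow> b \<le> s" for f b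
    using that ne[OF that(1)] by (auto simp: p_def intro: cInf_greatest)
  have "sublinear_on X p"
    unfolding sublinear_on_def
  proof (intro conjI allI impI)
    fix f g assume f: "bounded_real_on X f" and g: "bounded_real_on X g"
    have *: "p (\<lambda>x. f x + g x) \<le> s + t" if s: "s \<in> S f" "t \<in> S g" for s t
    proof -
      obtain w w' where w: "w \<in> W" "\<forall>x\<in>X. f x + w x \<le> s" and w': "w' \<in> W" "\<forall>x\<in>X. g x + w' x \<le> t"
        using s unfolding S_def by blast
      have "s + t \<in> S (\<lambda>x. f x + g x)"
        unfolding S_def using Wadd[OF w(1) w'(1)] w(2) w'(2)
        by (auto intro!: bexI[of _ "\<lambda>x. w x + w' x"]) (smt (verit, best))
      then show ?thesis by (intro le bounded_real_on_add f g)
    qed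
    have "p (\<lambda>x. f x + g x) - s \<le> p g" if "s \<in> S f" for s
      by (rule ge[OF g]) (use *[OF that] in force)
    then have "p (\<lambda>x. f x + g x) - p g \<le> p f" by (intro ge[OF f]) force
    then show "p (\<lambda>x. f x + g x) \<le> p f + p g" by simp
  next
    fix f and c :: real assume f: "bounded_real_on X f" and c: "0 < c"
    have *: "p (\<lambda>x. c * f x) \<le> c * p f" if f: "bounded_real_on X f" and c: "0 < c" for f c
    proof -
      have "p (\<lambda>x. c * f x) / c \<le> s" if s: "s \<in> S f" for s
      proof -
        obtain w where w: "w \<in> W" "\<forall>x\<in>X. f x + w x \<le> s" using s unfolding S_def by blast
        have "\<forall>x\<in>X. c * f x + c * w x \<le> c * s"
          using w(2) c by (auto simp flip: distrib_left)
        then have "c * s \<in> S (\<lambda>x. c * f x)"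
          unfolding S_def using Wmult[OF w(1), of c]
          by (auto intro!: bexI[of _ "\<lambda>x. c * w x"])
        then have "p (\<lambda>x. c * f x) \<le> c * s" by (intro le bounded_real_on_mult f)
        then show ?thesis using c by (simp add: field_simps)
      qed
      then have "p (\<lambda>x. c * f x) / c \<le> p f" by (rule ge[OF f])
      then show ?thesis using c by (simp add: field_simps)
    qed
    have "p (\<lambda>x. (1/c) * (c * f x)) \<le> (1/c) * p (\<lambda>x. c * f x)"
      using c by (intro * bounded_real_on_mult f) auto
    then have "c * p f \<le> p (\<lambda>x. c * f x)" using c by (simp add: field_simps)
    with *[OF f c] show "p (\<lambda>x. c * f x) = c * p f" by simp
  qed (simp add: p_def)
  then obtain m where m: "sublinear_on X m" "\<forall>f. m f \<le> p f"
    and neg: "\<And>f. bounded_real_on X f \<Longrightarrow> m (\<lambda>x. - f x) = - m f"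
    using linear_below_sublinear by blast
  have bneg: "bounded_real_on X (\<lambda>x. - f x)" if "bounded_real_on X f" for f
    using bounded_real_on_mult[OF that, of "-1"] by simp
  have pos: "m (\<lambda>x. c * f x) = c * m f" if "bounded_real_on X f" "0 < c" for f c
    using m(1) that unfolding sublinear_on_def by blast
  show ?thesis
  proof (intro exI[of _ m] conjI allI ballI impI)
    fix f g assume f: "bounded_real_on X f" and g: "bounded_real_on X g"
    have sub: "m (\<lambda>x. f x + g x) \<le> m f + m g" if "bounded_real_on X f" "bounded_real_on X g" for f g
      using m(1) that unfolding sublinear_on_def by blast
    have "m (\<lambda>x. - (f x + g x)) \<le> m (\<lambda>x. - f x) + m (\<lambda>x. - g x)"
      using sub[OF bneg[OF f] bneg[OF g]] by (simp add: algebra_simps)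
    then show "m (\<lambda>x. f x + g x) = m f + m g"
      using sub[OF f g] neg[OF f] neg[OF g] neg[OF bounded_real_on_add[OF f g]] by linarith
  next
    fix f and c :: real assume f: "bounded_real_on X f"
    consider "0 < c" | "c = 0" | "c < 0" by linarith
    then show "m (\<lambda>x. c * f x) = c * m f"
    proof cases
      case 1 then show ?thesis using pos f by blast
    next
      case 2 then show ?thesis using sublinear_zero[OF m(1)] by simp
    next
      case 3
      then have "m (\<lambda>x. - ((-c) * f x)) = - m (\<lambda>x. (-c) * f x)" 
        by (intro neg bounded_real_on_mult f)
      with pos[OF f, of "-c"] 3 show ?thesis by simp
    qed
  next
    fix f b assume "bounded_real_on X f" "\<forall>x\<in>X. f x \<le> b"
    then have "p f \<le> b" using W0 by (intro le) (auto simp: S_def intro!: bexI[of _ "\<lambda>x. 0"])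
    then show "m f \<le> b" using m(2) order_trans by blast
  next
    fix w assume w: "w \<in> W"
    \<comment> \<open>In the infimum that defines \<open>p w\<close>, the competitor
      \<open>-w\<close> cancels \<open>w\<close> and gives the bound 0.\<close>
    have *: "m w \<le> 0" if "w \<in> W" for w
    proof -
      have "p w \<le> 0" using Wmult[OF that, of "-1"] Wb[OF that]
        by (intro le) (auto simp: S_def intro!: bexI[of _ "\<lambda>x. - w x"])
      then show ?thesis using m(2) order_trans by blast
    qed
    have "m (\<lambda>x. - w x) \<le> 0" using *[OF Wmult[OF w, of "-1"]] by simp
    then show "m w = 0" using *[OF w] neg[OF Wb[OF w]] by linarith
  qed
qed

subsection \<open>Iterated derivatives\<close>

text \<open>The index is shifted by one: order \<open>n\<close> asks that the iterated derivatives
  of length up to \<open>n\<close> be differentiable, so order 0 is differentiability and order 2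
  makes second derivatives continuous. Truncating \<open>smooth_on\<close> in this way allows
  induction on \<open>n\<close> with the function varying.\<close>

fun diff_order :: "nat \<Rightarrow> 'a::real_normed_vector set \<Rightarrow> ('a \<Rightarrow> 'b::real_normed_vector) \<Rightarrow> bool" where
  "diff_order 0 S f \<longleftrightarrow> (\<forall>x\<in>S. f differentiable (at x))"
| "diff_order (Suc n) S f \<longleftrightarrow> (\<forall>x\<in>S. f differentiable (at x)) \<and>
     (\<forall>v. diff_order n S (\<lambda>x. frechet_derivative f (at x) v))"

lemma diff_order_iff_iter_deriv:
  "diff_order n S f \<longleftrightarrow> (\<forall>vs. length vs \<le> n \<longrightarrow> (\<forall>x\<in>S. iter_deriv vs f differentiable (at x)))"
proof (induction n arbitrary: f)
  case (Suc n)
  have "(\<forall>vs. length vs \<le> Suc n \<longrightarrow> P vs) \<longleftrightarrow> P [] \<and> (\<forall>v vs. length vs \<le> n \<longrightarrow> P (v # vs))"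
    for P :: "'a list \<Rightarrow> bool"
    by (metis Suc_le_mono le0 length_Cons list.exhaust list.size(3))
  then show ?case by (simp add: Suc.IH)
qed simp

lemma smooth_on_iff_diff_order: "smooth_on S f \<longleftrightarrow> (\<forall>n. diff_order n S f)"
  unfolding smooth_on_def diff_order_iff_iter_deriv by blast

lemma diff_order_differentiable: "diff_order n S f \<Longrightarrow> x \<in> S \<Longrightarrow> f differentiable (at x)"
  by (cases n) auto

lemma diff_order_Suc: "diff_order (Suc n) S f \<Longrightarrow> diff_order n S f"
  unfolding diff_order_iff_iter_deriv by simp

text \<open>On an open set the derivative depends only on values in the set, so agreement passes to
  all iterated derivatives.\<close>

lemma diff_order_cong:
  assumes S: "open S" and eq: "\<And>x. x \<in> S \<Longrightarrow> f x = g x" and f: "diff_order n S f"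
  shows "diff_order n S g"
  using eq f
proof (induction n arbitrary: f g)
  case 0
  then show ?case
    using S unfolding diff_order.simps differentiable_def
    by (metis has_derivative_transform_within_open)
next
  case (Suc n)
  have *: "(g has_derivative frechet_derivative f (at x)) (at x)" if "x \<in> S" for x
  proof -
    have "(f has_derivative frechet_derivative f (at x)) (at x)"
      using Suc.prems(2) that by (simp add: frechet_derivative_works)
    then show ?thesis
      using S that Suc.prems(1) by (rule has_derivative_transform_within_open)
  qed
  have eq: "frechet_derivative f (at x) v = frechet_derivative g (at x) v" if "x \<in> S" for x v
    using frechet_derivative_at[OF *[OF that]] by simp
  have "diff_order n S (\<lambda>x. frechet_derivative f (at x) v)" for v
    using Suc.prems(2) by simp
  then have "diff_order n S (\<lambda>x. frechet_derivative g (at x) v)" for v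
    using Suc.IH[of "\<lambda>x. frechet_derivative f (at x) v" "\<lambda>x. frechet_derivative g (at x) v" for v, OF eq]
    by blast
  then show ?case using * unfolding diff_order.simps differentiable_def by blast
qed

text \<open>Lets any explicit formula for the derivative replace the chosen
  \<open>frechet_derivative\<close> in an induction on the order.\<close>

lemma diff_order_SucI:
  assumes S: "open S" and D: "\<And>x. x \<in> S \<Longrightarrow> (f has_derivative D x) (at x)"
    and n: "\<And>v. diff_order n S (\<lambda>x. D x v)"
  shows "diff_order (Suc n) S f"
proof -
  have "D x v = frechet_derivative f (at x) v" if "x \<in> S" for x v
    using frechet_derivative_at[OF D[OF that]] by simp
  then have "diff_order n S (\<lambda>x. frechet_derivative f (at x) v)" for v
    by (rule diff_order_cong[OF S _ n])
  then show ?thesis using D unfolding diff_order.simps differentiable_def by blast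
qed

lemma diff_order_locally:
  assumes "\<And>x. x \<in> S \<Longrightarrow> \<exists>U. x \<in> U \<and> diff_order n U f"
  shows "diff_order n S f"
  using assms unfolding diff_order_iff_iter_deriv by metis

lemma diff_order_subset: "diff_order n S f \<Longrightarrow> T \<subseteq> S \<Longrightarrow> diff_order n T f"
  unfolding diff_order_iff_iter_deriv by blast

lemma diff_order_const: "open S \<Longrightarrow> diff_order n S (\<lambda>x. c)"
proof (induction n arbitrary: c)
  case (Suc n)
  then show ?case by (auto intro!: diff_order_SucI[where D = "\<lambda>_ _. 0"])
qed simp

lemma diff_order_bounded_linear:
  assumes "open S" "bounded_linear L"
  shows "diff_order n S L"
proof (cases n)
  case 0
  then show ?thesis
    using bounded_linear_imp_has_derivative[OF assms(2)] by (auto simp: differentiable_def)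
next
  case (Suc m)
  show ?thesis
    unfolding Suc using bounded_linear_imp_has_derivative[OF assms(2)]
    by (rule diff_order_SucI[OF assms(1)]) (rule diff_order_const[OF assms(1)])
qed

lemma diff_order_has_derivative:
  "diff_order n S f \<Longrightarrow> x \<in> S \<Longrightarrow> (f has_derivative frechet_derivative f (at x)) (at x)"
  using diff_order_differentiable frechet_derivative_works by blast

lemma diff_order_add:
  assumes S: "open S" and "diff_order n S f" "diff_order n S g"
  shows "diff_order n S (\<lambda>x. f x + g x)"
  using assms(2,3)
proof (induction n arbitrary: f g)
  case (Suc n)
  show ?case
    by (rule diff_order_SucI[OF S has_derivative_add[OF diff_order_has_derivative[OF Suc.prems(1)] diff_order_has_derivative[OF Suc.prems(2)]]])
      (use Suc in auto)
qed auto

lemma diff_order_sum: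
  assumes S: "open S" and "\<And>i. i \<in> I \<Longrightarrow> diff_order n S (f i)"
  shows "diff_order n S (\<lambda>x. \<Sum>i\<in>I. f i x)"
  using assms(2)
  by (induction I rule: infinite_finite_induct) (auto intro!: diff_order_add diff_order_const S)

lemma diff_order_bilinear:
  assumes S: "open S" and B: "bounded_bilinear B" and "diff_order n S f" "diff_order n S g"
  shows "diff_order n S (\<lambda>x. B (f x) (g x))"
  using assms(3,4)
proof (induction n arbitrary: f g)
  case 0
  then show ?case
    using bounded_bilinear.FDERIV[OF B] unfolding diff_order.simps differentiable_def by blast
next
  case (Suc n)
  note n = Suc.prems[THEN diff_order_Suc]
  show ?case
  proof (rule diff_order_SucI[OF S bounded_bilinear.FDERIV[OF B diff_order_has_derivative[OF Suc.prems(1)] diff_order_has_derivative[OF Suc.prems(2)]]])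
    show "diff_order n S (\<lambda>x. B (f x) (frechet_derivative g (at x) v) + B (frechet_derivative f (at x) v) (g x))" for v
      using Suc.prems by (intro diff_order_add[OF S] Suc.IH n) auto
  qed
qed

lemma diff_order_linear_compose:
  assumes S: "open S" and L: "bounded_linear L" and "diff_order n S f"
  shows "diff_order n S (\<lambda>x. L (f x))"
  using assms(3)
proof (induction n arbitrary: f)
  case 0
  then show ?case
    using bounded_linear.has_derivative[OF L] unfolding diff_order.simps differentiable_def by blast
next
  case (Suc n)
  show ?case
    by (rule diff_order_SucI[OF S bounded_linear.has_derivative[OF L diff_order_has_derivative[OF Suc.prems(1)]]])
      (use Suc in auto)
qed

lemma diff_order_compose:
  fixes F :: "'a::real_normed_vector \<Rightarrow> 'b::euclidean_space"
  assumes S: "open S" and T: "open T" and ST: "F ` S \<subseteq> T"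
    and "diff_order n T g" "diff_order n S F"
  shows "diff_order n S (\<lambda>x. g (F x))"
  using assms(4,5)
proof (induction n arbitrary: g)
  case 0
  have "((\<lambda>x. g (F x)) has_derivative (\<lambda>v. frechet_derivative g (at (F x)) (frechet_derivative F (at x) v))) (at x)"
    if "x \<in> S" for x
    using that ST diff_chain_at[OF diff_order_has_derivative[OF 0(2) that] diff_order_has_derivative[OF 0(1)], of ]
    by (auto simp: o_def)
  then show ?case unfolding diff_order.simps differentiable_def by blast
next
  case (Suc n)
  have der: "((\<lambda>x. g (F x)) has_derivative (\<lambda>v. frechet_derivative g (at (F x)) (frechet_derivative F (at x) v))) (at x)"
    if "x \<in> S" for x
    using that ST diff_chain_at[OF diff_order_has_derivative[OF Suc(3) that] diff_order_has_derivative[OF Suc(2)]]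
    by (auto simp: o_def)
  \<comment> \<open>In the chain rule the direction in which \<open>g\<close> is differentiated
    moves with \<open>x\<close>. Expanding it in a basis leaves products of scalar functions with
    derivatives of \<open>g\<close> in fixed directions, to which the induction hypothesis
    applies.\<close>
  have eq: "(\<Sum>b\<in>Basis. (frechet_derivative F (at x) v \<bullet> b) *\<^sub>R frechet_derivative g (at (F x)) b)
      = frechet_derivative g (at (F x)) (frechet_derivative F (at x) v)" if "x \<in> S" for x v
  proof -
    have "bounded_linear (frechet_derivative g (at (F x)))"
      using diff_order_has_derivative[OF Suc(2)] ST that has_derivative_bounded_linear by blast
    then interpret l: bounded_linear "frechet_derivative g (at (F x))" .
    show ?thesis by (subst (3) euclidean_representation[symmetric]) (simp add: l.sum l.scaleR)
  qed
  have "diff_order n S (\<lambda>x. frechet_derivative g (at (F x)) (frechet_derivative F (at x) v))" for v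
  proof (rule diff_order_cong[OF S eq])
    show "diff_order n S (\<lambda>x. \<Sum>b\<in>Basis. (frechet_derivative F (at x) v \<bullet> b) *\<^sub>R frechet_derivative g (at (F x)) b)"
    proof (intro diff_order_sum diff_order_bilinear[OF S bounded_bilinear_scaleR] S)
      fix b :: 'b
      show "diff_order n S (\<lambda>x. frechet_derivative F (at x) v \<bullet> b)"
        using Suc.prems by (intro diff_order_linear_compose[OF S bounded_linear_inner_left]) auto
      show "diff_order n S (\<lambda>x. frechet_derivative g (at (F x)) b)"
        using Suc.prems diff_order_Suc by (intro Suc.IH) auto
    qed
  qed
  then show ?case by (intro diff_order_SucI[OF S der])
qed

section \<open>Smooth bump functions on Euclidean space\<close>

text \<open>The bump uses only \<open>k = 0\<close>; the powers of \<open>1/x\<close> are included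
  so that the family is closed under differentiation up to linear combinations.\<close>

definition exp_inv_power :: "nat \<Rightarrow> real \<Rightarrow> real" where
  "exp_inv_power k x = (if x \<le> 0 then 0 else inverse x ^ k * exp (- inverse x))"

lemma exp_inv_power_tendsto_0: "(exp_inv_power k \<longlongrightarrow> 0) (at 0)"
proof -
  have "((\<lambda>x. inverse x ^ k * exp (- inverse x)) \<longlongrightarrow> 0) (at_right (0::real))"
  proof -
    have "((\<lambda>y. y ^ k / exp y) \<longlongrightarrow> 0) (at_top :: real filter)" by (rule tendsto_power_div_exp_0)
    then have "((\<lambda>x. inverse x ^ k / exp (inverse x)) \<longlongrightarrow> 0) (at_right (0::real))"
      using filterlim_compose filterlim_inverse_at_top_right by blast
    then show ?thesis by (simp add: exp_minus field_simps)
  qed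
  then have "(exp_inv_power k \<longlongrightarrow> 0) (at_right 0)"
    by (rule Lim_transform_eventually)
      (auto simp: exp_inv_power_def eventually_at_filter)
  moreover have "(exp_inv_power k \<longlongrightarrow> 0) (at_left 0)"
    by (rule Lim_transform_eventually[OF tendsto_const])
      (auto simp: exp_inv_power_def eventually_at_filter)
  ultimately show ?thesis by (simp add: filterlim_split_at)
qed

lemma exp_inv_power_has_derivative:
  "(exp_inv_power k has_real_derivative (exp_inv_power (k + 2) x - k * exp_inv_power (k + 1) x)) (at x)"
proof -
  consider "x < 0" | "x = 0" | "0 < x" by linarith
  then show ?thesis
  proof cases
    case 1
    have "(exp_inv_power k has_real_derivative 0) (at x)"
      by (rule has_field_derivative_transform_within_open[OF DERIV_const, of "{..<0}"])
        (use 1 in \<open>simp_all add: exp_inv_power_def\<close>)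
    then show ?thesis using 1 by (simp add: exp_inv_power_def)
  next
    case 2
    \<comment> \<open>Away from 0 the difference quotient at 0 is the member of the family with
      index \<open>k + 1\<close>, so its limit is already known.\<close>
    have "((\<lambda>y. exp_inv_power k y / y) \<longlongrightarrow> 0) (at 0)"
      using exp_inv_power_tendsto_0[of "k + 1"]
      by (rule Lim_transform_eventually)
        (auto simp: exp_inv_power_def eventually_at_filter field_simps)
    then show ?thesis using 2 by (simp add: has_field_derivative_iff exp_inv_power_def)
  next
    case 3
    have "((\<lambda>x. exp (- inverse x)) has_real_derivative exp (- inverse x) * inverse x ^ 2) (at x)"
      using 3 by (auto intro!: derivative_eq_intros simp: power2_eq_square)
    moreover have "((\<lambda>x. inverse x ^ k) has_real_derivative - (k * inverse x ^ (k + 1))) (at x)"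
      using DERIV_power[OF DERIV_inverse, of x k] 3
      by (cases k) (simp_all add: power2_eq_square algebra_simps)
    ultimately have "((\<lambda>x. inverse x ^ k * exp (- inverse x)) has_real_derivative
      - (k * inverse x ^ (k + 1)) * exp (- inverse x) + exp (- inverse x) * inverse x ^ 2 * inverse x ^ k) (at x)"
      by (rule DERIV_mult[rotated])
    moreover have "- (k * inverse x ^ (k + 1)) * exp (- inverse x) + exp (- inverse x) * inverse x ^ 2 * inverse x ^ k
      = inverse x ^ (k + 2) * exp (- inverse x) - k * (inverse x ^ (k + 1) * exp (- inverse x))"
      by (simp add: power2_eq_square algebra_simps)
    ultimately have "((\<lambda>x. inverse x ^ k * exp (- inverse x)) has_real_derivative
      (inverse x ^ (k + 2) * exp (- inverse x) - k * (inverse x ^ (k + 1) * exp (- inverse x)))) (at x)"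
      by (simp only:)
    then have "(exp_inv_power k has_real_derivative
      (inverse x ^ (k + 2) * exp (- inverse x) - k * (inverse x ^ (k + 1) * exp (- inverse x)))) (at x)"
      by (rule has_field_derivative_transform_within_open[of _ _ _ "{0<..}"])
        (use 3 in \<open>auto simp: exp_inv_power_def\<close>)
    then show ?thesis using 3 by (simp add: exp_inv_power_def)
  qed
qed

lemma diff_order_exp_inv_power: "diff_order n UNIV (exp_inv_power k)"
proof (induction n arbitrary: k)
  case 0
  then show ?case
    using exp_inv_power_has_derivative by (auto simp: differentiable_def has_field_derivative_def)
next
  case (Suc n)
  show ?case
    by (rule diff_order_SucI[OF open_UNIV exp_inv_power_has_derivative[unfolded has_field_derivative_def]])
      (auto intro!: diff_order_add diff_order_linear_compose[OF _ bounded_linear_mult_left]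
        diff_order_linear_compose[OF _ bounded_linear_mult_right]
        diff_order_linear_compose[OF _ bounded_linear_minus[OF bounded_linear_ident]] Suc
        simp: diff_conv_add_uminus simp del: add_uminus_conv_diff)
qed

text \<open>The squared distance makes the inner function a polynomial, hence smooth at the centre
  as well, and it is positive exactly on the open ball.\<close>

definition ball_bump :: "'a::euclidean_space \<Rightarrow> real \<Rightarrow> 'a \<Rightarrow> real" where
  "ball_bump z r x = exp_inv_power 0 (r\<^sup>2 - (x - z) \<bullet> (x - z))"

lemma ball_bump_pos: "0 < r \<Longrightarrow> ball_bump z r x > 0 \<longleftrightarrow> x \<in> ball z r"
  and ball_bump_eq_0: "0 < r \<Longrightarrow> x \<notin> ball z r \<Longrightarrow> ball_bump z r x = 0"
  and ball_bump_nonneg: "ball_bump z r x \<ge> 0"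
proof -
  have "r\<^sup>2 - (x - z) \<bullet> (x - z) \<le> 0 \<longleftrightarrow> x \<notin> ball z r" if "0 < r"
    using that by (auto simp: power2_norm_eq_inner[symmetric] dist_norm norm_minus_commute
        not_less intro: power_mono power2_le_imp_le)
  then show "0 < r \<Longrightarrow> ball_bump z r x > 0 \<longleftrightarrow> x \<in> ball z r" 
    "0 < r \<Longrightarrow> x \<notin> ball z r \<Longrightarrow> ball_bump z r x = 0"
    by (auto simp: ball_bump_def exp_inv_power_def)
  show "ball_bump z r x \<ge> 0" by (simp add: ball_bump_def exp_inv_power_def)
qed

lemma diff_order_ball_bump: "diff_order n UNIV (ball_bump z r)"
proof -
  have sub: "diff_order n UNIV (\<lambda>x. x - z)"
    using diff_order_add[OF open_UNIV diff_order_bounded_linear[OF open_UNIV bounded_linear_ident]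
        diff_order_const[OF open_UNIV], of n "- z"] by simp
  have "diff_order n UNIV (\<lambda>x. r\<^sup>2 + - ((x - z) \<bullet> (x - z)))"
    by (intro diff_order_add diff_order_const open_UNIV
        diff_order_linear_compose[OF _ bounded_linear_minus[OF bounded_linear_ident]]
        diff_order_bilinear[OF _ bounded_bilinear_inner] sub)
  then show ?thesis
    unfolding ball_bump_def
    using diff_order_compose[OF open_UNIV open_UNIV _ diff_order_exp_inv_power] by simp
qed

subsection \<open>Holomorphic functions of several variables\<close>

text \<open>The scalar counterpart of \<open>holomorphic_map_on\<close>, to which Cauchy's formula
  in one variable can be applied componentwise.\<close>

definition holomorphic_function_on :: "(complex ^ 'k::finite \<Rightarrow> complex) \<Rightarrow> (complex ^ 'k) set \<Rightarrow> bool" where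
  "holomorphic_function_on G S \<longleftrightarrow>
     (\<forall>x\<in>S. \<exists>D. (G has_derivative D) (at x) \<and> (\<forall>a v. D (a *s v) = a * D v))"

lemma holomorphic_functionD:
  assumes "holomorphic_function_on G S" "x \<in> S"
  shows "(G has_derivative frechet_derivative G (at x)) (at x)"
    and "frechet_derivative G (at x) (a *s v) = a * frechet_derivative G (at x) v"
proof -
  obtain D where D: "(G has_derivative D) (at x)" "\<forall>a v. D (a *s v) = a * D v"
    using assms unfolding holomorphic_function_on_def by blast
  have "D = frechet_derivative G (at x)" by (rule frechet_derivative_at[OF D(1)])
  with D show "(G has_derivative frechet_derivative G (at x)) (at x)"
    and "frechet_derivative G (at x) (a *s v) = a * frechet_derivative G (at x) v" by simp_all
qed

lemma norm_vector_smult: "norm (a *s v) = norm a * norm (v :: complex ^ 'k::finite)"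
  by (simp add: norm_vec_def norm_mult L2_set_right_distrib)

lemma bounded_linear_smult_left: "bounded_linear (\<lambda>a. a *s (v :: complex ^ 'k::finite))"
  by (rule bounded_linear_intro[of _ "norm v"])
    (simp_all add: norm_vector_smult vec_eq_iff algebra_simps)

text \<open>Cauchy's formula on the complex line through \<open>x\<close> in the direction \<open>v\<close> represents a
  directional derivative as an integral, under which one can differentiate again.\<close>

lemma holomorphic_derivative_integral:
  fixes G :: "complex ^ 'k::finite \<Rightarrow> complex"
  assumes G: "holomorphic_function_on G S" and r: "0 < r"
    and sub: "\<And>a. norm a \<le> r \<Longrightarrow> x + a *s v \<in> S"
  shows "frechet_derivative G (at x) v =
    integral (cbox 0 1) (\<lambda>t. G (x + circlepath 0 r t *s v) / circlepath 0 r t)"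
proof -
  define f where "f a = G (x + a *s v)" for a
  have der: "(f has_field_derivative frechet_derivative G (at (x + a *s v)) v) (at a)"
    if "norm a \<le> r" for a
  proof -
    note G' = holomorphic_functionD[OF G sub[OF that]]
    have "((\<lambda>a. x + a *s v) has_derivative (\<lambda>h. h *s v)) (at a)"
      by (auto intro!: derivative_eq_intros bounded_linear_imp_has_derivative bounded_linear_smult_left)
    from diff_chain_at[OF this G'(1)]
    moreover have "frechet_derivative G (at (x + a *s v)) \<circ> (\<lambda>h. h *s v) = (*) (frechet_derivative G (at (x + a *s v)) v)"
      by (auto simp: G'(2) mult.commute)
    ultimately show ?thesis by (simp add: f_def[abs_def] has_field_derivative_def o_def)
  qed
  have cont: "continuous_on (cball 0 r) f"
    by (intro continuous_at_imp_continuous_on ballI DERIV_isCont[OF der]) simp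
  have hol: "f holomorphic_on ball 0 r"
  proof (rule holomorphic_onI)
    fix a :: complex assume "a \<in> ball 0 r"
    then have "f field_differentiable at a" using der[of a] unfolding field_differentiable_def by auto
    then show "f field_differentiable at a within ball 0 r" by (rule field_differentiable_at_within)
  qed
  have "(f has_field_derivative (1 / (2 * of_real pi * \<i>) * contour_integral (circlepath 0 r) (\<lambda>u. f u / (u - 0)^2))) (at 0)"
    by (rule Cauchy_derivative_integral_circlepath[OF cont hol]) (use r in simp)
  moreover have "(f has_field_derivative frechet_derivative G (at x) v) (at 0)"
    using der[of 0] r by simp
  ultimately have "frechet_derivative G (at x) v
    = 1 / (2 * of_real pi * \<i>) * contour_integral (circlepath 0 r) (\<lambda>u. f u / u^2)"
    using DERIV_unique by fastforce
  also have "\<dots> = integral {0..1} (\<lambda>t. 1 / (2 * of_real pi * \<i>) *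
      (f (circlepath 0 r t) / (circlepath 0 r t)\<^sup>2 * vector_derivative (circlepath 0 r) (at t)))"
    by (simp only: contour_integral_integral integral_mult_right)
  also have "\<dots> = integral {0..1} (\<lambda>t. f (circlepath 0 r t) / circlepath 0 r t)"
  proof (rule integral_cong)
    fix t
    \<comment> \<open>On the circle \<open>u = r exp (2 pi i t)\<close> one has
      \<open>du = 2 pi i u dt\<close>, which cancels the prefactor and one of the two powers of
      \<open>u\<close>.\<close>
    have "vector_derivative (circlepath 0 r) (at t) = 2 * of_real pi * \<i> * circlepath 0 r t"
      unfolding vector_derivative_circlepath by (simp add: circlepath)
    moreover have "circlepath 0 r t \<noteq> 0" using r by (simp add: circlepath)
    ultimately show "1 / (2 * of_real pi * \<i>) * (f (circlepath 0 r t) / (circlepath 0 r t)\<^sup>2 *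
      vector_derivative (circlepath 0 r) (at t)) = f (circlepath 0 r t) / circlepath 0 r t"
      by (simp add: power2_eq_square)
  qed
  finally show ?thesis by (simp add: f_def)
qed

text \<open>One radius serves for all \<open>x\<close> in the smaller ball; the summand 1 in the
  denominator covers \<open>v = 0\<close>.\<close>

lemma circle_in_ball:
  fixes x v :: "complex ^ 'k::finite"
  assumes "cball x0 (2 * r) \<subseteq> S" "0 < r" "x \<in> ball x0 r" "norm a \<le> r / (1 + norm v)"
  shows "x + a *s v \<in> S"
proof -
  have "norm a * norm v \<le> r / (1 + norm v) * norm v"
    using assms by (intro mult_right_mono) auto
  also have "\<dots> = r * (norm v / (1 + norm v))" by simp
  also have "\<dots> \<le> r" using assms(2) by (intro mult_left_le) (auto simp: divide_le_eq_1 add_pos_nonneg)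
  finally have "norm (a *s v) \<le> r" by (simp add: norm_vector_smult)
  moreover have "dist x0 x < r" using assms(3) by simp
  ultimately have "dist x0 (x + a *s v) \<le> 2 * r"
    using norm_triangle_ineq4[of "x0 - x" "a *s v"] by (simp add: dist_norm algebra_simps)
  then show ?thesis using assms(1) by auto
qed

text \<open>The Cauchy integrand contains \<open>G\<close> but no derivative of it, so it is jointly
  continuous in \<open>x\<close> and the circle parameter, and the integral is continuous in
  \<open>x\<close>.\<close>

lemma holomorphic_derivative_continuous:
  fixes G :: "complex ^ 'k::finite \<Rightarrow> complex"
  assumes S: "open S" and G: "holomorphic_function_on G S"
  shows "continuous_on S (\<lambda>x. frechet_derivative G (at x) v)"
proof (intro continuous_at_imp_continuous_on ballI)
  fix x0 assume "x0 \<in> S"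
  then obtain e where e: "e > 0" "cball x0 e \<subseteq> S" using S open_contains_cball by blast
  define r where "r = e / 2"
  have r: "0 < r" "cball x0 (2 * r) \<subseteq> S" using e by (auto simp: r_def)
  define \<rho> where "\<rho> = r / (1 + norm v)"
  have \<rho>: "0 < \<rho>" using r by (auto simp: \<rho>_def intro!: divide_pos_pos add_pos_nonneg)
  have G_cont: "continuous_on S G"
    using holomorphic_functionD(1)[OF G] has_derivative_continuous
    by (intro continuous_at_imp_continuous_on) blast
  have sub: "x + a *s v \<in> S" if "x \<in> ball x0 r" "norm a \<le> \<rho>" for x a
    using circle_in_ball[OF r(2,1)] that by (simp add: \<rho>_def)
  have nc: "norm (circlepath 0 \<rho> t) = \<rho>" for t
    using \<rho> by (simp add: circlepath norm_mult)
  have "continuous_on (ball x0 r \<times> cbox 0 1) (\<lambda>p. circlepath 0 \<rho> (snd p))"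
    unfolding circlepath by (intro continuous_intros)
  note [continuous_intros] = this
    bounded_linear.continuous_on[OF bounded_linear_smult_left]
  have ne: "circlepath 0 \<rho> t \<noteq> 0" for t using nc[of t] \<rho> by auto
  have "continuous_on (ball x0 r \<times> cbox 0 1)
      (\<lambda>p. G (fst p + circlepath 0 \<rho> (snd p) *s v) / circlepath 0 \<rho> (snd p))"
    by (intro continuous_intros continuous_on_compose2[OF G_cont]) (use sub nc ne in auto)
  then have "continuous_on (ball x0 r) (\<lambda>x. integral (cbox 0 1) (\<lambda>t. G (x + circlepath 0 \<rho> t *s v) / circlepath 0 \<rho> t))"
    by (intro integral_continuous_on_param) (simp add: split_beta)
  then have "continuous_on (ball x0 r) (\<lambda>x. frechet_derivative G (at x) v)"
    by (rule continuous_on_eq) (intro holomorphic_derivative_integral[OF G \<rho>, symmetric] sub)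
  then show "isCont (\<lambda>x. frechet_derivative G (at x) v) x0"
    using r(1) continuous_on_eq_continuous_at[OF open_ball] centre_in_ball by blast
qed

text \<open>Differentiation under the Cauchy integral: holomorphy is inherited by directional
  derivatives, so it can be iterated. The derivative of the integrand involves the first derivative
  of \<open>G\<close>, whose continuity is the preceding lemma.\<close>

lemma holomorphic_function_derivative:
  fixes G :: "complex ^ 'k::finite \<Rightarrow> complex"
  assumes S: "open S" and G: "holomorphic_function_on G S"
  shows "holomorphic_function_on (\<lambda>x. frechet_derivative G (at x) v) S"
  unfolding holomorphic_function_on_def
proof
  fix x0 assume "x0 \<in> S"
  then obtain e where e: "e > 0" "cball x0 e \<subseteq> S" using S open_contains_cball by blast
  define r where "r = e / 2"
  have r: "0 < r" "cball x0 (2 * r) \<subseteq> S" using e by (auto simp: r_def)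
  define \<rho> where "\<rho> = r / (1 + norm v)"
  have \<rho>: "0 < \<rho>" using r by (auto simp: \<rho>_def intro!: divide_pos_pos add_pos_nonneg)
  define \<gamma> where "\<gamma> = circlepath 0 \<rho>"
  have sub: "x + a *s v \<in> S" if "x \<in> ball x0 r" "norm a \<le> \<rho>" for x a
    using circle_in_ball[OF r(2,1)] that by (simp add: \<rho>_def)
  have nc: "norm (\<gamma> t) = \<rho>" for t
    using \<rho> by (simp add: \<gamma>_def circlepath norm_mult)
  have n0: "\<gamma> t \<noteq> 0" for t using nc[of t] \<rho> by auto
  have sub\<gamma>: "x + \<gamma> t *s v \<in> S" if "x \<in> ball x0 r" for x t
    using sub[OF that] nc by simp
  have G_cont: "continuous_on S G"
    using holomorphic_functionD(1)[OF G] has_derivative_continuous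
    by (intro continuous_at_imp_continuous_on) blast
  \<comment> \<open>The rule for differentiating under the integral wants the derivative of the
    integrand as an element of the space of bounded linear maps.\<close>
  define D where "D x t = Blinfun (\<lambda>w. frechet_derivative G (at (x + \<gamma> t *s v)) w / \<gamma> t)" for x t
  have D: "blinfun_apply (D x t) w = frechet_derivative G (at (x + \<gamma> t *s v)) w / \<gamma> t"
    if "x \<in> ball x0 r" for x t w
  proof -
    have "bounded_linear (\<lambda>w. frechet_derivative G (at (x + \<gamma> t *s v)) w / \<gamma> t)"
      by (intro bounded_linear_compose[OF bounded_linear_divide]
          has_derivative_bounded_linear[OF holomorphic_functionD(1)[OF G sub\<gamma>[OF that]]])
    then show ?thesis unfolding D_def by (simp add: bounded_linear_Blinfun_apply)
  qed
  have \<gamma>_cont: "continuous_on X \<gamma>" for X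
    unfolding \<gamma>_def circlepath by (intro continuous_intros)
  have \<gamma>_cont2: "continuous_on X (\<lambda>p. \<gamma> (snd p))" for X :: "((complex ^ 'k) \<times> real) set"
    using continuous_on_compose2[OF \<gamma>_cont[of UNIV] continuous_on_snd[OF continuous_on_id]] by simp
  note [continuous_intros] = \<gamma>_cont2 \<gamma>_cont bounded_linear.continuous_on[OF bounded_linear_smult_left]
  \<comment> \<open>In finite dimension, continuity in the operator norm can be tested on one basis
    vector at a time.\<close>
  have D_cont: "continuous_on (ball x0 r \<times> cbox 0 1) (\<lambda>(x, t). D x t)"
    unfolding split_beta continuous_on_eq_continuous_within
  proof (intro ballI continuous_blinfun_componentwiseI1)
    fix p :: "(complex ^ 'k) \<times> real" and b assume p: "p \<in> ball x0 r \<times> cbox 0 1"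
    have "continuous_on (ball x0 r \<times> cbox 0 1) (\<lambda>p. frechet_derivative G (at (fst p + \<gamma> (snd p) *s v)) b / \<gamma> (snd p))"
      by (intro continuous_intros continuous_on_compose2[OF holomorphic_derivative_continuous[OF S G]])
        (use sub\<gamma> n0 in auto)
    then have "continuous_on (ball x0 r \<times> cbox 0 1) (\<lambda>p. blinfun_apply (D (fst p) (snd p)) b)"
      by (rule continuous_on_eq) (auto simp: D)
    then show "continuous (at p within ball x0 r \<times> cbox 0 1) (\<lambda>p. blinfun_apply (D (fst p) (snd p)) b)"
      using p unfolding continuous_on_eq_continuous_within by blast
  qed
  have x0: "x0 \<in> ball x0 r" using r by simp
  have "((\<lambda>x. integral (cbox 0 1) (\<lambda>t. G (x + \<gamma> t *s v) / \<gamma> t)) has_derivative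
    blinfun_apply (integral (cbox 0 1) (D x0))) (at x0 within ball x0 r)"
  proof (rule leibniz_rule[OF _ _ D_cont x0 convex_ball])
    fix x t assume x: "x \<in> ball x0 r"
    have "((\<lambda>x. x + \<gamma> t *s v) has_derivative (\<lambda>h. h)) (at x)"
      by (auto intro!: derivative_eq_intros)
    from diff_chain_at[OF this holomorphic_functionD(1)[OF G sub\<gamma>[OF x]]]
    have "((\<lambda>x. G (x + \<gamma> t *s v)) has_derivative frechet_derivative G (at (x + \<gamma> t *s v))) (at x)"
      by (simp add: o_def)
    from bounded_linear.has_derivative[OF bounded_linear_divide this]
    have "((\<lambda>x. G (x + \<gamma> t *s v) / \<gamma> t) has_derivative (\<lambda>w. frechet_derivative G (at (x + \<gamma> t *s v)) w / \<gamma> t)) (at x)" .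
    moreover have "(\<lambda>w. frechet_derivative G (at (x + \<gamma> t *s v)) w / \<gamma> t) = blinfun_apply (D x t)"
      using D[OF x] by auto
    ultimately show "((\<lambda>x. G (x + \<gamma> t *s v) / \<gamma> t) has_derivative blinfun_apply (D x t)) (at x within ball x0 r)"
      by (simp add: has_derivative_at_withinI)
  next
    fix x assume x: "x \<in> ball x0 r"
    show "(\<lambda>t. G (x + \<gamma> t *s v) / \<gamma> t) integrable_on cbox 0 1"
      by (intro integrable_continuous continuous_intros continuous_on_compose2[OF G_cont])
        (use x sub\<gamma> n0 in auto)
  qed
  then have der: "((\<lambda>x. integral (cbox 0 1) (\<lambda>t. G (x + \<gamma> t *s v) / \<gamma> t)) has_derivative
    blinfun_apply (integral (cbox 0 1) (D x0))) (at x0)"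
    using at_within_open[OF x0 open_ball] by simp
  have eq: "integral (cbox 0 1) (\<lambda>t. G (x + \<gamma> t *s v) / \<gamma> t) = frechet_derivative G (at x) v"
    if "x \<in> ball x0 r" for x
    unfolding \<gamma>_def using that by (intro holomorphic_derivative_integral[OF G \<rho>, symmetric] sub)
  have "((\<lambda>x. frechet_derivative G (at x) v) has_derivative blinfun_apply (integral (cbox 0 1) (D x0))) (at x0)"
    by (rule has_derivative_transform_within_open[OF der open_ball x0 eq])
  \<comment> \<open>Complex linearity holds for every value of the integrand and passes through the
    integral.\<close>
  moreover have "blinfun_apply (integral (cbox 0 1) (D x0)) (a *s w) = a * blinfun_apply (integral (cbox 0 1) (D x0)) w" for a w
  proof -
    have "continuous_on (cbox 0 1) (D x0)"
      using continuous_on_compose2[OF D_cont continuous_on_Pair[OF continuous_on_const continuous_on_id], of x0 "cbox 0 1"] x0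
      by (simp add: image_subset_iff)
    then have i: "D x0 integrable_on cbox 0 1" by (rule integrable_continuous)
    have "blinfun_apply (D x0 t) (a *s w) = a * blinfun_apply (D x0 t) w" for t
      by (simp add: D[OF x0] holomorphic_functionD(2)[OF G sub\<gamma>[OF x0]])
    then show ?thesis unfolding blinfun_apply_integral[OF i] by (simp only: integral_mult_right)
  qed
  ultimately show "\<exists>D. ((\<lambda>x. frechet_derivative G (at x) v) has_derivative D) (at x0) \<and> (\<forall>a v. D (a *s v) = a * D v)"
    by blast
qed

lemma holomorphic_function_diff_order:
  assumes S: "open S" and G: "holomorphic_function_on G S"
  shows "diff_order n S G"
  using G
proof (induction n arbitrary: G)
  case 0
  then show ?case using holomorphic_functionD(1) by (auto simp: differentiable_def)
next
  case (Suc n)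
  have "diff_order n S (\<lambda>x. frechet_derivative G (at x) v)" for v
    by (intro Suc.IH holomorphic_function_derivative[OF S Suc.prems])
  then show ?case by (intro diff_order_SucI[OF S holomorphic_functionD(1)[OF Suc.prems]])
qed

lemma holomorphic_map_component:
  assumes "holomorphic_map_on F S"
  shows "holomorphic_function_on (\<lambda>x. F x $ i) S"
  unfolding holomorphic_function_on_def
proof
  fix x assume "x \<in> S"
  then obtain D where D: "(F has_derivative D) (at x)" "\<forall>a v. D (a *s v) = a *s D v"
    using assms unfolding holomorphic_map_on_def by blast
  have "((\<lambda>x. F x $ i) has_derivative (\<lambda>v. D v $ i)) (at x)"
    by (rule bounded_linear.has_derivative[OF bounded_linear_vec_nth D(1)])
  then show "\<exists>D. ((\<lambda>x. F x $ i) has_derivative D) (at x) \<and> (\<forall>a v. D (a *s v) = a * D v)"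
    using D(2) by auto
qed

lemma bounded_linear_axis: "bounded_linear (axis i :: 'a::real_normed_vector \<Rightarrow> 'a ^ 'n::finite)"
proof (rule bounded_linear_intro[of _ 1])
  fix x :: 'a
  have "(norm (axis i x $ j))\<^sup>2 = (if j = i then (norm x)\<^sup>2 else 0)" for j :: 'n
    by (simp add: axis_def)
  then have "norm (axis i x :: 'a ^ 'n) = norm x" by (simp add: norm_vec_def L2_set_def)
  then show "norm (axis i x :: 'a ^ 'n) \<le> norm x * 1" by simp
qed (auto simp: vec_eq_iff axis_def)

lemma diff_order_vec:
  fixes F :: "'a::real_normed_vector \<Rightarrow> ('b::real_normed_vector) ^ 'n::finite"
  assumes S: "open S" and F: "\<And>i. diff_order n S (\<lambda>x. F x $ i)"
  shows "diff_order n S F"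
proof -
  have "(\<Sum>i\<in>UNIV. axis i (F x $ i)) = F x" for x
    by (simp add: vec_eq_iff axis_def)
  moreover have "diff_order n S (\<lambda>x. \<Sum>i\<in>UNIV. axis i (F x $ i))"
    by (intro diff_order_sum diff_order_linear_compose[OF S bounded_linear_axis] S F)
  ultimately show ?thesis by simp
qed

lemma holomorphic_map_diff_order:
  assumes S: "open S" and F: "holomorphic_map_on F S"
  shows "diff_order n S F"
  by (intro diff_order_vec S holomorphic_function_diff_order[OF S] holomorphic_map_component F)

subsection \<open>The Levi form\<close>

lemma line_derivative:
  assumes "diff_order n S f" "x + t *\<^sub>R v \<in> S"
  shows "((\<lambda>t. f (x + t *\<^sub>R v)) has_vector_derivative frechet_derivative f (at (x + t *\<^sub>R v)) v) (at t)"
proof -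
  note D = diff_order_has_derivative[OF assms]
  have "((\<lambda>t. x + t *\<^sub>R v) has_derivative (\<lambda>h. h *\<^sub>R v)) (at t)"
    by (auto intro!: derivative_eq_intros)
  from diff_chain_at[OF this D]
  have "((\<lambda>t. f (x + t *\<^sub>R v)) has_derivative (\<lambda>h. frechet_derivative f (at (x + t *\<^sub>R v)) (h *\<^sub>R v))) (at t)"
    by (simp add: o_def)
  then show ?thesis
    by (simp add: has_vector_derivative_def linear_cmul[OF has_derivative_linear[OF D]])
qed

text \<open>The mean value theorem is used twice: along \<open>v\<close> for the difference of two
  translates of \<open>f\<close>, then along \<open>w\<close> for the derivative in direction
  \<open>v\<close>. The left-hand side is symmetric in \<open>v\<close> and \<open>w\<close>, which
  is what Schwarz's theorem exploits.\<close>

lemma second_difference: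
  fixes f :: "'a::real_normed_vector \<Rightarrow> real"
  assumes f: "diff_order 1 S f" and s: "0 < s"
    and sub: "\<And>a b. 0 \<le> a \<Longrightarrow> a \<le> s \<Longrightarrow> 0 \<le> b \<Longrightarrow> b \<le> s \<Longrightarrow> x + a *\<^sub>R v + b *\<^sub>R w \<in> S"
  shows "\<exists>a b. 0 < a \<and> a < s \<and> 0 < b \<and> b < s \<and>
    f (x + s *\<^sub>R v + s *\<^sub>R w) - f (x + s *\<^sub>R v) - f (x + s *\<^sub>R w) + f x
    = s * s * iter_deriv [v, w] f (x + a *\<^sub>R v + b *\<^sub>R w)"
proof -
  have f1: "diff_order 0 S (\<lambda>y. frechet_derivative f (at y) v)" using f by simp
  define g where "g a = f ((x + s *\<^sub>R w) + a *\<^sub>R v) - f (x + a *\<^sub>R v)" for a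
  have "(g has_real_derivative frechet_derivative f (at ((x + s *\<^sub>R w) + a *\<^sub>R v)) v - frechet_derivative f (at (x + a *\<^sub>R v)) v) (at a)"
    if "0 \<le> a" "a \<le> s" for a
    unfolding g_def has_real_derivative_iff_has_vector_derivative
    using sub[OF that, of s] sub[OF that, of 0] s
    by (intro has_vector_derivative_diff line_derivative[OF f]) (simp_all add: algebra_simps)
  from MVT2[OF s this] obtain a where a: "0 < a" "a < s"
    "g s - g 0 = (s - 0) * (frechet_derivative f (at ((x + s *\<^sub>R w) + a *\<^sub>R v)) v - frechet_derivative f (at (x + a *\<^sub>R v)) v)"
    by blast
  define h where "h b = frechet_derivative f (at ((x + a *\<^sub>R v) + b *\<^sub>R w)) v" for b
  have "(h has_real_derivative iter_deriv [v, w] f (x + a *\<^sub>R v + b *\<^sub>R w)) (at b)"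
    if "0 \<le> b" "b \<le> s" for b
    unfolding h_def has_real_derivative_iff_has_vector_derivative
    using sub[of a b] that a line_derivative[OF f1] by simp
  from MVT2[OF s this] obtain b where b: "0 < b" "b < s"
    "h s - h 0 = (s - 0) * iter_deriv [v, w] f (x + a *\<^sub>R v + b *\<^sub>R w)"
    by blast
  have "g s - g 0 = s * (h s - h 0)" using a(3) by (simp add: h_def algebra_simps)
  then have "g s - g 0 = s * s * iter_deriv [v, w] f (x + a *\<^sub>R v + b *\<^sub>R w)" using b(3) by simp
  moreover have "g s - g 0 = f (x + s *\<^sub>R v + s *\<^sub>R w) - f (x + s *\<^sub>R v) - f (x + s *\<^sub>R w) + f x"
    by (simp add: g_def algebra_simps)
  ultimately show ?thesis using a(1,2) b(1,2) by auto
qed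

text \<open>The symmetric second difference, expressed in both ways, forces the two mixed
  derivatives to share values at points arbitrarily close to \<open>x\<close>; continuity there
  makes them equal.\<close>

lemma iter_deriv_commute_real:
  fixes f :: "'a::real_normed_vector \<Rightarrow> real"
  assumes S: "open S" "x \<in> S" and f: "diff_order 2 S f"
  shows "iter_deriv [v, w] f x = iter_deriv [w, v] f x"
proof (rule ccontr)
  assume ne: "iter_deriv [v, w] f x \<noteq> iter_deriv [w, v] f x"
  \<comment> \<open>Half the gap: no number is closer than this to both derivatives.\<close>
  define e where "e = \<bar>iter_deriv [v, w] f x - iter_deriv [w, v] f x\<bar> / 2"
  have e: "e > 0" using ne by (simp add: e_def)
  have c: "isCont (iter_deriv [v, w] f) x" for v w
  proof -
    have "iter_deriv [v, w] f differentiable at x"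
      using f[unfolded diff_order_iff_iter_deriv, rule_format, of "[v, w]" x] S(2)
      by (simp del: iter_deriv.simps)
    then show ?thesis by (rule differentiable_imp_continuous_within)
  qed
  obtain d1 where d1: "d1 > 0" "\<And>y. dist y x < d1 \<Longrightarrow> dist (iter_deriv [v, w] f y) (iter_deriv [v, w] f x) < e"
    using c[of v w] e unfolding continuous_at_eps_delta by metis
  obtain d2 where d2: "d2 > 0" "\<And>y. dist y x < d2 \<Longrightarrow> dist (iter_deriv [w, v] f y) (iter_deriv [w, v] f x) < e"
    using c[of w v] e unfolding continuous_at_eps_delta by metis
  obtain d3 where d3: "d3 > 0" "ball x d3 \<subseteq> S" using S open_contains_ball by blast
  define d where "d = min d1 (min d2 d3)"
  \<comment> \<open>With this side length the whole parallelogram spanned by \<open>s v\<close> and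
    \<open>s w\<close> at \<open>x\<close> stays within distance \<open>d\<close>.\<close>
  define s where "s = d / (1 + norm v + norm w)"
  have d: "d > 0" using d1 d2 d3 by (simp add: d_def)
  have p: "1 + norm v + norm w > 0" by (simp add: add_pos_nonneg)
  have s: "s > 0" using d p by (simp add: s_def)
  have near: "dist (x + a *\<^sub>R v + b *\<^sub>R w) x < d" if "0 \<le> a" "a \<le> s" "0 \<le> b" "b \<le> s" for a b
  proof -
    have "norm (a *\<^sub>R v + b *\<^sub>R w) \<le> a * norm v + b * norm w"
      using that norm_triangle_ineq[of "a *\<^sub>R v" "b *\<^sub>R w"] by simp
    also have "\<dots> \<le> s * norm v + s * norm w" using that by (intro add_mono mult_right_mono) auto
    also have "\<dots> < s * (1 + norm v + norm w)" using s by (simp add: algebra_simps)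
    also have "\<dots> = d" using p by (simp add: s_def)
    finally show ?thesis by (simp add: dist_norm add.assoc)
  qed
  have sub: "x + a *\<^sub>R v + b *\<^sub>R w \<in> S" if "0 \<le> a" "a \<le> s" "0 \<le> b" "b \<le> s" for a b
    using near[OF that] d3 by (auto simp: d_def dist_commute)
  have sub': "x + a *\<^sub>R w + b *\<^sub>R v \<in> S" if "0 \<le> a" "a \<le> s" "0 \<le> b" "b \<le> s" for a b
    using sub[of b a] that by (simp add: algebra_simps)
  have f1: "diff_order 1 S f" using diff_order_Suc[of 1] f by (simp add: numeral_2_eq_2)
  obtain a b where ab: "0 < a" "a < s" "0 < b" "b < s"
    "f (x + s *\<^sub>R v + s *\<^sub>R w) - f (x + s *\<^sub>R v) - f (x + s *\<^sub>R w) + f x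
     = s * s * iter_deriv [v, w] f (x + a *\<^sub>R v + b *\<^sub>R w)"
    using second_difference[OF f1 s sub] by blast
  obtain a' b' where ab': "0 < a'" "a' < s" "0 < b'" "b' < s"
    "f (x + s *\<^sub>R w + s *\<^sub>R v) - f (x + s *\<^sub>R w) - f (x + s *\<^sub>R v) + f x
     = s * s * iter_deriv [w, v] f (x + a' *\<^sub>R w + b' *\<^sub>R v)"
    using second_difference[OF f1 s sub'] by blast
  have "s * s * iter_deriv [v, w] f (x + a *\<^sub>R v + b *\<^sub>R w) = s * s * iter_deriv [w, v] f (x + a' *\<^sub>R w + b' *\<^sub>R v)"
    using ab(5) ab'(5) by (simp add: algebra_simps)
  then have eq: "iter_deriv [v, w] f (x + a *\<^sub>R v + b *\<^sub>R w) = iter_deriv [w, v] f (x + b' *\<^sub>R v + a' *\<^sub>R w)"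
    using s by (simp add: algebra_simps)
  have "dist (iter_deriv [v, w] f (x + a *\<^sub>R v + b *\<^sub>R w)) (iter_deriv [v, w] f x) < e"
    using near[of a b] ab by (intro d1) (auto simp: d_def)
  moreover have "dist (iter_deriv [w, v] f (x + b' *\<^sub>R v + a' *\<^sub>R w)) (iter_deriv [w, v] f x) < e"
    using near[of b' a'] ab' by (intro d2) (auto simp: d_def)
  moreover have False if "dist p a < \<bar>a - b\<bar> / 2" "dist p b < \<bar>a - b\<bar> / 2" for p a b :: real
    using dist_triangle_half_r[OF that] by (simp add: dist_real_def)
  ultimately show False unfolding eq e_def by blast
qed

lemma frechet_derivative_linear_compose:
  assumes L: "bounded_linear L" and f: "f differentiable (at x)"
  shows "frechet_derivative (\<lambda>x. L (f x)) (at x) v = L (frechet_derivative f (at x) v)"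
  using frechet_derivative_at[OF bounded_linear.has_derivative[OF L f[unfolded frechet_derivative_works]], symmetric]
  by simp

lemma frechet_derivative_cong_open:
  assumes S: "open S" "x \<in> S" and eq: "\<And>y. y \<in> S \<Longrightarrow> f y = g y" and f: "f differentiable (at x)"
  shows "frechet_derivative f (at x) = frechet_derivative g (at x)"
  using has_derivative_transform_within_open[OF f[unfolded frechet_derivative_works] S eq]
  by (rule frechet_derivative_at)

lemma iter_deriv_linear_compose:
  assumes S: "open S" "x \<in> S" and L: "bounded_linear L" and f: "diff_order 2 S f"
  shows "iter_deriv [v, w] (\<lambda>y. L (f y)) x = L (iter_deriv [v, w] f x)"
proof -
  have f1: "(\<lambda>y. frechet_derivative f (at y) v) differentiable (at x)"
    using f S(2) by (simp add: numeral_2_eq_2)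
  have eq: "L (frechet_derivative f (at y) v) = frechet_derivative (\<lambda>y. L (f y)) (at y) v" if "y \<in> S" for y
    using frechet_derivative_linear_compose[OF L diff_order_differentiable[OF f that]] by simp
  have d: "(\<lambda>y. L (frechet_derivative f (at y) v)) differentiable (at x)"
    using bounded_linear.has_derivative[OF L f1[unfolded frechet_derivative_works]]
    by (auto simp: differentiable_def)
  show ?thesis
    using frechet_derivative_cong_open[OF S eq d] frechet_derivative_linear_compose[OF L f1] by simp
qed

lemma iter_deriv_commute:
  fixes f :: "'a::real_normed_vector \<Rightarrow> 'b::euclidean_space"
  assumes S: "open S" "x \<in> S" and f: "diff_order 2 S f"
  shows "iter_deriv [v, w] f x = iter_deriv [w, v] f x"
proof (rule euclidean_eqI)
  fix b :: 'b assume "b \<in> Basis"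
  have "diff_order 2 S (\<lambda>y. f y \<bullet> b)"
    by (rule diff_order_linear_compose[OF S(1) bounded_linear_inner_left f])
  then show "iter_deriv [v, w] f x \<bullet> b = iter_deriv [w, v] f x \<bullet> b"
    using iter_deriv_commute_real[OF S] iter_deriv_linear_compose[OF S bounded_linear_inner_left f] by metis
qed

text \<open>Along the line through \<open>x\<close> the first derivative is 0 at the maximum; a
  positive second derivative would make it positive just to the right, and \<open>f\<close> would
  exceed its maximum.\<close>

lemma iter_deriv_max_le_0:
  fixes f :: "'a::real_normed_vector \<Rightarrow> real"
  assumes S: "open S" "x \<in> S" and f: "diff_order 2 S f" and max: "\<And>y. y \<in> S \<Longrightarrow> f y \<le> f x"
  shows "iter_deriv [v, v] f x \<le> 0"
proof (rule ccontr)
  assume "\<not> iter_deriv [v, v] f x \<le> 0"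
  then have pos: "iter_deriv [v, v] f x > 0" by simp
  obtain e where e: "e > 0" "ball x e \<subseteq> S" using S open_contains_ball by blast
  define d where "d = e / (1 + norm v)"
  have p: "1 + norm v > 0" by (simp add: add_pos_nonneg)
  have d: "d > 0" using e p by (simp add: d_def)
  have sub: "x + t *\<^sub>R v \<in> S" if "\<bar>t\<bar> < d" for t
  proof -
    have "\<bar>t\<bar> * norm v \<le> \<bar>t\<bar> * (1 + norm v)" by (simp add: mult_left_mono)
    also have "\<dots> < d * (1 + norm v)" using that p by (intro mult_strict_right_mono) auto
    finally have "norm (t *\<^sub>R v) < e" using p by (simp add: d_def)
    then show ?thesis using e(2) by (auto simp: dist_norm)
  qed
  define \<phi> where "\<phi> t = f (x + t *\<^sub>R v)" for t
  define \<phi>' where "\<phi>' t = frechet_derivative f (at (x + t *\<^sub>R v)) v" for t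
  have f1: "diff_order 1 S (\<lambda>y. frechet_derivative f (at y) v)" using f by (simp add: numeral_2_eq_2)
  have D1: "(\<phi> has_real_derivative \<phi>' t) (at t)" if "\<bar>t\<bar> < d" for t
    unfolding \<phi>_def \<phi>'_def has_real_derivative_iff_has_vector_derivative by (rule line_derivative[OF f sub[OF that]])
  have "((\<lambda>t. frechet_derivative f (at (x + t *\<^sub>R v)) v) has_vector_derivative
      frechet_derivative (\<lambda>y. frechet_derivative f (at y) v) (at (x + 0 *\<^sub>R v)) v) (at 0)"
    by (rule line_derivative[OF f1 sub]) (use d in simp)
  then have D2: "(\<phi>' has_real_derivative iter_deriv [v, v] f x) (at 0)"
    by (simp add: \<phi>'_def[abs_def] has_real_derivative_iff_has_vector_derivative)
  have z: "\<phi>' 0 = 0"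
    by (rule DERIV_local_max[OF D1 d]) (use d sub max in \<open>auto simp: \<phi>_def\<close>)
  obtain c where c: "c > 0" "\<And>h. 0 < h \<Longrightarrow> h < c \<Longrightarrow> \<phi>' 0 < \<phi>' h"
    using DERIV_pos_inc_right[OF D2 pos] by auto
  define t where "t = min c d / 2"
  have t: "0 < t" "t < c" "t < d" using c d by (auto simp: t_def)
  have "(\<phi> has_real_derivative \<phi>' u) (at u)" if "0 \<le> u" "u \<le> t" for u
    using D1[of u] that t by auto
  from MVT2[OF t(1) this] obtain u where u: "0 < u" "u < t" "\<phi> t - \<phi> 0 = (t - 0) * \<phi>' u" by blast
  have "\<phi>' u > 0" using c(2)[of u] u t z by auto
  then have "\<phi> t - \<phi> 0 > 0" using u(3) t by simp
  moreover have "\<phi> t \<le> \<phi> 0" using max[OF sub[of t]] t by (simp add: \<phi>_def)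
  ultimately show False by simp
qed

text \<open>The Wirtinger derivatives are the coefficients of the complex linear and the conjugate
  linear part of the real differential; comparing the values at \<open>v\<close> and
  \<open>\<i> *s v\<close> separates the two parts.\<close>

lemma wirtinger_sum:
  fixes g :: "complex ^ 'k::finite \<Rightarrow> complex"
  assumes "g differentiable (at x)"
  shows "(\<Sum>a\<in>UNIV. wirtinger a g x * v $ a) =
    (frechet_derivative g (at x) v - \<i> * frechet_derivative g (at x) (\<i> *s v)) / 2" (is ?A)
  and "(\<Sum>b\<in>UNIV. wirtinger_bar b g x * cnj (v $ b)) =
    (frechet_derivative g (at x) v + \<i> * frechet_derivative g (at x) (\<i> *s v)) / 2" (is ?B)
proof -
  define D where "D = frechet_derivative g (at x)"
  have "linear D"
    unfolding D_def using assms[unfolded frechet_derivative_works] by (rule has_derivative_linear)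
  then interpret D: linear D .
  \<comment> \<open>The differential is only real linear, so each complex coordinate has to be split
    into its two real directions.\<close>
  have ax: "axis a z = Re z *\<^sub>R axis a 1 + Im z *\<^sub>R (axis a \<i> :: complex ^ 'k)" for a z
    by (auto simp: vec_eq_iff axis_def complex_eq_iff)
  have rep: "D u = (\<Sum>a\<in>UNIV. Re (u $ a) *\<^sub>R D (axis a 1) + Im (u $ a) *\<^sub>R D (axis a \<i>))" for u
  proof -
    have "u = (\<Sum>a\<in>UNIV. axis a (u $ a))" by (simp add: vec_eq_iff axis_def)
    then have "D u = D (\<Sum>a\<in>UNIV. axis a (u $ a))" by simp
    also have "\<dots> = (\<Sum>a\<in>UNIV. D (axis a (u $ a)))" by (rule D.sum)
    also have "\<dots> = (\<Sum>a\<in>UNIV. Re (u $ a) *\<^sub>R D (axis a 1) + Im (u $ a) *\<^sub>R D (axis a \<i>))"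
      by (subst ax) (simp add: D.add D.scale)
    finally show ?thesis .
  qed
  have "(D v - \<i> * D (\<i> *s v)) / 2 = (\<Sum>a\<in>UNIV. (D (axis a 1) - \<i> * D (axis a \<i>)) / 2 * v $ a)"
    unfolding rep[of v] rep[of "\<i> *s v"] sum_distrib_left sum_subtractf[symmetric] sum_divide_distrib
    by (intro sum.cong) (auto simp: complex_eq_iff algebra_simps)
  then show ?A by (simp add: wirtinger_def D_def)
  have "(D v + \<i> * D (\<i> *s v)) / 2 = (\<Sum>a\<in>UNIV. (D (axis a 1) + \<i> * D (axis a \<i>)) / 2 * cnj (v $ a))"
    unfolding rep[of v] rep[of "\<i> *s v"] sum_distrib_left sum.distrib[symmetric] sum_divide_distrib
    by (intro sum.cong) (auto simp: complex_eq_iff algebra_simps)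
  then show ?B by (simp add: wirtinger_bar_def D_def)
qed

lemma frechet_derivative_lin_comb:
  fixes f g :: "'a::real_normed_vector \<Rightarrow> complex"
  assumes "f differentiable (at x)" "g differentiable (at x)"
  shows "frechet_derivative (\<lambda>y. (f y + c * g y) / d) (at x) v =
    (frechet_derivative f (at x) v + c * frechet_derivative g (at x) v) / d"
proof -
  have "((\<lambda>y. (f y + c * g y) / d) has_derivative
      (\<lambda>v. (frechet_derivative f (at x) v + c * frechet_derivative g (at x) v) / d)) (at x)"
    by (intro bounded_linear.has_derivative[OF bounded_linear_divide] has_derivative_add
        bounded_linear.has_derivative[OF bounded_linear_mult_right] assms[unfolded frechet_derivative_works])
  from frechet_derivative_at[OF this, symmetric] show ?thesis by simp
qed

lemma diff_order_wirtinger_bar: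
  assumes S: "open S" and g: "diff_order (Suc n) S g"
  shows "diff_order n S (wirtinger_bar b g)"
  unfolding wirtinger_bar_def[abs_def]
  using g by (intro diff_order_linear_compose[OF S bounded_linear_divide] diff_order_add[OF S]
      diff_order_linear_compose[OF S bounded_linear_mult_right]) auto

lemma diff_order_wirtinger:
  assumes S: "open S" and g: "diff_order (Suc n) S g"
  shows "diff_order n S (wirtinger a g)"
proof -
  have "diff_order n S (\<lambda>x. (frechet_derivative g (at x) (axis a 1) + (- \<i>) * frechet_derivative g (at x) (axis a \<i>)) / 2)"
    using g by (intro diff_order_linear_compose[OF S bounded_linear_divide] diff_order_add[OF S]
      diff_order_linear_compose[OF S bounded_linear_mult_right]) auto
  then show ?thesis by (simp add: wirtinger_def[abs_def])
qed

text \<open>The complex Hessian of \<open>g\<close> at \<open>x\<close>, restricted to the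
  diagonal.\<close>

definition levi_form :: "(complex ^ 'k::finite \<Rightarrow> complex) \<Rightarrow> complex ^ 'k \<Rightarrow> complex ^ 'k \<Rightarrow> complex" where
  "levi_form g x v = (\<Sum>a\<in>UNIV. \<Sum>b\<in>UNIV. wirtinger a (wirtinger_bar b g) x * v $ a * cnj (v $ b))"

text \<open>Up to the factor 1/4 this is the Laplacian of \<open>g\<close> along the complex line in
  direction \<open>v\<close>, which brings the real second-derivative test to bear.\<close>

lemma levi_form_eq:
  fixes g :: "complex ^ 'k::finite \<Rightarrow> complex"
  assumes S: "open S" "x \<in> S" and g: "diff_order 2 S g"
  shows "levi_form g x v = (iter_deriv [v, v] g x + iter_deriv [\<i> *s v, \<i> *s v] g x) / 4"
proof -
  \<comment> \<open>The conjugate linear part of the differential in the fixed direction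
    \<open>v\<close>; its complex linear part in the same direction is the Levi form.\<close>
  define P where "P y = (\<Sum>b\<in>UNIV. wirtinger_bar b g y * cnj (v $ b))" for y
  have g1: "diff_order (Suc 1) S g" using g by (simp add: numeral_2_eq_2)
  have d: "wirtinger_bar b g differentiable (at x)" for b
    using diff_order_differentiable[OF diff_order_wirtinger_bar[OF S(1) g1] S(2)] .
  have DP: "frechet_derivative P (at x) u = (\<Sum>b\<in>UNIV. frechet_derivative (wirtinger_bar b g) (at x) u * cnj (v $ b))" for u
  proof -
    have "(P has_derivative (\<lambda>u. \<Sum>b\<in>UNIV. frechet_derivative (wirtinger_bar b g) (at x) u * cnj (v $ b))) (at x)"
      unfolding P_def
      by (intro has_derivative_sum bounded_linear.has_derivative[OF bounded_linear_mult_left]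
          d[unfolded frechet_derivative_works])
    from frechet_derivative_at[OF this, symmetric] show ?thesis by simp
  qed
  have Pdiff: "P differentiable (at x)"
    unfolding P_def by (intro differentiable_sum differentiable_mult differentiable_const) (simp_all add: d)
  have dg: "(\<lambda>y. frechet_derivative g (at y) u) differentiable (at x)" for u
    using g1 S(2) by simp
  have DP2: "frechet_derivative P (at x) u = (iter_deriv [v, u] g x + \<i> * iter_deriv [\<i> *s v, u] g x) / 2" for u
  proof -
    have "frechet_derivative P (at x) = frechet_derivative (\<lambda>y. (frechet_derivative g (at y) v + \<i> * frechet_derivative g (at y) (\<i> *s v)) / 2) (at x)"
      by (rule frechet_derivative_cong_open[OF S _ Pdiff])
        (use wirtinger_sum(2) diff_order_differentiable[OF g] P_def in auto)
    then show ?thesis by (simp add: frechet_derivative_lin_comb[OF dg dg])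
  qed
  have "levi_form g x v =
    (\<Sum>b\<in>UNIV. (\<Sum>a\<in>UNIV. wirtinger a (wirtinger_bar b g) x * v $ a) * cnj (v $ b))"
    unfolding levi_form_def by (subst sum.swap) (simp add: sum_distrib_right)
  also have "\<dots> = (frechet_derivative P (at x) v - \<i> * frechet_derivative P (at x) (\<i> *s v)) / 2"
    unfolding wirtinger_sum(1)[OF d] DP
    by (simp add: sum_distrib_left sum_subtractf sum_divide_distrib algebra_simps diff_divide_distrib)
  \<comment> \<open>The mixed terms carry the factors \<open>\<i>\<close> and \<open>-\<i>\<close>
    and cancel by symmetry of second derivatives.\<close>
  also have "\<dots> = (iter_deriv [v, v] g x + iter_deriv [\<i> *s v, \<i> *s v] g x) / 4"
    unfolding DP2 iter_deriv_commute[OF S g, of "\<i> *s v" v]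
    by (simp del: iter_deriv.simps add: algebra_simps add_divide_distrib diff_divide_distrib)
  finally show ?thesis .
qed

text \<open>At a maximum of \<open>Re g\<close> the second derivatives of \<open>Re g\<close> along
  both \<open>v\<close> and \<open>\<i> *s v\<close> are nonpositive, and the Levi form averages
  them.\<close>

lemma levi_form_max:
  fixes g :: "complex ^ 'k::finite \<Rightarrow> complex"
  assumes S: "open S" "x \<in> S" and g: "diff_order 2 S g" and max: "\<And>y. y \<in> S \<Longrightarrow> Re (g y) \<le> Re (g x)"
  shows "Re (levi_form g x v) \<le> 0"
proof -
  have "diff_order 2 S (\<lambda>y. Re (g y))"
    by (rule diff_order_linear_compose[OF S(1) bounded_linear_Re g])
  from iter_deriv_max_le_0[OF S this max]
  have "Re (iter_deriv [u, u] g x) \<le> 0" for u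
    unfolding iter_deriv_linear_compose[OF S bounded_linear_Re g] .
  from this[of v] this[of "\<i> *s v"] show ?thesis
    unfolding levi_form_eq[OF S g] by simp
qed

subsection \<open>Charts and smooth forms\<close>

text \<open>Makes multiplication of a form by a function an instance of the general product rules,
  for smoothness and for uniform limits alike.\<close>

lemma bounded_bilinear_matrix_scale:
  "bounded_bilinear (\<lambda>(z::complex) (m :: complex ^ 'k ^ 'k::finite). \<chi> i j. z * m $ i $ j)"
proof (rule bounded_bilinear.intro)
  have "norm (\<chi> i j. z * m $ i $ j) = norm z * norm m" for z :: complex and m :: "complex ^ 'k ^ 'k"
    by (simp add: norm_vec_def norm_mult L2_set_right_distrib[symmetric] L2_set_nonneg)
  then show "\<exists>K. \<forall>z (m :: complex ^ 'k ^ 'k). norm (\<chi> i j. z * m $ i $ j) \<le> norm z * norm m * K"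
    by (intro exI[of _ 1]) simp
qed (simp_all add: vec_eq_iff algebra_simps)

lemma eval11_scale: "eval11 (\<chi> i j. z * m $ i $ j) v w = z * eval11 m v w"
  by (simp add: eval11_def sum_distrib_left algebra_simps)

lemma eval11_add: "eval11 (m + m') v w = eval11 m v w + eval11 m' v w"
  by (simp add: eval11_def sum.distrib algebra_simps)

lemma eval11_zero [simp]: "eval11 0 v w = 0"
  by (simp add: eval11_def)

lemma eval11_diff: "eval11 (m - m') v w = eval11 m v w - eval11 m' v w"
  by (simp add: eval11_def sum_subtractf algebra_simps)

lemma eval11_sum: "eval11 (\<Sum>s\<in>I. f s) v w = (\<Sum>s\<in>I. eval11 (f s) v w)"
  by (induction I rule: infinite_finite_induct) (simp_all add: eval11_add)

lemma eval11_axis: "eval11 m (axis a 1) (axis b 1) = m $ a $ b"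
proof -
  have "m $ i $ j * axis a 1 $ i * cnj (axis b 1 $ j) = (if i = a then if j = b then m $ i $ j else 0 else 0)" for i j
    by (auto simp: axis_def)
  then have "eval11 m (axis a 1) (axis b 1) = (\<Sum>i\<in>UNIV. \<Sum>j\<in>UNIV. if i = a then if j = b then m $ i $ j else 0 else 0)"
    by (simp add: eval11_def)
  also have "\<dots> = (\<Sum>i\<in>UNIV. if i = a then m $ i $ b else 0)"
    by (intro sum.cong) auto
  finally show ?thesis by simp
qed

lemma eval11_eqI: "(\<And>v w. eval11 m v w = eval11 m' v w) \<Longrightarrow> m = m'"
  unfolding vec_eq_iff eval11_axis[symmetric] by blast

lemma eval11_rank_one: "eval11 (\<chi> i j. a $ i * b $ j) v w = eval10 a v * eval01 b w"
  by (simp add: eval11_def eval10_def eval01_def sum_product algebra_simps)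

locale complex_manifold =
  fixes A :: "('m::t2_space, 'k::finite) chart set"
  assumes atlas: "complex_atlas A"
begin

context
  fixes c assumes c: "c \<in> A"
begin

lemma open_chart_domain: "open (fst c)"
  and open_chart_image: "open (chart_image c)"
  and chart_inv_left: "p \<in> fst c \<Longrightarrow> chart_inv c (snd c p) = p"
  and chart_inv_right: "x \<in> chart_image c \<Longrightarrow> snd c (chart_inv c x) = x"
  and chart_inv_in: "x \<in> chart_image c \<Longrightarrow> chart_inv c x \<in> fst c"
  and chart_in: "p \<in> fst c \<Longrightarrow> snd c p \<in> chart_image c"
  and continuous_chart: "continuous_on (fst c) (snd c)"
  and continuous_chart_inv: "continuous_on (chart_image c) (chart_inv c)"
proof -
  have ch: "is_chart c" using atlas c by (simp add: complex_atlas_def)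
  then obtain g where g: "homeomorphism (fst c) (snd c ` fst c) (snd c) g" by (auto simp: is_chart_def)
  show "open (fst c)" "open (chart_image c)" using ch by (auto simp: is_chart_def chart_image_def)
  have "inj_on (snd c) (fst c)" using g by (intro inj_on_inverseI[of _ g]) (simp add: homeomorphism_def)
  then show L: "p \<in> fst c \<Longrightarrow> chart_inv c (snd c p) = p" for p by (simp add: chart_inv_def)
  show "x \<in> chart_image c \<Longrightarrow> snd c (chart_inv c x) = x" for x
    by (simp add: chart_inv_def chart_image_def f_inv_into_f)
  show "x \<in> chart_image c \<Longrightarrow> chart_inv c x \<in> fst c" for x
    by (simp add: chart_inv_def chart_image_def inv_into_into)
  show "p \<in> fst c \<Longrightarrow> snd c p \<in> chart_image c" for p by (simp add: chart_image_def)
  show "continuous_on (fst c) (snd c)" using g by (simp add: homeomorphism_def)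
  have "continuous_on (chart_image c) g" using g by (simp add: homeomorphism_def chart_image_def)
  then show "continuous_on (chart_image c) (chart_inv c)"
    by (rule continuous_on_eq) (use g L in \<open>auto simp: chart_image_def homeomorphism_def\<close>)
qed

lemma open_image_chart:
  assumes "open U" "U \<subseteq> fst c"
  shows "open (snd c ` U)"
proof -
  have "snd c ` U = chart_image c \<inter> chart_inv c -` U"
    using assms(2) chart_inv_left chart_inv_right by (force simp: chart_image_def)
  then show ?thesis
    using continuous_open_preimage[OF continuous_chart_inv open_chart_image assms(1)] by simp
qed

lemma continuous_on_chart:
  fixes s :: "'m \<Rightarrow> 'e::real_normed_vector"
  assumes "diff_order n (chart_image c) (s \<circ> chart_inv c)"
  shows "continuous_on (fst c) s"
proof -
  have "continuous_on (chart_image c) (s \<circ> chart_inv c)"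
    by (intro continuous_at_imp_continuous_on ballI differentiable_imp_continuous_within
        diff_order_differentiable[OF assms])
  then have "continuous_on (fst c) (\<lambda>p. (s \<circ> chart_inv c) (snd c p))"
    by (rule continuous_on_compose2[OF _ continuous_chart]) (auto simp: chart_image_def)
  then show ?thesis by (rule continuous_on_eq) (simp add: chart_inv_left)
qed

end

lemma covered: obtains c where "c \<in> A" "p \<in> fst c"
proof -
  have "p \<in> (\<Union>c\<in>A. fst c)" using atlas by (simp add: complex_atlas_def)
  then show thesis using that by (elim UN_E)
qed

lemma continuous_on_UNIV_charts:
  assumes "\<And>c. c \<in> A \<Longrightarrow> continuous_on (fst c) s"
  shows "continuous_on UNIV s"
  unfolding continuous_on_eq_continuous_within
proof
  fix p :: 'm
  obtain c where c: "c \<in> A" "p \<in> fst c" by (rule covered)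
  then show "isCont s p"
    using assms[OF c(1)] continuous_on_eq_continuous_at[OF open_chart_domain[OF c(1)]] by blast
qed

context
  fixes c c' assumes c: "c \<in> A" and c': "c' \<in> A"
begin

lemma open_overlap: "open (snd c ` (fst c \<inter> fst c'))"
  by (intro open_image_chart[OF c] open_Int open_chart_domain c c') auto

text \<open>The atlas postulates one complex derivative of the transition maps; here Cauchy's
  formula turns it into derivatives of every order.\<close>

lemma transition_diff_order: "diff_order n (snd c ` (fst c \<inter> fst c')) (transition c c')"
  using atlas c c' by (intro holomorphic_map_diff_order open_overlap) (auto simp: complex_atlas_def)

lemma transition_chart: "p \<in> fst c \<Longrightarrow> transition c c' (snd c p) = snd c' p"
  by (simp add: transition_def chart_inv_left[OF c])

context
  fixes p assumes p: "p \<in> fst c" "p \<in> fst c'"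
begin

lemma transition_has_derivative:
  "(transition c c' has_derivative transition_deriv c c' p) (at (snd c p))"
  unfolding transition_deriv_def using p by (intro diff_order_has_derivative[OF transition_diff_order]) auto

lemma transition_deriv_smult: "transition_deriv c c' p (a *s v) = a *s transition_deriv c c' p v"
proof -
  have "holomorphic_map_on (transition c c') (snd c ` (fst c \<inter> fst c'))"
    using atlas c c' by (simp add: complex_atlas_def)
  then obtain D where D: "(transition c c' has_derivative D) (at (snd c p))" "\<forall>a v. D (a *s v) = a *s D v"
    using p unfolding holomorphic_map_on_def by blast
  then show ?thesis unfolding transition_deriv_def frechet_derivative_at[OF D(1), symmetric] by simp
qed

text \<open>Complex linearity allows complex coefficients here, so the transition derivative is
  given by a complex Jacobian matrix.\<close>

lemma transition_deriv_sum:
  "transition_deriv c c' p v = (\<Sum>i\<in>UNIV. v $ i *s transition_deriv c c' p (axis i 1))"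
proof -
  interpret D: linear "transition_deriv c c' p"
    by (rule has_derivative_linear[OF transition_has_derivative])
  have "v = (\<Sum>i\<in>UNIV. v $ i *s axis i 1)" by (simp add: vec_eq_iff axis_def if_distrib cong: if_cong)
  then have "transition_deriv c c' p v = transition_deriv c c' p (\<Sum>i\<in>UNIV. v $ i *s axis i 1)" by simp
  then show ?thesis by (simp add: D.sum transition_deriv_smult)
qed

end
end

lemma transition_deriv_chain:
  assumes c: "c \<in> A" "p \<in> fst c" and c': "c' \<in> A" "p \<in> fst c'" and c'': "c'' \<in> A" "p \<in> fst c''"
  shows "transition_deriv c c'' p v = transition_deriv c' c'' p (transition_deriv c c' p v)"
proof -
  \<comment> \<open>The composite of the transition maps is known to be the direct transition map
    only on the triple overlap, which is still an open neighbourhood of the point.\<close>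
  define U where "U = snd c ` (fst c \<inter> fst c' \<inter> fst c'')"
  have U: "open U" unfolding U_def
    by (intro open_image_chart[OF c(1)] open_Int open_chart_domain c c' c'') auto
  have e: "transition c c' (snd c p) = snd c' p" by (rule transition_chart[OF c(1) c'(1) c(2)])
  have "(transition c' c'' has_derivative transition_deriv c' c'' p) (at (transition c c' (snd c p)))"
    unfolding e by (rule transition_has_derivative[OF c'(1) c''(1) c'(2) c''(2)])
  from diff_chain_at[OF transition_has_derivative[OF c(1) c'(1) c(2) c'(2)] this]
  have "(transition c c'' has_derivative transition_deriv c' c'' p \<circ> transition_deriv c c' p) (at (snd c p))"
  proof (rule has_derivative_transform_within_open[OF _ U])
    show "snd c p \<in> U" using c c' c'' by (auto simp: U_def)
    show "(transition c' c'' \<circ> transition c c') x = transition c c'' x" if "x \<in> U" for x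
      using that c(1) c'(1) by (auto simp: U_def transition_def chart_inv_left)
  qed
  then show ?thesis unfolding transition_deriv_def[of c c''] by (simp add: frechet_derivative_at[symmetric])
qed

lemma smooth_coeffs_iff:
  "smooth_coeffs A s \<longleftrightarrow> (\<forall>c\<in>A. \<forall>n. diff_order n (chart_image c) (s c \<circ> chart_inv c))"
  by (simp add: smooth_coeffs_def smooth_on_iff_diff_order)

lemma smooth_function_iff:
  "smooth_function A f \<longleftrightarrow> (\<forall>c\<in>A. \<forall>n. diff_order n (chart_image c) (\<lambda>x. f (chart_inv c x)))"
  by (simp add: smooth_function_def smooth_on_iff_diff_order o_def)

lemma smooth_function_const: "smooth_function A (\<lambda>p. a)"
  by (simp add: smooth_function_iff diff_order_const open_chart_image)

lemma smooth_function_add: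
  "smooth_function A f \<Longrightarrow> smooth_function A g \<Longrightarrow> smooth_function A (\<lambda>p. f p + g p)"
  by (simp add: smooth_function_iff diff_order_add open_chart_image)

lemma smooth_function_mult:
  "smooth_function A f \<Longrightarrow> smooth_function A g \<Longrightarrow> smooth_function A (\<lambda>p. f p * g p)"
  by (simp add: smooth_function_iff diff_order_bilinear[OF _ bounded_bilinear_mult] open_chart_image)

lemma smooth_function_continuous: "smooth_function A f \<Longrightarrow> continuous_on UNIV f"
  by (intro continuous_on_UNIV_charts continuous_on_chart) (auto simp: smooth_function_iff o_def)

lemma smooth_coeffs_continuous:
  "smooth_coeffs A s \<Longrightarrow> continuous_coeffs A s"
  unfolding continuous_coeffs_def smooth_coeffs_iff by (auto intro: continuous_on_chart)

text \<open>Every point of the chart \<open>c'\<close> lies either in the overlap with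
  \<open>c\<close> or in the complement of \<open>K\<close>, where \<open>h\<close> vanishes.
  Closedness of \<open>K\<close> in the whole manifold makes that complement open.\<close>

lemma smooth_extension_by_zero:
  assumes c: "c \<in> A" and c': "c' \<in> A" and K: "closed K" "K \<subseteq> fst c"
    and zero: "\<And>p. p \<in> fst c' \<Longrightarrow> p \<notin> K \<Longrightarrow> h p = 0"
    and h: "diff_order n (snd c' ` (fst c' \<inter> fst c)) (\<lambda>x. h (chart_inv c' x))"
  shows "diff_order n (chart_image c') (\<lambda>x. h (chart_inv c' x))"
proof (rule diff_order_locally)
  fix x assume x: "x \<in> chart_image c'"
  define p where "p = chart_inv c' x"
  have p: "p \<in> fst c'" "x = snd c' p" using x c' by (auto simp: p_def chart_inv_in chart_inv_right)
  show "\<exists>U. x \<in> U \<and> diff_order n U (\<lambda>x. h (chart_inv c' x))"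
  proof (cases "p \<in> fst c")
    case True
    then have "x \<in> snd c' ` (fst c' \<inter> fst c)" using p by simp
    with h show ?thesis by (intro exI conjI)
  next
    case False
    define U where "U = snd c' ` (fst c' - K)"
    have U: "open U"
      unfolding U_def by (intro open_image_chart[OF c'] open_Diff open_chart_domain[OF c'] K) auto
    have "diff_order n U (\<lambda>x. h (chart_inv c' x))"
      by (rule diff_order_cong[OF U _ diff_order_const[OF U, of _ 0]])
        (auto simp: U_def chart_inv_left[OF c'] zero)
    moreover have "x \<in> U" using p False K(2) by (auto simp: U_def)
    ultimately show ?thesis by blast
  qed
qed

section \<open>Bump functions and bump forms supported in chart balls\<close>

text \<open>Requiring the closed ball to lie in the chart image makes its copy in the manifold
  compact, hence closed, so that bumps extend by zero.\<close>

definition chart_ball :: "('m, 'k) chart \<times> (complex ^ 'k) \<times> real \<Rightarrow> bool" where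
  "chart_ball s \<longleftrightarrow> (case s of (c, z, r) \<Rightarrow> c \<in> A \<and> 0 < r \<and> cball z r \<subseteq> chart_image c)"

definition chart_ball_set :: "('m, 'k) chart \<times> (complex ^ 'k) \<times> real \<Rightarrow> 'm set" where
  "chart_ball_set s = (case s of (c, z, r) \<Rightarrow> chart_inv c ` cball z r)"

definition chart_bump :: "('m, 'k) chart \<times> (complex ^ 'k) \<times> real \<Rightarrow> 'm \<Rightarrow> real" where
  "chart_bump s p = (case s of (c, z, r) \<Rightarrow> if p \<in> fst c then ball_bump z r (snd c p) else 0)"

context
  fixes s assumes s: "chart_ball s"
begin

lemma chart_ball_in: "fst s \<in> A"
  using s by (auto simp: chart_ball_def)

lemma compact_chart_ball_set: "compact (chart_ball_set s)"
  using s by (auto simp: chart_ball_def chart_ball_set_def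
      intro!: compact_continuous_image continuous_on_subset[OF continuous_chart_inv])

lemma chart_ball_set_subset: "chart_ball_set s \<subseteq> fst (fst s)"
proof -
  obtain c z r where eq: "s = (c, z, r)" by (cases s)
  have cs: "c \<in> A" "cball z r \<subseteq> chart_image c" using s by (auto simp: eq chart_ball_def)
  show ?thesis using chart_inv_in[OF cs(1)] cs(2) by (auto simp: eq chart_ball_set_def)
qed

lemma chart_bump_eq_0: "p \<notin> chart_ball_set s \<Longrightarrow> chart_bump s p = 0"
proof -
  obtain c z r where eq: "s = (c, z, r)" by (cases s)
  have cs: "c \<in> A" "0 < r" "cball z r \<subseteq> chart_image c" using s by (auto simp: eq chart_ball_def)
  assume p: "p \<notin> chart_ball_set s"
  show "chart_bump s p = 0"
  proof (cases "p \<in> fst c")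
    case True
    then have "chart_inv c (snd c p) = p" using cs chart_inv_left by blast
    then have "snd c p \<notin> cball z r" using p by (auto simp: eq chart_ball_set_def dest: sym)
    then have "snd c p \<notin> ball z r" using ball_subset_cball by blast
    then show ?thesis using cs by (simp add: chart_bump_def eq ball_bump_eq_0)
  qed (simp add: chart_bump_def eq)
qed

lemma chart_bump_diff_order:
  assumes c': "c' \<in> A"
  shows "diff_order n (chart_image c') (\<lambda>x. chart_bump s (chart_inv c' x))"
proof -
  obtain c z r where eq: "s = (c, z, r)" by (cases s)
  have cs: "c \<in> A" "0 < r" "cball z r \<subseteq> chart_image c" using s by (auto simp: eq chart_ball_def)
  show ?thesis
  proof (rule smooth_extension_by_zero[OF cs(1) c'])
    show "closed (chart_ball_set s)" by (rule compact_imp_closed[OF compact_chart_ball_set])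
    show "chart_ball_set s \<subseteq> fst c" using chart_ball_set_subset by (simp add: eq)
    have "diff_order n (snd c' ` (fst c' \<inter> fst c)) (\<lambda>x. ball_bump z r (transition c' c x))"
      by (rule diff_order_compose[OF open_overlap[OF c' cs(1)] open_UNIV _ diff_order_ball_bump transition_diff_order[OF c' cs(1)]]) simp
    then show "diff_order n (snd c' ` (fst c' \<inter> fst c)) (\<lambda>x. chart_bump s (chart_inv c' x))"
      by (rule diff_order_cong[OF open_overlap[OF c' cs(1)], rotated])
        (auto simp: eq chart_bump_def transition_def chart_inv_left[OF c'])
  qed (rule chart_bump_eq_0)
qed

lemma smooth_chart_bump: "smooth_function A (\<lambda>p. of_real (chart_bump s p))"
  unfolding smooth_function_iff
  by (intro ballI allI diff_order_linear_compose[OF _ bounded_linear_of_real] chart_bump_diff_order open_chart_image)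

lemma continuous_chart_bump: "continuous_on UNIV (chart_bump s)"
  unfolding comp_def by (intro continuous_on_UNIV_charts continuous_on_chart[where n = 0, unfolded comp_def] chart_bump_diff_order)

end

text \<open>The bump times \<open>dz_a\<close> wedge conjugate \<open>dz_b\<close> in the
  coordinates of the chart \<open>fst s\<close>, written in an arbitrary chart \<open>c\<close>.
  Outside \<open>fst (fst s)\<close> the transition derivative has no meaning, but the bump is 0
  there.\<close>

definition bump_form :: "('m, 'k) chart \<times> (complex ^ 'k) \<times> real \<Rightarrow> 'k \<Rightarrow> 'k \<Rightarrow> ('m, 'k) two_form" where
  "bump_form s a b = (\<lambda>c p. if c \<in> A \<and> p \<in> fst c
     then \<chi> i j. of_real (chart_bump s p) * (transition_deriv c (fst s) p (axis i 1) $ a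
       * cnj (transition_deriv c (fst s) p (axis j 1) $ b)) else 0)"

context
  fixes s assumes s: "chart_ball s"
begin

lemma eval_bump_form:
  assumes c: "c \<in> A" and p: "p \<in> fst c"
  shows "eval11 (bump_form s a b c p) v w =
    of_real (chart_bump s p) * (transition_deriv c (fst s) p v $ a * cnj (transition_deriv c (fst s) p w $ b))"
proof (cases "p \<in> fst (fst s)")
  case True
  note t = transition_deriv_sum[OF c chart_ball_in[OF s] p True]
  let ?J = "\<lambda>i. transition_deriv c (fst s) p (axis i 1)"
  have "eval11 (bump_form s a b c p) v w =
    (\<Sum>i\<in>UNIV. \<Sum>j\<in>UNIV. of_real (chart_bump s p) * ((v $ i * ?J i $ a) * cnj (w $ j * ?J j $ b)))"
    using c p by (simp add: bump_form_def eval11_def mult_ac)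
  also have "\<dots> = of_real (chart_bump s p) * ((\<Sum>i\<in>UNIV. v $ i * ?J i $ a) * cnj (\<Sum>j\<in>UNIV. w $ j * ?J j $ b))"
    by (simp only: sum_distrib_left[symmetric] sum_product cnj_sum)
  also have "(\<Sum>i\<in>UNIV. v $ i * ?J i $ a) = transition_deriv c (fst s) p v $ a" by (subst t) simp
  also have "(\<Sum>j\<in>UNIV. w $ j * ?J j $ b) = transition_deriv c (fst s) p w $ b" by (subst t) simp
  finally show ?thesis .
next
  case False
  then have "chart_bump s p = 0" using chart_bump_eq_0[OF s] chart_ball_set_subset[OF s] by blast
  then show ?thesis using c p by (simp add: bump_form_def eval11_def)
qed

lemma smooth_bump_form: "smooth_form11 A (bump_form s a b)"
  unfolding smooth_form11_def
proof
  show "form11 A (bump_form s a b)"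
    unfolding form11_def
  proof (intro conjI ballI allI)
    show "supported_on_atlas A (bump_form s a b)" by (auto simp: supported_on_atlas_def bump_form_def)
    fix c c' p v w assume c: "c \<in> A" "c' \<in> A" and p: "p \<in> fst c \<inter> fst c'"
    show "eval11 (bump_form s a b c p) v w =
      eval11 (bump_form s a b c' p) (transition_deriv c c' p v) (transition_deriv c c' p w)"
    proof (cases "p \<in> fst (fst s)")
      case True
      then show ?thesis using c p transition_deriv_chain[OF c(1) _ c(2) _ chart_ball_in[OF s] True]
        by (simp add: eval_bump_form)
    next
      case False
      then have "chart_bump s p = 0" using chart_bump_eq_0[OF s] chart_ball_set_subset[OF s] by blast
      then show ?thesis using c p by (simp add: eval_bump_form)
    qed
  qed
  show "smooth_coeffs A (bump_form s a b)"
    unfolding smooth_coeffs_iff o_def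
  proof (intro ballI allI)
    fix c' n assume c': "c' \<in> A"
    let ?c = "fst s"
    have c: "?c \<in> A" by (rule chart_ball_in[OF s])
    show "diff_order n (chart_image c') (\<lambda>x. bump_form s a b c' (chart_inv c' x))"
    proof (rule smooth_extension_by_zero[OF c c'])
      show "closed (chart_ball_set s)" by (rule compact_imp_closed[OF compact_chart_ball_set[OF s]])
      show "chart_ball_set s \<subseteq> fst ?c" by (rule chart_ball_set_subset[OF s])
      show "bump_form s a b c' p = 0" if "p \<notin> chart_ball_set s" for p
        using that by (auto simp: bump_form_def chart_bump_eq_0[OF s] vec_eq_iff)
      let ?S = "snd c' ` (fst c' \<inter> fst ?c)"
      note S = open_overlap[OF c' c]
      \<comment> \<open>Entries of the Jacobian lose one order of differentiability, hence
        \<open>Suc n\<close> for the transition map.\<close>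
      have J: "diff_order n ?S (\<lambda>x. frechet_derivative (transition c' ?c) (at x) u $ l)" for u l
        using transition_diff_order[OF c' c, of "Suc n"]
        by (intro diff_order_linear_compose[OF S bounded_linear_vec_nth]) simp
      have "diff_order n ?S (\<lambda>x. \<chi> i j. of_real (chart_bump s (chart_inv c' x)) *
        (frechet_derivative (transition c' ?c) (at x) (axis i 1) $ a
          * cnj (frechet_derivative (transition c' ?c) (at x) (axis j 1) $ b)))"
        by (intro diff_order_vec S, simp only: vec_lambda_beta,
            intro diff_order_bilinear[OF S bounded_bilinear_mult] diff_order_linear_compose[OF S bounded_linear_of_real]
            diff_order_linear_compose[OF S bounded_linear_cnj] J
            diff_order_subset[OF chart_bump_diff_order[OF s c']]) (auto simp: chart_image_def)
      then show "diff_order n ?S (\<lambda>x. bump_form s a b c' (chart_inv c' x))"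
        by (rule diff_order_cong[OF S, rotated])
          (auto simp: bump_form_def chart_inv_left[OF c'] c' transition_deriv_def)
    qed
  qed
qed

end

section \<open>Sums and multiples of smooth forms\<close>

lemma form11_transform:
  assumes "form11 A \<psi>" "c \<in> A" "c' \<in> A" "p \<in> fst c" "p \<in> fst c'"
  shows "eval11 (\<psi> c p) v w = eval11 (\<psi> c' p) (transition_deriv c c' p v) (transition_deriv c c' p w)"
  using assms unfolding form11_def by blast

lemma smooth_form11_scale:
  assumes f: "smooth_function A f" and \<theta>: "smooth_form11 A \<theta>"
  shows "smooth_form11 A (\<lambda>c p. \<chi> i j. f p * \<theta> c p $ i $ j)"
  unfolding smooth_form11_def
proof
  show "form11 A (\<lambda>c p. \<chi> i j. f p * \<theta> c p $ i $ j)"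
    unfolding form11_def eval11_scale
  proof (intro conjI ballI allI)
    show "supported_on_atlas A (\<lambda>c p. \<chi> i j. f p * \<theta> c p $ i $ j)"
      using \<theta> unfolding smooth_form11_def form11_def supported_on_atlas_def by (simp add: vec_eq_iff)
    fix c c' p v w assume "c \<in> A" "c' \<in> A" "p \<in> fst c \<inter> fst c'"
    then have "eval11 (\<theta> c p) v w = eval11 (\<theta> c' p) (transition_deriv c c' p v) (transition_deriv c c' p w)"
      using \<theta> by (intro form11_transform) (auto simp: smooth_form11_def)
    then show "f p * eval11 (\<theta> c p) v w = f p * eval11 (\<theta> c' p) (transition_deriv c c' p v) (transition_deriv c c' p w)"
      by simp
  qed
  show "smooth_coeffs A (\<lambda>c p. \<chi> i j. f p * \<theta> c p $ i $ j)"
    unfolding smooth_coeffs_iff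
  proof (intro ballI allI)
    fix c n assume c: "c \<in> A"
    have "diff_order n (chart_image c) (\<lambda>x. f (chart_inv c x))" "diff_order n (chart_image c) (\<theta> c \<circ> chart_inv c)"
      using f \<theta> c by (simp_all add: smooth_function_iff smooth_form11_def smooth_coeffs_iff)
    from diff_order_bilinear[OF open_chart_image[OF c] bounded_bilinear_matrix_scale this]
    show "diff_order n (chart_image c) ((\<lambda>p. \<chi> i j. f p * \<theta> c p $ i $ j) \<circ> chart_inv c)"
      by (simp add: o_def)
  qed
qed

lemma smooth_form11_zero: "smooth_form11 A (\<lambda>c p. 0)"
  by (simp add: smooth_form11_def form11_def supported_on_atlas_def smooth_coeffs_iff o_def
      diff_order_const open_chart_image)

lemma smooth_form11_add:
  assumes "smooth_form11 A \<psi>" "smooth_form11 A \<phi>"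
  shows "smooth_form11 A (\<lambda>c p. \<psi> c p + \<phi> c p)"
  unfolding smooth_form11_def
proof
  show "form11 A (\<lambda>c p. \<psi> c p + \<phi> c p)"
    unfolding form11_def eval11_add
  proof (intro conjI ballI allI)
    show "supported_on_atlas A (\<lambda>c p. \<psi> c p + \<phi> c p)"
      using assms unfolding smooth_form11_def form11_def supported_on_atlas_def by simp
    fix c c' p v w assume "c \<in> A" "c' \<in> A" "p \<in> fst c \<inter> fst c'"
    then show "eval11 (\<psi> c p) v w + eval11 (\<phi> c p) v w =
      eval11 (\<psi> c' p) (transition_deriv c c' p v) (transition_deriv c c' p w)
      + eval11 (\<phi> c' p) (transition_deriv c c' p v) (transition_deriv c c' p w)"
      using assms by (intro arg_cong2[where f = "(+)"] form11_transform) (auto simp: smooth_form11_def)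
  qed
  show "smooth_coeffs A (\<lambda>c p. \<psi> c p + \<phi> c p)"
    unfolding smooth_coeffs_iff
  proof (intro ballI allI)
    fix c n assume c: "c \<in> A"
    have "diff_order n (chart_image c) (\<psi> c \<circ> chart_inv c)" "diff_order n (chart_image c) (\<phi> c \<circ> chart_inv c)"
      using assms c by (simp_all add: smooth_form11_def smooth_coeffs_iff)
    from diff_order_add[OF open_chart_image[OF c] this]
    show "diff_order n (chart_image c) ((\<lambda>p. \<psi> c p + \<phi> c p) \<circ> chart_inv c)"
      by (simp add: o_def)
  qed
qed

lemma smooth_form11_sum:
  "(\<And>i. i \<in> I \<Longrightarrow> smooth_form11 A (\<theta> i)) \<Longrightarrow> smooth_form11 A (\<lambda>c p. \<Sum>i\<in>I. \<theta> i c p)"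
  by (induction I rule: infinite_finite_induct) (auto intro: smooth_form11_zero smooth_form11_add)

end

subsection \<open>Density of the smooth forms\<close>

locale compact_manifold = complex_manifold A for A :: "('m::t2_space, 'k::finite) chart set" +
  assumes compact_UNIV: "compact (UNIV :: 'm set)"
begin

lemma chart_ball_exists:
  assumes c: "c \<in> A" and p: "p \<in> fst c"
  obtains r where "chart_ball (c, snd c p, r)" "chart_bump (c, snd c p, r) p > 0"
proof -
  obtain r where r: "0 < r" "cball (snd c p) r \<subseteq> chart_image c"
    using open_chart_image[OF c] chart_in[OF c p] open_contains_cball by blast
  then show thesis using c p by (intro that[of r]) (auto simp: chart_ball_def chart_bump_def ball_bump_pos)
qed

lemma finite_chart_balls:
  obtains Q where "finite Q" "\<And>s. s \<in> Q \<Longrightarrow> chart_ball s" "\<And>p. \<exists>s\<in>Q. chart_bump s p > 0"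
proof -
  define U where "U s = {p. chart_bump s p > 0}" for s :: "('m, 'k) chart \<times> (complex ^ 'k) \<times> real"
  have op: "open (U s)" if "s \<in> Collect chart_ball" for s
    unfolding U_def using continuous_chart_bump that by (intro open_Collect_less) auto
  have "UNIV \<subseteq> (\<Union>s\<in>Collect chart_ball. U s)"
  proof
    fix p :: 'm
    obtain c where "c \<in> A" "p \<in> fst c" by (rule covered)
    then obtain r where "chart_ball (c, snd c p, r)" "chart_bump (c, snd c p, r) p > 0"
      by (rule chart_ball_exists)
    then show "p \<in> (\<Union>s\<in>Collect chart_ball. U s)" unfolding U_def by blast
  qed
  from compactE_image[OF compact_UNIV op this] obtain Q
    where "Q \<subseteq> Collect chart_ball" "finite Q" "UNIV \<subseteq> (\<Union>s\<in>Q. U s)"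
    by blast
  then show thesis by (intro that[of Q]) (auto simp: U_def)
qed

lemma smooth_function_separates:
  assumes "p \<noteq> q"
  obtains h :: "'m \<Rightarrow> real" where "smooth_function A (\<lambda>x. of_real (h x))" "h p \<noteq> h q"
proof -
  obtain c where c: "c \<in> A" "p \<in> fst c" by (rule covered)
  obtain r where r: "0 < r" "cball (snd c p) r \<subseteq> chart_image c"
    using open_chart_image[OF c(1)] chart_in[OF c] open_contains_cball by blast
  \<comment> \<open>A radius no larger than the distance to \<open>q\<close> keeps \<open>q\<close>
    out of the open ball on which the bump is positive; if \<open>q\<close> is outside the chart,
    the bump is 0 there by definition.\<close>
  define d where "d = (if q \<in> fst c then min r (dist (snd c p) (snd c q)) else r)"
  have "snd c p \<noteq> snd c q" if "q \<in> fst c"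
    using that chart_inv_left[OF c(1)] c(2) assms by metis
  then have d: "0 < d" "d \<le> r" using r by (auto simp: d_def)
  then have "cball (snd c p) d \<subseteq> chart_image c" using r subset_cball[of d r] by blast
  with d c have s: "chart_ball (c, snd c p, d)" by (simp add: chart_ball_def)
  have "chart_bump (c, snd c p, d) p > 0" using d c by (simp add: chart_bump_def ball_bump_pos)
  moreover have "chart_bump (c, snd c p, d) q = 0"
    using d by (auto simp: chart_bump_def d_def intro!: ball_bump_eq_0)
  ultimately show thesis using that[OF smooth_chart_bump[OF s]] by simp
qed

lemma smooth_function_dense:
  fixes f :: "'m \<Rightarrow> complex"
  assumes f: "continuous_on UNIV f" and e: "0 < e"
  obtains g where "smooth_function A g" "\<And>p. norm (f p - g p) < e"
proof -
  \<comment> \<open>The Stone--Weierstrass theorem is applied to real functions; the real and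
    imaginary parts of \<open>f\<close> each get half of the error.\<close>
  have *: "\<exists>g. smooth_function A (\<lambda>p. of_real (g p)) \<and> (\<forall>p\<in>UNIV. \<bar>h p - g p\<bar> < e / 2)"
    if h: "continuous_on UNIV h" for h :: "'m \<Rightarrow> real"
  proof (rule Stone_Weierstrass_HOL[where P = "\<lambda>g. smooth_function A (\<lambda>p. of_real (g p))"])
    show "continuous_on UNIV g" if "smooth_function A (\<lambda>p. complex_of_real (g p))" for g
      using continuous_on_Re[OF smooth_function_continuous[OF that]] by simp
    show "\<exists>g. smooth_function A (\<lambda>p. complex_of_real (g p)) \<and> g x \<noteq> g y"
      if "x \<in> UNIV \<and> y \<in> UNIV \<and> x \<noteq> y" for x y
      using that smooth_function_separates by metis
  qed (use e h compact_UNIV smooth_function_const smooth_function_add smooth_function_mult in auto)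
  obtain g1 where g1: "smooth_function A (\<lambda>p. of_real (g1 p))" "\<And>p. \<bar>Re (f p) - g1 p\<bar> < e / 2"
    using *[OF continuous_on_Re[OF f]] by auto
  obtain g2 where g2: "smooth_function A (\<lambda>p. of_real (g2 p))" "\<And>p. \<bar>Im (f p) - g2 p\<bar> < e / 2"
    using *[OF continuous_on_Im[OF f]] by auto
  show thesis
  proof (rule that)
    show "smooth_function A (\<lambda>p. of_real (g1 p) + \<i> * of_real (g2 p))"
      by (intro smooth_function_add smooth_function_mult smooth_function_const g1 g2)
    fix p
    have "norm (f p - (of_real (g1 p) + \<i> * of_real (g2 p))) \<le> \<bar>Re (f p) - g1 p\<bar> + \<bar>Im (f p) - g2 p\<bar>"
      using cmod_le[of "f p - (of_real (g1 p) + \<i> * of_real (g2 p))"] by simp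
    also have "\<dots> < e" using g1(2)[of p] g2(2)[of p] by linarith
    finally show "norm (f p - (of_real (g1 p) + \<i> * of_real (g2 p))) < e" .
  qed
qed

lemma uniform_limit_sum:
  fixes F :: "'i \<Rightarrow> nat \<Rightarrow> 'x \<Rightarrow> 'e::real_normed_vector"
  assumes "\<And>i. i \<in> I \<Longrightarrow> uniform_limit K (F i) (f i) sequentially"
  shows "uniform_limit K (\<lambda>n x. \<Sum>i\<in>I. F i n x) (\<lambda>x. \<Sum>i\<in>I. f i x) sequentially"
  using assms by (induction I rule: infinite_finite_induct) (auto intro!: uniform_limit_intros)

text \<open>Writing \<open>\<eta>\<close> for the bumps, \<open>\<psi> = \<Sum> (\<eta> \<psi>\<^sub>a\<^sub>b / \<Sum> \<eta>\<^sup>2) \<cdot> \<eta> dz\<^sub>a \<and> d\<close>conj\<open>(z\<^sub>b)\<close> has globally defined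
  continuous coefficients with respect to finitely many smooth forms.\<close>

lemma form11_decomposition:
  assumes \<psi>: "form11 A \<psi>" "continuous_coeffs A \<psi>"
    and Q: "finite Q" "\<And>s. s \<in> Q \<Longrightarrow> chart_ball s" "\<And>p. \<exists>s\<in>Q. chart_bump s p > 0"
  shows "\<exists>f. (\<forall>s\<in>Q. \<forall>a b. continuous_on UNIV (f s a b)) \<and> (\<forall>c\<in>A. \<forall>p\<in>fst c.
      \<psi> c p = (\<Sum>s\<in>Q. \<Sum>a\<in>UNIV. \<Sum>b\<in>UNIV. \<chi> i j. f s a b p * bump_form s a b c p $ i $ j))"
proof -
  define N where "N p = (\<Sum>s\<in>Q. (chart_bump s p)\<^sup>2)" for p
  have N: "N p > 0" for p
  proof -
    obtain s where s: "s \<in> Q" "chart_bump s p > 0" using Q(3) by blast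
    show ?thesis unfolding N_def by (rule sum_pos2[OF Q(1) s(1)]) (use s in auto)
  qed
  have N_cont: "continuous_on UNIV N"
    unfolding N_def by (intro continuous_intros continuous_chart_bump Q)
  \<comment> \<open>One bump sits in the coefficient and a second one in \<open>bump_form\<close>,
    which is why \<open>N\<close> adds up squares.\<close>
  define f where "f s a b p = of_real (chart_bump s p) * \<psi> (fst s) p $ a $ b / of_real (N p)" for s a b p
  show ?thesis
  proof (intro exI[of _ f] conjI ballI allI)
    fix s a b assume s: "s \<in> Q"
    note b = Q(2)[OF s]
    let ?K = "chart_ball_set s"
    have 1: "continuous_on (fst (fst s)) (f s a b)"
      unfolding f_def using \<psi>(2) chart_ball_in[OF b] N
      by (intro continuous_intros continuous_on_subset[OF continuous_chart_bump[OF b]] continuous_on_subset[OF N_cont])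
        (auto simp: continuous_coeffs_def less_imp_neq[symmetric])
    \<comment> \<open>The coefficient of \<psi> is only continuous inside its chart; its factor
      \<open>chart_bump\<close> vanishes off the compact ball, so the two open pieces glue.\<close>
    have 2: "continuous_on (- ?K) (f s a b)"
      by (rule continuous_on_eq[OF continuous_on_const[of _ 0]]) (simp add: f_def chart_bump_eq_0[OF b])
    have "continuous_on (fst (fst s) \<union> - ?K) (f s a b)"
      by (intro continuous_on_open_Un 1 2 open_chart_domain chart_ball_in[OF b] open_Compl compact_imp_closed compact_chart_ball_set[OF b])
    moreover have "fst (fst s) \<union> - ?K = UNIV" using chart_ball_set_subset[OF b] by blast
    ultimately show "continuous_on UNIV (f s a b)" by simp
  next
    fix c p assume c: "c \<in> A" "p \<in> fst c"
    show "\<psi> c p = (\<Sum>s\<in>Q. \<Sum>a\<in>UNIV. \<Sum>b\<in>UNIV. \<chi> i j. f s a b p * bump_form s a b c p $ i $ j)"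
    proof (rule eval11_eqI)
      fix v w
      have *: "(\<Sum>a\<in>UNIV. \<Sum>b\<in>UNIV. f s a b p * eval11 (bump_form s a b c p) v w)
        = of_real ((chart_bump s p)\<^sup>2) / of_real (N p) * eval11 (\<psi> c p) v w" if s: "s \<in> Q" for s
      proof (cases "p \<in> fst (fst s)")
        case True
        show ?thesis
          unfolding form11_transform[OF \<psi>(1) c(1) chart_ball_in[OF Q(2)[OF s]] c(2) True]
            eval_bump_form[OF Q(2)[OF s] c] f_def
          unfolding eval11_def by (simp add: sum_distrib_left power2_eq_square mult_ac)
      next
        case False
        then have "chart_bump s p = 0"
          using chart_bump_eq_0[OF Q(2)[OF s]] chart_ball_set_subset[OF Q(2)[OF s]] by blast
        then show ?thesis by (simp add: f_def)
      qed
      have "eval11 (\<Sum>s\<in>Q. \<Sum>a\<in>UNIV. \<Sum>b\<in>UNIV. \<chi> i j. f s a b p * bump_form s a b c p $ i $ j) v w =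
        (\<Sum>s\<in>Q. of_real ((chart_bump s p)\<^sup>2) / of_real (N p) * eval11 (\<psi> c p) v w)"
        unfolding eval11_sum eval11_scale by (intro sum.cong refl *)
      also have "\<dots> = of_real (N p) / of_real (N p) * eval11 (\<psi> c p) v w"
        unfolding N_def of_real_sum sum_divide_distrib sum_distrib_right ..
      also have "\<dots> = eval11 (\<psi> c p) v w" using N[of p] by simp
      finally show "eval11 (\<psi> c p) v w =
        eval11 (\<Sum>s\<in>Q. \<Sum>a\<in>UNIV. \<Sum>b\<in>UNIV. \<chi> i j. f s a b p * bump_form s a b c p $ i $ j) v w" ..
    qed
  qed
qed

text \<open>Only the finitely many global coefficient functions are approximated, the smooth bump
  forms being kept fixed. The resulting sequence is what makes the value of
  \<open>continuous_extension\<close> unique.\<close>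

lemma smooth_form11_dense:
  assumes \<psi>: "form11 A \<psi>" "continuous_coeffs A \<psi>"
  obtains \<Psi> where "\<And>n. smooth_form11 A (\<Psi> n)" "uniform_form_limit A \<Psi> \<psi>"
proof -
  obtain Q where Q: "finite Q" "\<And>s. s \<in> Q \<Longrightarrow> chart_ball s" "\<And>p. \<exists>s\<in>Q. chart_bump s p > 0"
    by (rule finite_chart_balls) blast
  obtain f where f: "\<And>s a b. s \<in> Q \<Longrightarrow> continuous_on UNIV (f s a b)"
    and dec: "\<And>c p. c \<in> A \<Longrightarrow> p \<in> fst c \<Longrightarrow>
      \<psi> c p = (\<Sum>s\<in>Q. \<Sum>a\<in>UNIV. \<Sum>b\<in>UNIV. \<chi> i j. f s a b p * bump_form s a b c p $ i $ j)"
    using form11_decomposition[OF \<psi> Q] by blast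
  have "\<exists>g. smooth_function A g \<and> (\<forall>p. norm (f s a b p - g p) < inverse (real (Suc n)))" if "s \<in> Q" for s a b n
    using smooth_function_dense[OF f[OF that], of "inverse (real (Suc n))" a b] by (metis inverse_positive_iff_positive of_nat_0_less_iff zero_less_Suc)
  then obtain F where F: "\<And>s a b n. s \<in> Q \<Longrightarrow> smooth_function A (F s a b n)"
    "\<And>s a b n p. s \<in> Q \<Longrightarrow> norm (f s a b p - F s a b n p) < inverse (real (Suc n))"
    by metis
  have lim: "uniform_limit UNIV (F s a b) (f s a b) sequentially" if "s \<in> Q" for s a b
  proof (rule uniform_limitI)
    fix e :: real assume "0 < e"
    then obtain n where n: "inverse (real (Suc n)) < e" using reals_Archimedean by blast
    have "dist (F s a b m p) (f s a b p) < e" if "m \<ge> n" for m p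
    proof -
      have "dist (F s a b m p) (f s a b p) < inverse (real (Suc m))"
        using F(2)[OF \<open>s \<in> Q\<close>, of a b p m] by (simp add: dist_norm norm_minus_commute)
      also have "\<dots> \<le> inverse (real (Suc n))" using that by (simp add: field_simps)
      finally show ?thesis using n by simp
    qed
    then show "\<forall>\<^sub>F m in sequentially. \<forall>p\<in>UNIV. dist (F s a b m p) (f s a b p) < e"
      using eventually_sequentially by blast
  qed
  define \<Psi> where "\<Psi> n c p = (\<Sum>s\<in>Q. \<Sum>a\<in>UNIV. \<Sum>b\<in>UNIV. \<chi> i j. F s a b n p * bump_form s a b c p $ i $ j)" for n c p
  show thesis
  proof (rule that)
    show "smooth_form11 A (\<Psi> n)" for n
      unfolding \<Psi>_def[abs_def] by (intro smooth_form11_sum smooth_form11_scale F smooth_bump_form Q)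
    show "uniform_form_limit A \<Psi> \<psi>"
      unfolding uniform_form_limit_def
    proof (intro ballI allI impI)
      fix c K assume c: "c \<in> A" and K: "compact K \<and> K \<subseteq> fst c"
      have "uniform_limit K (\<lambda>n. \<Psi> n c)
        (\<lambda>p. \<Sum>s\<in>Q. \<Sum>a\<in>UNIV. \<Sum>b\<in>UNIV. \<chi> i j. f s a b p * bump_form s a b c p $ i $ j) sequentially"
        unfolding \<Psi>_def[abs_def]
      proof (intro uniform_limit_sum bounded_bilinear.bounded_uniform_limit[OF bounded_bilinear_matrix_scale])
        fix s a b assume s: "s \<in> Q"
        show "uniform_limit K (\<lambda>n p. F s a b n p) (\<lambda>p. f s a b p) sequentially"
          using lim[OF s] uniform_limit_on_subset by blast
        show "uniform_limit K (\<lambda>n p. bump_form s a b c p) (\<lambda>p. bump_form s a b c p) sequentially"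
          by (rule uniform_limit_const)
        have "continuous_on (fst c) (bump_form s a b c)"
          using smooth_coeffs_continuous smooth_bump_form[OF Q(2)[OF s]] c
          unfolding smooth_form11_def continuous_coeffs_def by blast
        then show "bounded ((\<lambda>p. bump_form s a b c p) ` K)"
          using K by (intro compact_imp_bounded compact_continuous_image) (auto intro: continuous_on_subset)
        show "bounded ((\<lambda>p. f s a b p) ` K)"
          using K f[OF s] by (intro compact_imp_bounded compact_continuous_image) (auto intro: continuous_on_subset)
      qed
      then show "uniform_limit K (\<lambda>n. \<Psi> n c) (\<psi> c) sequentially"
        by (rule uniform_limit_cong'[THEN iffD1, rotated 2]) (use dec[OF c] K in auto)
    qed
  qed
qed

end

section \<open>Linearity of the Levi form and linear algebra on a single tangent space\<close>

lemma iter_deriv_add: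
  assumes S: "open S" "x \<in> S" and f: "diff_order 2 S f" and g: "diff_order 2 S g"
  shows "iter_deriv [v, w] (\<lambda>y. f y + g y) x = iter_deriv [v, w] f x + iter_deriv [v, w] g x"
proof -
  have D: "frechet_derivative (\<lambda>y. F y + G y) (at y) u = frechet_derivative F (at y) u + frechet_derivative G (at y) u"
    if "F differentiable (at y)" "G differentiable (at y)" for F G :: "'a \<Rightarrow> 'b" and y u
    using frechet_derivative_at[OF has_derivative_add[OF that[unfolded frechet_derivative_works]], symmetric] by simp
  have f1: "(\<lambda>y. frechet_derivative f (at y) v) differentiable (at x)"
    and g1: "(\<lambda>y. frechet_derivative g (at y) v) differentiable (at x)"
    using f g S(2) by (simp_all add: numeral_2_eq_2)
  have eq: "frechet_derivative f (at y) v + frechet_derivative g (at y) v = frechet_derivative (\<lambda>y. f y + g y) (at y) v"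
    if "y \<in> S" for y
    using D diff_order_differentiable[OF f that] diff_order_differentiable[OF g that] by simp
  show ?thesis
    using frechet_derivative_cong_open[OF S eq differentiable_add[OF f1 g1]] D[OF f1 g1] by simp
qed

lemma levi_form_add:
  assumes S: "open S" "x \<in> S" and f: "diff_order 2 S f" and g: "diff_order 2 S g"
  shows "levi_form (\<lambda>y. f y + g y) x v = levi_form f x v + levi_form g x v"
  unfolding levi_form_eq[OF S f] levi_form_eq[OF S g]
    levi_form_eq[OF S diff_order_add[OF S(1) f g]] iter_deriv_add[OF S f g]
  by (simp add: add_divide_distrib)

lemma levi_form_mult:
  assumes S: "open S" "x \<in> S" and f: "diff_order 2 S f"
  shows "levi_form (\<lambda>y. z * f y) x v = z * levi_form f x v"
  unfolding levi_form_eq[OF S f]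
    levi_form_eq[OF S diff_order_linear_compose[OF S(1) bounded_linear_mult_right f]]
    iter_deriv_linear_compose[OF S bounded_linear_mult_right f]
  by (simp add: algebra_simps)

lemma norm_eval11_le: "norm (eval11 m v w) \<le> real CARD('k) ^ 2 * (norm m * norm v * norm w)"
  for m :: "complex ^ 'k ^ 'k::finite"
proof -
  have "norm (m $ i $ j * v $ i * cnj (w $ j)) \<le> norm m * norm v * norm w" for i j
  proof -
    have "norm (m $ i $ j) \<le> norm m"
      using Finite_Cartesian_Product.norm_nth_le[of "m $ i" j] Finite_Cartesian_Product.norm_nth_le[of m i] by linarith
    then show ?thesis
      by (auto simp: norm_mult intro!: mult_mono Finite_Cartesian_Product.norm_nth_le)
  qed
  then have "norm (eval11 m v w) \<le> (\<Sum>i::'k\<in>UNIV. \<Sum>j::'k\<in>UNIV. norm m * norm v * norm w)"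
    unfolding eval11_def by (intro sum_norm_le)
  then show ?thesis by (simp add: power2_eq_square mult_ac)
qed

lemma eval11_scaleR: "eval11 m (r *\<^sub>R v) (r *\<^sub>R v) = of_real (r\<^sup>2) * eval11 m v v"
  by (simp add: eval11_def sum_distrib_left power2_eq_square scaleR_conv_of_real[where 'a = complex] mult_ac)

text \<open>The forms become rows of a square matrix that still has one row to spare; a zero row
  there makes the matrix singular.\<close>

lemma common_kernel_vector:
  fixes \<alpha> :: "nat \<Rightarrow> complex ^ 'k::finite"
  shows "\<exists>v. v \<noteq> 0 \<and> (\<forall>j\<in>{1..<CARD('k)}. eval10 (\<alpha> j) v = 0)"
proof -
  obtain e where e: "bij_betw e (UNIV :: 'k set) {0..<CARD('k)}"
    using ex_bij_betw_finite_nat[of "UNIV :: 'k set"] by auto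
  \<comment> \<open>The index 0 lies outside \<open>{1..<CARD('k)}\<close>, so its row is the spare
    one.\<close>
  define M :: "complex ^ 'k ^ 'k" where "M = (\<chi> i. if e i = 0 then 0 else \<alpha> (e i))"
  obtain i0 where "e i0 = 0"
    using e by (metis atLeastLessThan_iff bij_betw_imp_surj_on imageE less_eq_nat.simps(1) zero_less_card_finite)
  then have "row i0 M = 0" by (simp add: row_def M_def vec_eq_iff)
  then have "det M = 0" by (rule det_zero_row)
  then have "\<not> (\<exists>B. B ** M = mat 1)" using invertible_det_nz invertible_left_inverse by blast
  then obtain v where v: "M *v v = 0" "v \<noteq> 0" using matrix_left_invertible_ker by blast
  have "eval10 (\<alpha> j) v = 0" if j: "j \<in> {1..<CARD('k)}" for j
  proof -
    have "j \<in> range e" using j e by (auto simp: bij_betw_def)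
    then obtain i where i: "e i = j" by auto
    have "(M *v v) $ i = 0" using v by simp
    then show ?thesis using i j by (simp add: matrix_vector_mult_def M_def eval10_def)
  qed
  then show ?thesis using v by blast
qed

lemma continuous_on_eval11:
  assumes "continuous_on S m" "continuous_on S v" "continuous_on S w"
  shows "continuous_on S (\<lambda>x. eval11 (m x) (v x) (w x))"
  unfolding eval11_def by (intro continuous_intros continuous_on_component assms)

section \<open>Hermitian forms, the operator \<open>i_del_delbar\<close> and wedge products in a
  chart\<close>

context complex_manifold
begin

text \<open>The minimum over \<open>K\<close> times the unit sphere is attained and positive;
  homogeneity of degree two carries it to all vectors.\<close>

lemma hermitian_form_lower_bound:
  assumes \<omega>: "hermitian_form A \<omega>" and c: "c \<in> A" and K: "compact K" "K \<subseteq> fst c"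
  shows "\<exists>m>0. \<forall>p\<in>K. \<forall>v. m * (norm v)\<^sup>2 \<le> Re (- \<i> * eval11 (\<omega> c p) v v)"
proof (cases "K = {}")
  case True
  then show ?thesis by (intro exI[of _ 1]) simp
next
  case False
  let ?S = "K \<times> (sphere 0 1 :: (complex ^ 'k) set)"
  define F where "F x = Re (- \<i> * eval11 (\<omega> c (fst x)) (snd x) (snd x))" for x
  have "continuous_on (fst c) (\<omega> c)"
    using \<omega> c smooth_coeffs_continuous unfolding hermitian_form_def smooth_form11_def continuous_coeffs_def by blast
  then have "continuous_on ?S (\<lambda>x. \<omega> c (fst x))"
    by (rule continuous_on_compose2[OF _ continuous_on_fst[OF continuous_on_id]]) (use K in auto)
  then have F: "continuous_on ?S F"
    unfolding F_def by (intro continuous_intros continuous_on_eval11)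
  \<comment> \<open>Any coordinate vector will do: it shows that the unit sphere is
    nonempty.\<close>
  have "(axis undefined 1 :: complex ^ 'k) \<in> sphere 0 1" by (simp add: norm_axis_1)
  then have ne: "?S \<noteq> {}" using False by blast
  have "compact ?S" using K by (intro compact_Times) auto
  then obtain x0 where x0: "x0 \<in> ?S" "\<forall>x\<in>?S. F x0 \<le> F x"
    using continuous_attains_inf[OF _ ne F] by blast
  have "fst x0 \<in> fst c" "snd x0 \<noteq> 0" using x0(1) K by auto
  then have "- \<i> * eval11 (\<omega> c (fst x0)) (snd x0) (snd x0) \<in> \<real>\<^sub>\<ge>\<^sub>0 - {0}"
    using \<omega> c unfolding hermitian_form_def by blast
  then have pos: "F x0 > 0" unfolding F_def
    by (auto simp: complex_nonneg_Reals_iff complex_eq_iff)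
  have "F x0 * (norm v)\<^sup>2 \<le> Re (- \<i> * eval11 (\<omega> c p) v v)" if p: "p \<in> K" for p v
  proof (cases "v = 0")
    case True
    then show ?thesis by (simp add: eval11_def)
  next
    case False
    define u where "u = v /\<^sub>R norm v"
    have "(p, u) \<in> ?S" using p False by (simp add: u_def)
    then have le: "F x0 \<le> F (p, u)" using x0 by blast
    have "v = norm v *\<^sub>R u" using False by (simp add: u_def)
    then have "eval11 (\<omega> c p) v v = of_real ((norm v)\<^sup>2) * eval11 (\<omega> c p) u u"
      using eval11_scaleR by metis
    then have "Re (- \<i> * eval11 (\<omega> c p) v v) = (norm v)\<^sup>2 * F (p, u)" by (simp add: F_def)
    then show ?thesis using mult_right_mono[OF le, of "(norm v)\<^sup>2"] by (simp add: mult.commute)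
  qed
  then show ?thesis using pos by blast
qed

text \<open>The guarded definition of \<open>delbar\<close> agrees with the plain Wirtinger
  derivative on the open chart image, so the two have the same derivatives there.\<close>

lemma i_del_delbar_component:
  assumes f: "smooth_function A f" and c: "c \<in> A" and p: "p \<in> fst c"
  shows "i_del_delbar A f c p = (\<chi> a b. \<i> * wirtinger a (wirtinger_bar b (\<lambda>x. f (chart_inv c x))) (snd c p))"
proof -
  have "wirtinger a (\<lambda>x. delbar A f c (chart_inv c x) $ b) (snd c p)
      = wirtinger a (wirtinger_bar b (\<lambda>x. f (chart_inv c x))) (snd c p)" for a b
  proof -
    have "diff_order 1 (chart_image c) (\<lambda>x. f (chart_inv c x))"
      using f c by (simp only: smooth_function_iff)
    then have "diff_order 0 (chart_image c) (wirtinger_bar b (\<lambda>x. f (chart_inv c x)))"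
      by (intro diff_order_wirtinger_bar open_chart_image c) simp
    then have d: "wirtinger_bar b (\<lambda>x. f (chart_inv c x)) differentiable (at (snd c p))"
      using chart_in[OF c p] by simp
    have "frechet_derivative (wirtinger_bar b (\<lambda>x. f (chart_inv c x))) (at (snd c p)) =
      frechet_derivative (\<lambda>x. delbar A f c (chart_inv c x) $ b) (at (snd c p))"
      by (rule frechet_derivative_cong_open[OF open_chart_image[OF c] chart_in[OF c p] _ d])
        (simp add: delbar_def c chart_inv_in[OF c] chart_inv_right[OF c] o_def)
    then show ?thesis by (simp add: wirtinger_def)
  qed
  then show ?thesis using c p by (simp add: i_del_delbar_def scale11_def del01_def vec_eq_iff)
qed

lemma i_del_delbar_continuous:
  assumes f: "smooth_function A f"
  shows "continuous_coeffs A (i_del_delbar A f)"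
  unfolding continuous_coeffs_def
proof
  fix c assume c: "c \<in> A"
  have "continuous_on (fst c) (\<lambda>p. \<chi> a b. \<i> * wirtinger a (wirtinger_bar b (\<lambda>x. f (chart_inv c x))) (snd c p))"
  proof (intro continuous_on_vec_lambda continuous_intros)
    fix a b
    have "diff_order 2 (chart_image c) (\<lambda>x. f (chart_inv c x))"
      using f c by (simp only: smooth_function_iff)
    then have "diff_order 0 (chart_image c) (wirtinger a (wirtinger_bar b (\<lambda>x. f (chart_inv c x))))"
      by (intro diff_order_wirtinger diff_order_wirtinger_bar open_chart_image c) (simp add: numeral_2_eq_2)
    then have "continuous_on (chart_image c) (wirtinger a (wirtinger_bar b (\<lambda>x. f (chart_inv c x))))"
      by (intro continuous_at_imp_continuous_on ballI differentiable_imp_continuous_within) simp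
    then show "continuous_on (fst c) (\<lambda>p. wirtinger a (wirtinger_bar b (\<lambda>x. f (chart_inv c x))) (snd c p))"
      by (rule continuous_on_compose2[OF _ continuous_chart[OF c]]) (auto simp: chart_image_def)
  qed
  then show "continuous_on (fst c) (i_del_delbar A f c)"
    by (rule continuous_on_eq) (simp add: i_del_delbar_component[OF f c])
qed

lemma eval_i_del_delbar:
  assumes f: "smooth_function A f" and c: "c \<in> A" "p \<in> fst c"
  shows "- \<i> * eval11 (i_del_delbar A f c p) v v = levi_form (\<lambda>x. f (chart_inv c x)) (snd c p) v"
  unfolding i_del_delbar_component[OF f c] eval11_def levi_form_def
  by (simp add: sum_distrib_left mult.assoc[symmetric])

text \<open>Continuity is all that \<alpha> passes on to the product, hence the detour through
  \<open>continuous_extension\<close>.\<close>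

lemma wedge_form11:
  assumes \<alpha>: "continuous_form10 A \<alpha>" and \<beta>: "smooth_form01 A \<beta>"
  shows "form11 A (wedge \<alpha> \<beta>)" "continuous_coeffs A (wedge \<alpha> \<beta>)"
proof -
  show "form11 A (wedge \<alpha> \<beta>)"
    unfolding form11_def wedge_def eval11_rank_one
  proof (intro conjI ballI allI)
    show "supported_on_atlas A (\<lambda>c p. \<chi> i j. \<alpha> c p $ i * \<beta> c p $ j)"
      using \<alpha> by (auto simp: continuous_form10_def form10_def supported_on_atlas_def vec_eq_iff)
    fix c c' p v w assume "c \<in> A" "c' \<in> A" "p \<in> fst c \<inter> fst c'"
    then show "eval10 (\<alpha> c p) v * eval01 (\<beta> c p) w =
      eval10 (\<alpha> c' p) (transition_deriv c c' p v) * eval01 (\<beta> c' p) (transition_deriv c c' p w)"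
      using \<alpha> \<beta> unfolding continuous_form10_def smooth_form01_def form10_def form01_def
      by (intro arg_cong2[where f = "(*)"]) blast+
  qed
  have "continuous_coeffs A \<beta>" using \<beta> by (simp add: smooth_form01_def smooth_coeffs_continuous)
  then show "continuous_coeffs A (wedge \<alpha> \<beta>)"
    using \<alpha> unfolding continuous_form10_def continuous_coeffs_def wedge_def
    by (auto intro!: continuous_on_vec_lambda continuous_on_mult continuous_on_component)
qed

end

subsection \<open>The current\<close>

context complex_manifold
begin

text \<open>This is \<open>L\<close> of the overview. The factor \<open>-\<i>\<close> makes it
  nonnegative on positive forms, and \<open>ch\<close> fixes the chart in which each point is
  read.\<close>

definition diag_eval :: "('m \<Rightarrow> ('m, 'k) chart) \<Rightarrow> ('m, 'k) two_form \<Rightarrow> 'm \<times> (complex ^ 'k) \<Rightarrow> complex" where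
  "diag_eval ch \<psi> x = - \<i> * eval11 (\<psi> (ch (fst x)) (fst x)) (snd x) (snd x)"

lemma diag_eval_add: "diag_eval ch (add11 \<psi> \<phi>) x = diag_eval ch \<psi> x + diag_eval ch \<phi> x"
  by (simp add: diag_eval_def add11_def eval11_add algebra_simps)

lemma diag_eval_scale: "diag_eval ch (scale11 a \<psi>) x = a * diag_eval ch \<psi> x"
  by (simp add: diag_eval_def scale11_def eval11_scale algebra_simps)

end

context compact_manifold
begin

text \<open>\<open>X\<close> is the unit sphere bundle of the distribution \<open>\<Inter> ker \<alpha>\<^sub>j\<close>.  The point \<open>p\<close> is looked at only in
  the chart \<open>ch p\<close>, taken from a finite family whose compact balls cover the manifold; this makes
  bounds uniform and avoids any transformation rule for \<open>i\<partial>\<close>conj\<open>(\<partial>) f\<close>.\<close>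

context
  fixes \<omega> :: "('m, 'k) two_form" and \<alpha> :: "nat \<Rightarrow> ('m, 'k) one_form"
    and Q :: "(('m, 'k) chart \<times> (complex ^ 'k) \<times> real) set"
    and \<sigma> :: "'m \<Rightarrow> ('m, 'k) chart \<times> (complex ^ 'k) \<times> real"
    and X :: "('m \<times> (complex ^ 'k)) set" and ch :: "'m \<Rightarrow> ('m, 'k) chart"
  assumes \<omega>: "hermitian_form A \<omega>"
    and Q: "finite Q" "\<And>s. s \<in> Q \<Longrightarrow> chart_ball s"
    and \<sigma>: "\<And>p. \<sigma> p \<in> Q" "\<And>p. p \<in> chart_ball_set (\<sigma> p)"
    and ch: "ch = (\<lambda>p. fst (\<sigma> p))"
    and X: "X = {(p, v). (\<forall>j\<in>{1..<CARD('k)}. eval10 (\<alpha> j (ch p) p) v = 0) \<and> diag_eval ch \<omega> (p, v) = 1}"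
begin

lemma ch_in: "ch p \<in> A" "p \<in> fst (ch p)"
  using chart_ball_in[OF Q(2)[OF \<sigma>(1)]] chart_ball_set_subset[OF Q(2)[OF \<sigma>(1)]] \<sigma>(2) by (auto simp: ch)

lemma direction_exists: "\<exists>v. (p, v) \<in> X"
proof -
  obtain u where u: "u \<noteq> 0" "\<forall>j\<in>{1..<CARD('k)}. eval10 (\<alpha> j (ch p) p) u = 0"
    using common_kernel_vector[of "\<lambda>j. \<alpha> j (ch p) p"] by blast
  define t where "t = Re (- \<i> * eval11 (\<omega> (ch p) p) u u)"
  have "- \<i> * eval11 (\<omega> (ch p) p) u u \<in> \<real>\<^sub>\<ge>\<^sub>0 - {0}"
    using \<omega> ch_in u(1) unfolding hermitian_form_def by blast
  then have t: "t > 0" "- \<i> * eval11 (\<omega> (ch p) p) u u = of_real t"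
    by (auto simp: t_def complex_nonneg_Reals_iff complex_eq_iff)
  \<comment> \<open>The value of \<omega> on the diagonal scales by \<open>r\<^sup>2\<close>, while
    the kernel condition is unaffected by scaling.\<close>
  define r where "r = 1 / sqrt t"
  have r: "r\<^sup>2 * t = 1" using t by (simp add: r_def power_divide)
  have "diag_eval ch \<omega> (p, r *\<^sub>R u) = of_real (r\<^sup>2) * (- \<i> * eval11 (\<omega> (ch p) p) u u)"
    by (simp add: diag_eval_def eval11_scaleR algebra_simps)
  also have "\<dots> = of_real (r\<^sup>2 * t)" using t by simp
  finally have "diag_eval ch \<omega> (p, r *\<^sub>R u) = 1" using r by simp
  moreover have "eval10 a (r *\<^sub>R u) = of_real r * eval10 a u" for a
    by (simp add: eval10_def sum_distrib_left scaleR_conv_of_real[where 'a = complex] mult_ac)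
  ultimately have "(p, r *\<^sub>R u) \<in> X" using u(2) by (simp add: X)
  then show ?thesis by blast
qed

text \<open>In a chart ball \<omega> dominates a positive multiple of the squared Euclidean norm, so
  the normalisation \<open>diag_eval ch \<omega> x = 1\<close> bounds the coordinates of the vector;
  finiteness of \<open>Q\<close> makes the bound uniform.\<close>

lemma diag_eval_bound:
  "\<exists>B>0. \<forall>x\<in>X. \<forall>\<psi>. norm (diag_eval ch \<psi> x) \<le> B * norm (\<psi> (ch (fst x)) (fst x))"
proof -
  have "\<exists>m>0. \<forall>p\<in>chart_ball_set s. \<forall>v. m * (norm v)\<^sup>2 \<le> Re (- \<i> * eval11 (\<omega> (fst s) p) v v)" if "s \<in> Q" for s
    using hermitian_form_lower_bound[OF \<omega>] chart_ball_in compact_chart_ball_set chart_ball_set_subset Q(2)[OF that]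
    by blast
  then obtain m where m: "\<And>s. s \<in> Q \<Longrightarrow> m s > 0"
    "\<And>s p v. s \<in> Q \<Longrightarrow> p \<in> chart_ball_set s \<Longrightarrow> m s * (norm v)\<^sup>2 \<le> Re (- \<i> * eval11 (\<omega> (fst s) p) v v)"
    by metis
  \<comment> \<open>A sum of positive terms, used as a crude common bound for all of them.\<close>
  define C where "C = (\<Sum>s\<in>Q. 1 / m s)"
  have C: "1 / m s \<le> C" if "s \<in> Q" for s
    unfolding C_def using that m(1) Q(1) by (intro member_le_sum) (auto intro: less_imp_le)
  \<comment> \<open>The point \<open>undefined\<close> merely provides some element of
    \<open>Q\<close>, so that the sum is positive.\<close>
  have Cpos: "C > 0" using C[OF \<sigma>(1)[of undefined]] m(1)[OF \<sigma>(1)[of undefined]]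
    by (meson less_le_trans zero_less_divide_1_iff)
  define B where "B = (real CARD('k))\<^sup>2 * C"
  have "norm (diag_eval ch \<psi> x) \<le> B * norm (\<psi> (ch (fst x)) (fst x))" if x: "x \<in> X" for x \<psi>
  proof -
    obtain p v where pv: "x = (p, v)" by (cases x)
    have one: "- \<i> * eval11 (\<omega> (fst (\<sigma> p)) p) v v = 1" using x by (simp add: pv X diag_eval_def ch)
    have "m (\<sigma> p) * (norm v)\<^sup>2 \<le> 1" using m(2)[OF \<sigma>, of p v] unfolding one by simp
    then have "(norm v)\<^sup>2 \<le> 1 / m (\<sigma> p)" using m(1)[OF \<sigma>(1)] by (simp add: field_simps)
    also have "\<dots> \<le> C" by (rule C[OF \<sigma>(1)])
    finally have v: "norm v * norm v \<le> C" by (simp add: power2_eq_square)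
    have "norm (diag_eval ch \<psi> x) \<le> (real CARD('k))\<^sup>2 * (norm (\<psi> (ch p) p) * norm v * norm v)"
      using norm_eval11_le[of "\<psi> (ch p) p" v v] by (simp add: diag_eval_def pv norm_mult)
    also have "\<dots> \<le> (real CARD('k))\<^sup>2 * (norm (\<psi> (ch p) p) * C)"
      using v by (intro mult_left_mono) (simp_all add: mult.assoc mult_left_mono)
    finally show ?thesis by (simp add: B_def pv mult_ac)
  qed
  moreover have "B > 0" using Cpos by (simp add: B_def)
  ultimately show ?thesis by blast
qed

lemma diag_eval_bounded:
  assumes "continuous_coeffs A \<psi>"
  shows "\<exists>b. \<forall>x\<in>X. norm (diag_eval ch \<psi> x) \<le> b"
proof -
  obtain B where B: "B > 0" "\<And>x. x \<in> X \<Longrightarrow> norm (diag_eval ch \<psi> x) \<le> B * norm (\<psi> (ch (fst x)) (fst x))"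
    using diag_eval_bound by blast
  have "bounded (\<Union>s\<in>Q. \<psi> (fst s) ` chart_ball_set s)"
  proof (intro bounded_UN Q(1) ballI compact_imp_bounded compact_continuous_image)
    fix s assume s: "s \<in> Q"
    show "compact (chart_ball_set s)" by (rule compact_chart_ball_set[OF Q(2)[OF s]])
    show "continuous_on (chart_ball_set s) (\<psi> (fst s))"
      using assms chart_ball_in[OF Q(2)[OF s]] chart_ball_set_subset[OF Q(2)[OF s]]
      unfolding continuous_coeffs_def by (meson continuous_on_subset)
  qed
  then obtain d where d: "\<And>m. m \<in> (\<Union>s\<in>Q. \<psi> (fst s) ` chart_ball_set s) \<Longrightarrow> norm m \<le> d"
    unfolding bounded_iff by blast
  have "norm (\<psi> (ch p) p) \<le> d" for p
    using \<sigma>[of p] by (intro d) (auto simp: ch)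
  then have "norm (diag_eval ch \<psi> x) \<le> B * d" if "x \<in> X" for x
    using B(2)[OF that] B(1) by (meson less_imp_le mult_left_mono order_trans)
  then show ?thesis by blast
qed

lemma diag_eval_uniform_limit:
  assumes lim: "\<And>s. s \<in> Q \<Longrightarrow> uniform_limit (chart_ball_set s) (\<lambda>n. \<Psi> n (fst s)) (\<psi> (fst s)) sequentially"
    and zero: "\<And>x. x \<in> X \<Longrightarrow> diag_eval ch \<psi> x = 0" and e: "0 < e"
  shows "\<forall>\<^sub>F n in sequentially. \<forall>x\<in>X. norm (diag_eval ch (\<Psi> n) x) \<le> e"
proof -
  obtain B where B: "B > 0" "\<And>x \<psi>. x \<in> X \<Longrightarrow> norm (diag_eval ch \<psi> x) \<le> B * norm (\<psi> (ch (fst x)) (fst x))"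
    using diag_eval_bound by blast
  have "\<forall>s\<in>Q. \<forall>\<^sub>F n in sequentially. \<forall>p\<in>chart_ball_set s. dist (\<Psi> n (fst s) p) (\<psi> (fst s) p) < e / B"
    using lim e B(1) unfolding uniform_limit_iff by simp
  then have "\<forall>\<^sub>F n in sequentially. \<forall>s\<in>Q. \<forall>p\<in>chart_ball_set s. dist (\<Psi> n (fst s) p) (\<psi> (fst s) p) < e / B"
    using Q(1) by (simp add: eventually_ball_finite_distrib)
  then show ?thesis
  proof (rule eventually_mono)
    fix n assume n: "\<forall>s\<in>Q. \<forall>p\<in>chart_ball_set s. dist (\<Psi> n (fst s) p) (\<psi> (fst s) p) < e / B"
    show "\<forall>x\<in>X. norm (diag_eval ch (\<Psi> n) x) \<le> e"
    proof
      fix x assume x: "x \<in> X"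
      let ?d = "\<lambda>c p. \<Psi> n c p - \<psi> c p"
      have "diag_eval ch (\<Psi> n) x = diag_eval ch ?d x"
        using zero[OF x] by (simp add: diag_eval_def eval11_diff)
      then have "norm (diag_eval ch (\<Psi> n) x) \<le> B * norm (?d (ch (fst x)) (fst x))"
        using B(2)[OF x, of ?d] by simp
      also have "\<dots> \<le> B * (e / B)"
        using n \<sigma>[of "fst x"] B(1) by (intro mult_left_mono) (auto simp: ch dist_norm intro: less_imp_le)
      finally show "norm (diag_eval ch (\<Psi> n) x) \<le> e" using B(1) by simp
    qed
  qed
qed

lemma diag_eval_i_del_delbar:
  assumes "smooth_function A f"
  shows "diag_eval ch (i_del_delbar A f) (p, v) = levi_form (\<lambda>x. f (chart_inv (ch p) x)) (snd (ch p) p) v"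
  using eval_i_del_delbar[OF assms ch_in] by (simp add: diag_eval_def)

lemma diag_eval_i_del_delbar_add:
  assumes "smooth_function A f" "smooth_function A g"
  shows "diag_eval ch (i_del_delbar A (\<lambda>p. f p + g p)) x
    = diag_eval ch (i_del_delbar A f) x + diag_eval ch (i_del_delbar A g) x"
proof -
  obtain p v where x: "x = (p, v)" by (cases x)
  show ?thesis
    unfolding x diag_eval_i_del_delbar[OF assms(1)] diag_eval_i_del_delbar[OF assms(2)]
      diag_eval_i_del_delbar[OF smooth_function_add[OF assms]]
    by (rule levi_form_add[OF open_chart_image[OF ch_in(1)] chart_in[OF ch_in]])
      (use assms ch_in(1) in \<open>simp_all only: smooth_function_iff\<close>)
qed

lemma diag_eval_i_del_delbar_mult:
  assumes "smooth_function A f"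
  shows "diag_eval ch (i_del_delbar A (\<lambda>p. z * f p)) x = z * diag_eval ch (i_del_delbar A f) x"
proof -
  obtain p v where x: "x = (p, v)" by (cases x)
  have zf: "smooth_function A (\<lambda>p. z * f p)"
    by (intro smooth_function_mult smooth_function_const assms)
  show ?thesis
    unfolding x diag_eval_i_del_delbar[OF assms] diag_eval_i_del_delbar[OF zf]
    by (rule levi_form_mult[OF open_chart_image[OF ch_in(1)] chart_in[OF ch_in]])
      (use assms ch_in(1) in \<open>simp only: smooth_function_iff\<close>)
qed

lemma diag_eval_i_del_delbar_nonneg:
  assumes f: "smooth_function A f"
  shows "\<exists>x\<in>X. 0 \<le> Re (diag_eval ch (i_del_delbar A f) x)"
proof -
  \<comment> \<open>A minimum of \<open>Re f\<close> is a maximum of \<open>Re g\<close>, to which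
    \<open>levi_form_max\<close> applies; since \<open>X\<close> has a direction over every point,
    it has one over the extremal point.\<close>
  define g where "g p = (-1) * f p" for p
  have g: "smooth_function A g"
    unfolding g_def by (intro smooth_function_mult smooth_function_const f)
  obtain p where p: "\<And>q. Re (g q) \<le> Re (g p)"
    using continuous_attains_sup[OF compact_UNIV _ continuous_on_Re[OF smooth_function_continuous[OF g]]] by auto
  obtain v where v: "(p, v) \<in> X" using direction_exists by blast
  let ?h = "\<lambda>x. g (chart_inv (ch p) x)"
  have "Re (levi_form ?h (snd (ch p) p) v) \<le> 0"
  proof (rule levi_form_max)
    show "open (chart_image (ch p))" "snd (ch p) p \<in> chart_image (ch p)" "diff_order 2 (chart_image (ch p)) ?h"
      using g ch_in open_chart_image chart_in by (auto simp: smooth_function_iff)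
    show "Re (?h y) \<le> Re (?h (snd (ch p) p))" for y
      using p chart_inv_left[OF ch_in] by simp
  qed
  then have "Re (diag_eval ch (i_del_delbar A g) (p, v)) \<le> 0" by (simp add: diag_eval_i_del_delbar[OF g])
  then have "0 \<le> Re (diag_eval ch (i_del_delbar A f) (p, v))"
    unfolding g_def diag_eval_i_del_delbar_mult[OF f] by simp
  with v show ?thesis by blast
qed

lemma directed_harmonic_current:
  assumes \<alpha>: "\<And>j. j \<in> {1..<CARD('k)} \<Longrightarrow> continuous_form10 A (\<alpha> j)"
  shows "\<exists>T. positive_current11 A T \<and> current_mass T \<omega> = 1 \<and>
    (\<forall>j\<in>{1..<CARD('k)}. \<forall>\<beta>. smooth_form01 A \<beta> \<longrightarrow> current_wedge A T (\<alpha> j) \<beta> = 0) \<and>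
    (\<forall>f. smooth_function A f \<longrightarrow> i_del_delbar_current A T f = 0)"
proof -
  define W where "W = {\<lambda>x. Re (diag_eval ch (i_del_delbar A f) x) | f. smooth_function A f}"
  have bd: "bounded_real_on X (\<lambda>x. Re (diag_eval ch \<psi> x))" "bounded_real_on X (\<lambda>x. Im (diag_eval ch \<psi> x))"
    if "continuous_coeffs A \<psi>" for \<psi>
    using diag_eval_bounded[OF that] abs_Re_le_cmod abs_Im_le_cmod
    unfolding bounded_real_on_def by (meson order_trans)+
  have "X \<noteq> {}" using direction_exists by blast
  moreover have "W \<noteq> {}" unfolding W_def using smooth_function_const by blast
  moreover have "bounded_real_on X w" if "w \<in> W" for w
    using that bd(1) i_del_delbar_continuous unfolding W_def by blast
  moreover have "(\<lambda>x. w x + w' x) \<in> W" if w: "w \<in> W" "w' \<in> W" for w w'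
  proof -
    obtain f g where fg: "smooth_function A f" "smooth_function A g"
      "w = (\<lambda>x. Re (diag_eval ch (i_del_delbar A f) x))" "w' = (\<lambda>x. Re (diag_eval ch (i_del_delbar A g) x))"
      using w unfolding W_def by blast
    have "(\<lambda>x. w x + w' x) = (\<lambda>x. Re (diag_eval ch (i_del_delbar A (\<lambda>p. f p + g p)) x))"
      using fg by (simp add: diag_eval_i_del_delbar_add)
    then show ?thesis using smooth_function_add[OF fg(1,2)] by (auto simp: W_def)
  qed
  moreover have "(\<lambda>x. a * w x) \<in> W" if w: "w \<in> W" for w a
  proof -
    obtain f where f: "smooth_function A f" "w = (\<lambda>x. Re (diag_eval ch (i_del_delbar A f) x))"
      using w unfolding W_def by blast
    have "(\<lambda>x. a * w x) = (\<lambda>x. Re (diag_eval ch (i_del_delbar A (\<lambda>p. of_real a * f p)) x))"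
      using f by (simp add: diag_eval_i_del_delbar_mult)
    moreover have "smooth_function A (\<lambda>p. of_real a * f p)"
      by (intro smooth_function_mult smooth_function_const f)
    ultimately show ?thesis by (auto simp: W_def)
  qed
  moreover have "\<exists>x\<in>X. 0 \<le> w x" if "w \<in> W" for w
    using that diag_eval_i_del_delbar_nonneg by (auto simp: W_def)
  ultimately have "\<exists>m. (\<forall>f g. bounded_real_on X f \<longrightarrow> bounded_real_on X g \<longrightarrow> m (\<lambda>x. f x + g x) = m f + m g) \<and>
      (\<forall>f c. bounded_real_on X f \<longrightarrow> m (\<lambda>x. c * f x) = c * m f) \<and>
      (\<forall>f b. bounded_real_on X f \<longrightarrow> (\<forall>x\<in>X. f x \<le> b) \<longrightarrow> m f \<le> b) \<and> (\<forall>w\<in>W. m w = 0)"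
    by (rule mean_vanishing_on_exists)
  then obtain m :: "('m \<times> (complex ^ 'k) \<Rightarrow> real) \<Rightarrow> real" where
    m_add: "\<And>f g. bounded_real_on X f \<Longrightarrow> bounded_real_on X g \<Longrightarrow> m (\<lambda>x. f x + g x) = m f + m g"
    and m_mult: "\<And>f c. bounded_real_on X f \<Longrightarrow> m (\<lambda>x. c * f x) = c * m f"
    and m_le: "\<And>f b. bounded_real_on X f \<Longrightarrow> (\<And>x. x \<in> X \<Longrightarrow> f x \<le> b) \<Longrightarrow> m f \<le> b"
    and m_W: "\<And>w. w \<in> W \<Longrightarrow> m w = 0"
    by blast
  have m_ge: "b \<le> m f" if f: "bounded_real_on X f" and ge: "\<And>x. x \<in> X \<Longrightarrow> b \<le> f x" for f b
  proof -
    have "m (\<lambda>x. (-1) * f x) \<le> - b"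
      using ge by (intro m_le bounded_real_on_mult f) auto
    then show ?thesis using m_mult[OF f, of "-1"] by simp
  qed
  \<comment> \<open>The real functional \<open>m\<close> is extended complex linearly by acting on
    real and imaginary parts separately.\<close>
  define T where "T \<psi> = Complex (m (\<lambda>x. Re (diag_eval ch \<psi> x))) (m (\<lambda>x. Im (diag_eval ch \<psi> x)))" for \<psi>
  have cont: "continuous_coeffs A \<psi>" if "smooth_form11 A \<psi>" for \<psi>
    using that by (simp add: smooth_form11_def smooth_coeffs_continuous)
  note bds = bd[OF cont]
  have T_bound: "norm (T \<psi>) \<le> 2 * b"
    if \<psi>: "smooth_form11 A \<psi>" and b: "\<And>x. x \<in> X \<Longrightarrow> norm (diag_eval ch \<psi> x) \<le> b" for \<psi> b
  proof -
    have x: "\<bar>Re (diag_eval ch \<psi> x)\<bar> \<le> b" "\<bar>Im (diag_eval ch \<psi> x)\<bar> \<le> b" if "x \<in> X" for x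
      using b[OF that] abs_Re_le_cmod abs_Im_le_cmod order_trans by blast+
    have "m (\<lambda>x. Re (diag_eval ch \<psi> x)) \<le> b" "- b \<le> m (\<lambda>x. Re (diag_eval ch \<psi> x))"
      "m (\<lambda>x. Im (diag_eval ch \<psi> x)) \<le> b" "- b \<le> m (\<lambda>x. Im (diag_eval ch \<psi> x))"
      using x by (auto intro!: m_le m_ge bds[OF \<psi>] simp: abs_le_iff) (smt (verit))+
    then have "\<bar>Re (T \<psi>)\<bar> + \<bar>Im (T \<psi>)\<bar> \<le> 2 * b" by (simp add: T_def abs_le_iff)
    then show ?thesis using cmod_le order_trans by blast
  qed
  have T_lim: "(\<lambda>n. T (\<Psi> n)) \<longlonglongrightarrow> 0"
    if \<Psi>: "\<And>n. smooth_form11 A (\<Psi> n)"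
      and lim: "\<And>s. s \<in> Q \<Longrightarrow> uniform_limit (chart_ball_set s) (\<lambda>n. \<Psi> n (fst s)) (\<psi> (fst s)) sequentially"
      and zero: "\<And>x. x \<in> X \<Longrightarrow> diag_eval ch \<psi> x = 0" for \<Psi> \<psi>
  proof (rule tendstoI)
    fix e :: real assume e: "0 < e"
    \<comment> \<open>\<open>T_bound\<close> loses a factor 2, and a third of \<open>e\<close>
      leaves a strict inequality.\<close>
    then have "\<forall>\<^sub>F n in sequentially. \<forall>x\<in>X. norm (diag_eval ch (\<Psi> n) x) \<le> e / 3"
      by (intro diag_eval_uniform_limit[OF lim zero]) auto
    then show "\<forall>\<^sub>F n in sequentially. dist (T (\<Psi> n)) 0 < e"
    proof (rule eventually_mono)
      fix n assume "\<forall>x\<in>X. norm (diag_eval ch (\<Psi> n) x) \<le> e / 3"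
      then have "norm (T (\<Psi> n)) \<le> 2 * (e / 3)" by (intro T_bound \<Psi>) auto
      then show "dist (T (\<Psi> n)) 0 < e" using e by simp
    qed
  qed
  have "current11 A T"
    unfolding current11_def
  proof (intro conjI allI impI)
    fix \<psi> \<phi> assume "smooth_form11 A \<psi> \<and> smooth_form11 A \<phi>"
    then show "T (add11 \<psi> \<phi>) = T \<psi> + T \<phi>"
      by (simp add: T_def diag_eval_add m_add bds complex_eq_iff)
  next
    fix a \<psi> assume \<psi>: "smooth_form11 A \<psi>"
    have Re: "(\<lambda>x. Re (diag_eval ch (scale11 a \<psi>) x)) = (\<lambda>x. Re a * Re (diag_eval ch \<psi> x) + (- Im a) * Im (diag_eval ch \<psi> x))"
      and Im: "(\<lambda>x. Im (diag_eval ch (scale11 a \<psi>) x)) = (\<lambda>x. Re a * Im (diag_eval ch \<psi> x) + Im a * Re (diag_eval ch \<psi> x))"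
      by (simp_all add: diag_eval_scale)
    have "m (\<lambda>x. Re (diag_eval ch (scale11 a \<psi>) x)) = Re a * m (\<lambda>x. Re (diag_eval ch \<psi> x)) + (- Im a) * m (\<lambda>x. Im (diag_eval ch \<psi> x))"
      "m (\<lambda>x. Im (diag_eval ch (scale11 a \<psi>) x)) = Re a * m (\<lambda>x. Im (diag_eval ch \<psi> x)) + Im a * m (\<lambda>x. Re (diag_eval ch \<psi> x))"
      unfolding Re Im
      by (simp_all only: m_add[OF bounded_real_on_mult[OF bds(1)[OF \<psi>]] bounded_real_on_mult[OF bds(2)[OF \<psi>]]]
          m_add[OF bounded_real_on_mult[OF bds(2)[OF \<psi>]] bounded_real_on_mult[OF bds(1)[OF \<psi>]]]
          m_mult[OF bds(1)[OF \<psi>]] m_mult[OF bds(2)[OF \<psi>]])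
    then show "T (scale11 a \<psi>) = a * T \<psi>" by (simp add: T_def complex_eq_iff)
  next
    fix \<Psi> assume \<Psi>: "(\<forall>n. smooth_form11 A (\<Psi> n)) \<and> smooth_null_sequence A \<Psi>"
    show "(\<lambda>n. T (\<Psi> n)) \<longlonglongrightarrow> 0"
    proof (rule T_lim[where \<psi> = "\<lambda>c p. 0"])
      fix s assume s: "s \<in> Q"
      obtain c z r where eq: "s = (c, z, r)" by (cases s)
      have cs: "c \<in> A" "cball z r \<subseteq> chart_image c" using Q(2)[OF s] by (auto simp: eq chart_ball_def)
      \<comment> \<open>Of the convergence of all derivatives, the empty list of directions extracts
        that of the coefficients themselves.\<close>
      have "uniform_limit (cball z r) (\<lambda>n. iter_deriv [] (\<Psi> n c \<circ> chart_inv c)) (\<lambda>_. 0) sequentially"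
        using \<Psi> cs compact_cball unfolding smooth_null_sequence_def by blast
      then show "uniform_limit (chart_ball_set s) (\<lambda>n. \<Psi> n (fst s)) (\<lambda>p. 0) sequentially"
        by (simp add: uniform_limit_iff eq chart_ball_set_def)
    qed (use \<Psi> in \<open>auto simp: diag_eval_def\<close>)
  qed
  moreover have "T \<psi> \<in> \<real>\<^sub>\<ge>\<^sub>0" if \<psi>: "smooth_form11 A \<psi>" and pos: "positive_form11 A \<psi>" for \<psi>
  proof -
    have "diag_eval ch \<psi> x \<in> \<real>\<^sub>\<ge>\<^sub>0" for x
      using pos ch_in unfolding positive_form11_def diag_eval_def by blast
    then have "0 \<le> Re (diag_eval ch \<psi> x)" "Im (diag_eval ch \<psi> x) = 0" for x
      by (simp_all add: complex_nonneg_Reals_iff)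
    then have "0 \<le> m (\<lambda>x. Re (diag_eval ch \<psi> x))" "m (\<lambda>x. Im (diag_eval ch \<psi> x)) = 0"
      using m_ge[OF bds(1)[OF \<psi>], of 0] m_ge[OF bds(2)[OF \<psi>], of 0] m_le[OF bds(2)[OF \<psi>], of 0]
      by (auto intro: order_antisym)
    then show ?thesis by (simp add: T_def complex_nonneg_Reals_iff)
  qed
  moreover have "T \<omega> = 1"
  proof -
    have \<omega>s: "smooth_form11 A \<omega>" using \<omega> by (simp add: hermitian_form_def)
    \<comment> \<open>The normalisation of vectors in \<open>X\<close> was chosen for this: \<omega>
      becomes the constant 1, whose mean is 1.\<close>
    have "diag_eval ch \<omega> x = 1" if "x \<in> X" for x using that by (auto simp: X)
    then have "m (\<lambda>x. Re (diag_eval ch \<omega> x)) = 1" "m (\<lambda>x. Im (diag_eval ch \<omega> x)) = 0"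
      by (auto intro!: order_antisym m_le m_ge bds[OF \<omega>s])
    then show ?thesis by (simp add: T_def complex_eq_iff)
  qed
  moreover have "current_wedge A T (\<alpha> j) \<beta> = 0" if j: "j \<in> {1..<CARD('k)}" and \<beta>: "smooth_form01 A \<beta>" for j \<beta>
  proof -
    note w = wedge_form11[OF \<alpha>[OF j] \<beta>]
    have zero: "diag_eval ch (wedge (\<alpha> j) \<beta>) x = 0" if "x \<in> X" for x
      using that j by (auto simp: X diag_eval_def wedge_def eval11_rank_one)
    have lim: "(\<lambda>n. T (\<Psi> n)) \<longlonglongrightarrow> 0"
      if "(\<forall>n. smooth_form11 A (\<Psi> n)) \<and> uniform_form_limit A \<Psi> (wedge (\<alpha> j) \<beta>)" for \<Psi>
    proof (rule T_lim[OF _ _ zero])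
      show "smooth_form11 A (\<Psi> n)" for n using that by blast
      show "uniform_limit (chart_ball_set s) (\<lambda>n. \<Psi> n (fst s)) (wedge (\<alpha> j) \<beta> (fst s)) sequentially" if "s \<in> Q" for s
        using \<open>_ \<and> uniform_form_limit A \<Psi> _\<close> chart_ball_in compact_chart_ball_set chart_ball_set_subset Q(2)[OF that]
        unfolding uniform_form_limit_def by blast
    qed
    \<comment> \<open>One approximating sequence must exist; otherwise every \<open>z\<close> would
      satisfy the description of the limit vacuously.\<close>
    obtain \<Psi> where \<Psi>: "\<And>n. smooth_form11 A (\<Psi> n)" "uniform_form_limit A \<Psi> (wedge (\<alpha> j) \<beta>)"
      by (rule smooth_form11_dense[OF w]) blast
    show ?thesis
      unfolding current_wedge_def continuous_extension_def
    proof (rule the_equality)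
      fix z assume "\<forall>\<Psi>. (\<forall>n. smooth_form11 A (\<Psi> n)) \<and> uniform_form_limit A \<Psi> (wedge (\<alpha> j) \<beta>) \<longrightarrow> (\<lambda>n. T (\<Psi> n)) \<longlonglongrightarrow> z"
      then have "(\<lambda>n. T (\<Psi> n)) \<longlonglongrightarrow> z" "(\<lambda>n. T (\<Psi> n)) \<longlonglongrightarrow> 0" using \<Psi> lim by blast+
      then show "z = 0" by (rule LIMSEQ_unique)
    qed (use lim in blast)
  qed
  moreover have "i_del_delbar_current A T f = 0" if f: "smooth_function A f" for f
  proof -
    \<comment> \<open>Multiplication of \<open>f\<close> by \<open>-\<i>\<close> turns the imaginary
      part of the diagonal values into a real part, hence into an element of
      \<open>W\<close>.\<close>
    have "smooth_function A (\<lambda>p. - \<i> * f p)"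
      by (intro smooth_function_mult smooth_function_const f)
    then have "(\<lambda>x. Re (diag_eval ch (i_del_delbar A f) x)) \<in> W"
      "(\<lambda>x. Re (diag_eval ch (i_del_delbar A (\<lambda>p. - \<i> * f p)) x)) \<in> W"
      using f unfolding W_def by blast+
    moreover have "Re (diag_eval ch (i_del_delbar A (\<lambda>p. - \<i> * f p)) x) = Im (diag_eval ch (i_del_delbar A f) x)" for x
      unfolding diag_eval_i_del_delbar_mult[OF f] by simp
    ultimately show ?thesis by (simp add: i_del_delbar_current_def T_def m_W complex_eq_iff)
  qed
  ultimately show ?thesis unfolding positive_current11_def current_mass_def by blast
qed

end

end

theorem theorem1p1:
  fixes A :: "('m::t2_space, 'k::finite) chart set"
    and \<omega> :: "('m, 'k) two_form"
    and \<alpha> :: "nat \<Rightarrow> ('m, 'k) one_form"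
  assumes "compact_complex_manifold A"
    and "hermitian_form A \<omega>"
    and "\<And>j. j \<in> {1..<CARD('k)} \<Longrightarrow> continuous_form10 A (\<alpha> j)"
  shows "\<exists>T :: ('m, 'k) two_form \<Rightarrow> complex.
    positive_current11 A T \<and>
    current_mass T \<omega> = 1 \<and>
    (\<forall>j\<in>{1..<CARD('k)}. \<forall>\<beta>. smooth_form01 A \<beta> \<longrightarrow> current_wedge A T (\<alpha> j) \<beta> = 0) \<and>
    (\<forall>f. smooth_function A f \<longrightarrow> i_del_delbar_current A T f = 0)"
proof -
  interpret compact_manifold A
    using assms(1) by unfold_locales (simp_all add: compact_complex_manifold_def)
  obtain Q where Q: "finite Q" "\<And>s. s \<in> Q \<Longrightarrow> chart_ball s" "\<And>p. \<exists>s\<in>Q. chart_bump s p > 0"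
    by (rule finite_chart_balls) blast
  obtain \<sigma> where \<sigma>: "\<And>p. \<sigma> p \<in> Q" "\<And>p. chart_bump (\<sigma> p) p > 0" using Q(3) by metis
  \<comment> \<open>A bump that is positive at \<open>p\<close> cannot have \<open>p\<close> outside
    its compact ball, so the selected balls contain their points.\<close>
  have "p \<in> chart_ball_set (\<sigma> p)" for p
    using chart_bump_eq_0[OF Q(2)[OF \<sigma>(1)]] \<sigma>(2)[of p] by force
  from directed_harmonic_current[OF assms(2) Q(1,2) \<sigma>(1) this refl refl assms(3)]
  show ?thesis .
qed

end
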